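(* Let $R$ be a commutative rig. Then $\mathrm{Mat}(R)$ is the PROP for bicommutative bimonoids $A$ equipped with a map of rigs $\phi: R \to \mathrm{End}(A)$. That is, for every symmetric monoidal category $\mathcal{C}$, the category of algebras of $\mathrm{Mat}(R)$ over $\mathcal{C}$ is equivalent to the category $\mathrm{Bimon}^R$ (formed in $\mathcal{C}$).
   Context: A rig is a ring with unit in which elements are not required to have additive inverses: $(R,+,0)$ is a commutative monoid, $(R,\cdot,1)$ is a monoid, multiplication distributes over addition and $0$ is absorbing. Rig homomorphisms preserve $+,0,\cdot,1$. A PROP is a (strict) symmetric monoidal category whose objects are the natural numbers and whose tensor product on objects is addition. An algebra of a PROP $\mathcal{T}$ over a symmetric monoidal category $\mathcal{C}$ is a (strong) symmetric monoidal functor $\mathcal{T}\to\mathcal{C}$; morphisms of algebras are monoidal natural transformations. $\mathcal{T}$ is called the PROP for a kind of structure if, for each $\mathcal{C}$, the category of algebras of $\mathcal{T}$ over $\mathcal{C}$ is equivalent to the category of such structures in $\mathcal{C}$. For a commutative rig $R$, $\mathrm{Mat}(R)$ is the PROP in which morphisms $m\to n$ are $n\times m$ matrices with entries in $R$, composition is matrix multiplication, the tensor product of $f$ and $g$ is the block diagonal matrix $\begin{pmatrix} f & 0\\ 0& g\end{pmatrix}$, and the symmetry $m+n\to n+m$ is the block matrix $\begin{pmatrix}0&I_n\\ I_m&0\end{pmatrix}$. Let $\mathcal{C}$ be a symmetric monoidal category with unit $I$ and symmetry $\tau$ (associators and unitors are suppressed). A commutative monoid in $\mathcal{C}$ is an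 object $A$ with morphisms $\mu_A: A\otimes A\to A$, $\eta_A: I\to A$ satisfying associativity, the unit laws and commutativity. A cocommutative comonoid is an object $A$ with $\Delta_A: A\to A\otimes A$, $\epsilon_A: A\to I$ satisfying the dual axioms. A bicommutative bimonoid is an object that is both a commutative monoid and a cocommutative comonoid such that $\Delta_A\mu_A=(\mu_A\otimes\mu_A)(1_A\otimes\tau_{AA}\otimes 1_A)(\Delta_A\otimes\Delta_A)$, $\Delta_A\eta_A=\eta_A\otimes\eta_A$, $\epsilon_A\mu_A=\epsilon_A\otimes\epsilon_A$, $\epsilon_A\eta_A=1_I$. A bimonoid homomorphism $f:A\to B$ is a morphism of $\mathcal{C}$ that is both a monoid homomorphism ($\mu_B(f\otimes f)=f\mu_A$, $f\eta_A=\eta_B$) and a comonoid homomorphism ($\Delta_B f=(f\otimes f)\Delta_A$, $\epsilon_B f=\epsilon_A$). For a bicommutative bimonoid $A$, $\mathrm{End}(A)$ is the rig of bimonoid homomorphisms $A\to A$, with addition $f+g=\mu_A(f\otimes g)\Delta_A$, zero $\eta_A\epsilon_A$, multiplication given by composition, and unit $1_A$. The category $\mathrm{Bimon}^R$ has as objects the pairs $(A,\phi_A)$ with $A$ a bicommutative bimonoid in $\mathcal{C}$ and $\phi_A:R\to\mathrm{End}(A)$ a rig homomorphism; a morphism $(A,\phi_A)\to(B,\phi_B)$ is a bimonoid homomorphism $f:A\to B$ with $f\,\phi_A(r)=\phi_B(r)\,f$ for all $r\in R$. *)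

theory Defs
  imports "Jordan_Normal_Form.Matrix"
begin

section \<open>Rigs\<close>

text \<open>The class \<open>comm_semiring_1\<close> demands \<open>0 \<noteq> 1\<close>; the following class does not, so that it also
  covers the one-element rig.\<close>

class comm_rig = comm_semiring_0 + comm_monoid_mult

subclass (in comm_semiring_1) comm_rig ..

text \<open>Unlike \<open>ring_hom\<close>, preservation of zero has to be required explicitly.\<close>

definition rig_hom :: "('m, 'x) ring_scheme \<Rightarrow> ('r::comm_rig \<Rightarrow> 'm) set" where
  "rig_hom E = {\<phi>.
     (\<forall>r. \<phi> r \<in> carrier E) \<and>
     \<phi> 0 = \<zero>\<^bsub>E\<^esub> \<and> (\<forall>r s. \<phi> (r + s) = \<phi> r \<oplus>\<^bsub>E\<^esub> \<phi> s) \<and>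
     \<phi> 1 = \<one>\<^bsub>E\<^esub> \<and> (\<forall>r s. \<phi> (r * s) = \<phi> r \<otimes>\<^bsub>E\<^esub> \<phi> s)}"


section \<open>Categories, functors, equivalences\<close>

text \<open>\<open>g \<cdot> f\<close> is composition in the usual order (first \<open>f\<close>, then \<open>g\<close>).\<close>

record ('o, 'm) category_data =
  Obj :: "'o set"
  Arr :: "'m set"
  Dom :: "'m \<Rightarrow> 'o"
  Cod :: "'m \<Rightarrow> 'o"
  Idn :: "'o \<Rightarrow> 'm"
  Cmp :: "'m \<Rightarrow> 'm \<Rightarrow> 'm" (infixr \<open>\<cdot>\<index>\<close> 70)

definition in_hom :: "('o, 'm, 'x) category_data_scheme \<Rightarrow> 'm \<Rightarrow> 'o \<Rightarrow> 'o \<Rightarrow> bool" where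
  "in_hom C f a b \<longleftrightarrow> f \<in> Arr C \<and> Dom C f = a \<and> Cod C f = b"

locale category =
  fixes C :: "('o, 'm, 'x) category_data_scheme" (structure)
  assumes Dom_Obj: "f \<in> Arr C \<Longrightarrow> Dom C f \<in> Obj C"
    and Cod_Obj: "f \<in> Arr C \<Longrightarrow> Cod C f \<in> Obj C"
    and Idn_hom: "a \<in> Obj C \<Longrightarrow> in_hom C (Idn C a) a a"
    and Cmp_hom: "\<lbrakk>in_hom C f a b; in_hom C g b c\<rbrakk> \<Longrightarrow> in_hom C (g \<cdot> f) a c"
    and Cmp_Idn: "in_hom C f a b \<Longrightarrow> f \<cdot> Idn C a = f"
    and Idn_Cmp: "in_hom C f a b \<Longrightarrow> Idn C b \<cdot> f = f"
    and Cmp_assoc: "\<lbrakk>in_hom C f a b; in_hom C g b c; in_hom C h c d\<rbrakk> \<Longrightarrow>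
                      (h \<cdot> g) \<cdot> f = h \<cdot> (g \<cdot> f)"

definition inverse_arrows :: "('o, 'm, 'x) category_data_scheme \<Rightarrow> 'm \<Rightarrow> 'm \<Rightarrow> bool" where
  "inverse_arrows C f g \<longleftrightarrow>
     f \<in> Arr C \<and> in_hom C g (Cod C f) (Dom C f) \<and>
     g \<cdot>\<^bsub>C\<^esub> f = Idn C (Dom C f) \<and> f \<cdot>\<^bsub>C\<^esub> g = Idn C (Cod C f)"

definition is_iso :: "('o, 'm, 'x) category_data_scheme \<Rightarrow> 'm \<Rightarrow> bool" where
  "is_iso C f \<longleftrightarrow> (\<exists>g. inverse_arrows C f g)"

definition inv_arr :: "('o, 'm, 'x) category_data_scheme \<Rightarrow> 'm \<Rightarrow> 'm" where
  "inv_arr C f = (THE g. inverse_arrows C f g)"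

text \<open>A functor is given by its action \<open>FO\<close> on objects and its action \<open>FA\<close> on arrows.\<close>

locale category_functor = S: category S + T: category T
  for S :: "('o1, 'm1, 'x) category_data_scheme"
    and T :: "('o2, 'm2, 'y) category_data_scheme"
    and FO :: "'o1 \<Rightarrow> 'o2" and FA :: "'m1 \<Rightarrow> 'm2" +
  assumes FO_Obj: "a \<in> Obj S \<Longrightarrow> FO a \<in> Obj T"
    and FA_hom: "in_hom S f a b \<Longrightarrow> in_hom T (FA f) (FO a) (FO b)"
    and FA_Idn: "a \<in> Obj S \<Longrightarrow> FA (Idn S a) = Idn T (FO a)"
    and FA_Cmp: "\<lbrakk>in_hom S f a b; in_hom S g b c\<rbrakk> \<Longrightarrow> FA (g \<cdot>\<^bsub>S\<^esub> f) = FA g \<cdot>\<^bsub>T\<^esub> FA f"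

definition natural_transformation ::
  "('o1, 'm1, 'x) category_data_scheme \<Rightarrow> ('o2, 'm2, 'y) category_data_scheme \<Rightarrow>
   ('o1 \<Rightarrow> 'o2) \<Rightarrow> ('m1 \<Rightarrow> 'm2) \<Rightarrow> ('o1 \<Rightarrow> 'o2) \<Rightarrow> ('m1 \<Rightarrow> 'm2) \<Rightarrow> ('o1 \<Rightarrow> 'm2) \<Rightarrow> bool" where
  "natural_transformation S T FO FA GO GA \<theta> \<longleftrightarrow>
     (\<forall>a\<in>Obj S. in_hom T (\<theta> a) (FO a) (GO a)) \<and>
     (\<forall>f a b. in_hom S f a b \<longrightarrow> \<theta> b \<cdot>\<^bsub>T\<^esub> FA f = GA f \<cdot>\<^bsub>T\<^esub> \<theta> a)"

definition naturally_isomorphic ::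
  "('o1, 'm1, 'x) category_data_scheme \<Rightarrow> ('o2, 'm2, 'y) category_data_scheme \<Rightarrow>
   ('o1 \<Rightarrow> 'o2) \<Rightarrow> ('m1 \<Rightarrow> 'm2) \<Rightarrow> ('o1 \<Rightarrow> 'o2) \<Rightarrow> ('m1 \<Rightarrow> 'm2) \<Rightarrow> bool" where
  "naturally_isomorphic S T FO FA GO GA \<longleftrightarrow>
     (\<exists>\<theta>. natural_transformation S T FO FA GO GA \<theta> \<and> (\<forall>a\<in>Obj S. is_iso T (\<theta> a)))"

definition equivalent_categories ::
  "('o1, 'm1, 'x) category_data_scheme \<Rightarrow> ('o2, 'm2, 'y) category_data_scheme \<Rightarrow> bool" where
  "equivalent_categories S T \<longleftrightarrow>
     category S \<and> category T \<and>
     (\<exists>FO FA GO GA.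
        category_functor S T FO FA \<and> category_functor T S GO GA \<and>
        naturally_isomorphic S S (GO \<circ> FO) (GA \<circ> FA) id id \<and>
        naturally_isomorphic T T (FO \<circ> GO) (FA \<circ> GA) id id)"

text \<open>A category whose hom-sets \<open>H a b\<close> need not be disjoint: arrows are tagged with their domain and
  codomain.\<close>

definition hom_category ::
  "'o set \<Rightarrow> ('o \<Rightarrow> 'o \<Rightarrow> 'h set) \<Rightarrow> ('o \<Rightarrow> 'h) \<Rightarrow> ('h \<Rightarrow> 'h \<Rightarrow> 'h) \<Rightarrow>
   ('o, 'o \<times> 'o \<times> 'h) category_data" where
  "hom_category Ob H i c =
     \<lparr>Obj = Ob,
      Arr = {(a, b, f). a \<in> Ob \<and> b \<in> Ob \<and> f \<in> H a b},
      Dom = (\<lambda>(a, b, f). a),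
      Cod = (\<lambda>(a, b, f). b),
      Idn = (\<lambda>a. (a, a, i a)),
      Cmp = (\<lambda>(b', d, g) (a, b, f). (a, d, c g f))\<rparr>"


section \<open>Symmetric monoidal categories\<close>

text \<open>These are not assumed to be strict: \<open>assoc\<close> is the associator, \<open>lunit\<close> and \<open>runit\<close> are the
  unitors, \<open>symm\<close> is the symmetry.  Tensor products of objects and of arrows are written
  \<open>\<boxdot>\<close> and \<open>\<boxtimes>\<close>.\<close>

record ('o, 'm) smc_data = "('o, 'm) category_data" +
  TenO :: "'o \<Rightarrow> 'o \<Rightarrow> 'o" (infixr \<open>\<boxdot>\<index>\<close> 75)
  TenA :: "'m \<Rightarrow> 'm \<Rightarrow> 'm" (infixr \<open>\<boxtimes>\<index>\<close> 75)
  unit :: 'o (\<open>\<I>\<index>\<close>)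
  assoc :: "'o \<Rightarrow> 'o \<Rightarrow> 'o \<Rightarrow> 'm"
  lunit :: "'o \<Rightarrow> 'm"
  runit :: "'o \<Rightarrow> 'm"
  symm :: "'o \<Rightarrow> 'o \<Rightarrow> 'm"

locale symmetric_monoidal_category = category C
  for C :: "('o, 'm, 'x) smc_data_scheme" (structure) +
  assumes TenO_Obj: "\<lbrakk>a \<in> Obj C; b \<in> Obj C\<rbrakk> \<Longrightarrow> a \<boxdot> b \<in> Obj C"
    and unit_Obj: "\<I> \<in> Obj C"
    and TenA_hom: "\<lbrakk>in_hom C f a b; in_hom C g c d\<rbrakk> \<Longrightarrow> in_hom C (f \<boxtimes> g) (a \<boxdot> c) (b \<boxdot> d)"
    and TenA_Idn: "\<lbrakk>a \<in> Obj C; b \<in> Obj C\<rbrakk> \<Longrightarrow> Idn C a \<boxtimes> Idn C b = Idn C (a \<boxdot> b)"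
    and TenA_Cmp:
      "\<lbrakk>in_hom C f a b; in_hom C g b c; in_hom C f' a' b'; in_hom C g' b' c'\<rbrakk> \<Longrightarrow>
         (g \<cdot> f) \<boxtimes> (g' \<cdot> f') = (g \<boxtimes> g') \<cdot> (f \<boxtimes> f')"
    and assoc_hom:
      "\<lbrakk>a \<in> Obj C; b \<in> Obj C; c \<in> Obj C\<rbrakk> \<Longrightarrow>
         in_hom C (assoc C a b c) ((a \<boxdot> b) \<boxdot> c) (a \<boxdot> (b \<boxdot> c))"
    and assoc_iso: "\<lbrakk>a \<in> Obj C; b \<in> Obj C; c \<in> Obj C\<rbrakk> \<Longrightarrow> is_iso C (assoc C a b c)"
    and assoc_natural:
      "\<lbrakk>in_hom C f a a'; in_hom C g b b'; in_hom C h c c'\<rbrakk> \<Longrightarrow>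
         assoc C a' b' c' \<cdot> ((f \<boxtimes> g) \<boxtimes> h) = (f \<boxtimes> (g \<boxtimes> h)) \<cdot> assoc C a b c"
    and lunit_hom: "a \<in> Obj C \<Longrightarrow> in_hom C (lunit C a) (\<I> \<boxdot> a) a"
    and lunit_iso: "a \<in> Obj C \<Longrightarrow> is_iso C (lunit C a)"
    and lunit_natural:
      "in_hom C f a b \<Longrightarrow> lunit C b \<cdot> (Idn C \<I> \<boxtimes> f) = f \<cdot> lunit C a"
    and runit_hom: "a \<in> Obj C \<Longrightarrow> in_hom C (runit C a) (a \<boxdot> \<I>) a"
    and runit_iso: "a \<in> Obj C \<Longrightarrow> is_iso C (runit C a)"
    and runit_natural:
      "in_hom C f a b \<Longrightarrow> runit C b \<cdot> (f \<boxtimes> Idn C \<I>) = f \<cdot> runit C a"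
    and pentagon:
      "\<lbrakk>a \<in> Obj C; b \<in> Obj C; c \<in> Obj C; d \<in> Obj C\<rbrakk> \<Longrightarrow>
         assoc C a b (c \<boxdot> d) \<cdot> assoc C (a \<boxdot> b) c d =
         (Idn C a \<boxtimes> assoc C b c d) \<cdot> assoc C a (b \<boxdot> c) d \<cdot> (assoc C a b c \<boxtimes> Idn C d)"
    and triangle:
      "\<lbrakk>a \<in> Obj C; b \<in> Obj C\<rbrakk> \<Longrightarrow>
         (Idn C a \<boxtimes> lunit C b) \<cdot> assoc C a \<I> b = runit C a \<boxtimes> Idn C b"
    and symm_hom: "\<lbrakk>a \<in> Obj C; b \<in> Obj C\<rbrakk> \<Longrightarrow> in_hom C (symm C a b) (a \<boxdot> b) (b \<boxdot> a)"
    and symm_natural: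
      "\<lbrakk>in_hom C f a a'; in_hom C g b b'\<rbrakk> \<Longrightarrow>
         symm C a' b' \<cdot> (f \<boxtimes> g) = (g \<boxtimes> f) \<cdot> symm C a b"
    and symm_symm:
      "\<lbrakk>a \<in> Obj C; b \<in> Obj C\<rbrakk> \<Longrightarrow> symm C b a \<cdot> symm C a b = Idn C (a \<boxdot> b)"
    and hexagon:
      "\<lbrakk>a \<in> Obj C; b \<in> Obj C; c \<in> Obj C\<rbrakk> \<Longrightarrow>
         assoc C b c a \<cdot> symm C a (b \<boxdot> c) \<cdot> assoc C a b c =
         (Idn C b \<boxtimes> symm C a c) \<cdot> assoc C b a c \<cdot> (symm C a b \<boxtimes> Idn C c)"


section \<open>PROPs and their algebras\<close>

definition is_PROP :: "(nat, 't, 'x) smc_data_scheme \<Rightarrow> bool" where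
  "is_PROP T \<longleftrightarrow>
     symmetric_monoidal_category T \<and>
     Obj T = UNIV \<and> (\<forall>m n. m \<boxdot>\<^bsub>T\<^esub> n = m + n) \<and> \<I>\<^bsub>T\<^esub> = 0 \<and>
     (\<forall>k m n. assoc T k m n = Idn T (k + m + n)) \<and>
     (\<forall>n. lunit T n = Idn T n) \<and> (\<forall>n. runit T n = Idn T n)"

text \<open>The data of a monoidal functor: actions on objects and arrows, and the structure maps
  \<open>\<Phi>2 a b : F a \<boxdot> F b \<rightarrow> F (a \<boxdot> b)\<close> and \<open>\<Phi>0 : \<I> \<rightarrow> F \<I>\<close>.\<close>

record ('o1, 'm1, 'o2, 'm2) monoidal_functor_data =
  FunO :: "'o1 \<Rightarrow> 'o2"
  FunA :: "'m1 \<Rightarrow> 'm2"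
  Phi2 :: "'o1 \<Rightarrow> 'o1 \<Rightarrow> 'm2"
  Phi0 :: 'm2

locale symmetric_monoidal_functor =
  S: symmetric_monoidal_category S + T: symmetric_monoidal_category T +
  category_functor S T "FunO F" "FunA F"
  for S :: "('o1, 'm1, 'x) smc_data_scheme"
    and T :: "('o2, 'm2, 'y) smc_data_scheme"
    and F :: "('o1, 'm1, 'o2, 'm2) monoidal_functor_data" +
  assumes Phi2_hom:
      "\<lbrakk>a \<in> Obj S; b \<in> Obj S\<rbrakk> \<Longrightarrow>
         in_hom T (Phi2 F a b) (FunO F a \<boxdot>\<^bsub>T\<^esub> FunO F b) (FunO F (a \<boxdot>\<^bsub>S\<^esub> b))"
    and Phi2_iso: "\<lbrakk>a \<in> Obj S; b \<in> Obj S\<rbrakk> \<Longrightarrow> is_iso T (Phi2 F a b)"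
    and Phi2_natural:
      "\<lbrakk>in_hom S f a a'; in_hom S g b b'\<rbrakk> \<Longrightarrow>
         Phi2 F a' b' \<cdot>\<^bsub>T\<^esub> (FunA F f \<boxtimes>\<^bsub>T\<^esub> FunA F g) =
         FunA F (f \<boxtimes>\<^bsub>S\<^esub> g) \<cdot>\<^bsub>T\<^esub> Phi2 F a b"
    and Phi0_hom: "in_hom T (Phi0 F) \<I>\<^bsub>T\<^esub> (FunO F \<I>\<^bsub>S\<^esub>)"
    and Phi0_iso: "is_iso T (Phi0 F)"
    and Phi_assoc:
      "\<lbrakk>a \<in> Obj S; b \<in> Obj S; c \<in> Obj S\<rbrakk> \<Longrightarrow>
         FunA F (assoc S a b c) \<cdot>\<^bsub>T\<^esub> Phi2 F (a \<boxdot>\<^bsub>S\<^esub> b) c \<cdot>\<^bsub>T\<^esub>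
           (Phi2 F a b \<boxtimes>\<^bsub>T\<^esub> Idn T (FunO F c)) =
         Phi2 F a (b \<boxdot>\<^bsub>S\<^esub> c) \<cdot>\<^bsub>T\<^esub> (Idn T (FunO F a) \<boxtimes>\<^bsub>T\<^esub> Phi2 F b c) \<cdot>\<^bsub>T\<^esub>
           assoc T (FunO F a) (FunO F b) (FunO F c)"
    and Phi_lunit:
      "a \<in> Obj S \<Longrightarrow>
         FunA F (lunit S a) \<cdot>\<^bsub>T\<^esub> Phi2 F \<I>\<^bsub>S\<^esub> a \<cdot>\<^bsub>T\<^esub> (Phi0 F \<boxtimes>\<^bsub>T\<^esub> Idn T (FunO F a)) =
         lunit T (FunO F a)"
    and Phi_runit:
      "a \<in> Obj S \<Longrightarrow>
         FunA F (runit S a) \<cdot>\<^bsub>T\<^esub> Phi2 F a \<I>\<^bsub>S\<^esub> \<cdot>\<^bsub>T\<^esub> (Idn T (FunO F a) \<boxtimes>\<^bsub>T\<^esub> Phi0 F) =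
         runit T (FunO F a)"
    and Phi_symm:
      "\<lbrakk>a \<in> Obj S; b \<in> Obj S\<rbrakk> \<Longrightarrow>
         FunA F (symm S a b) \<cdot>\<^bsub>T\<^esub> Phi2 F a b =
         Phi2 F b a \<cdot>\<^bsub>T\<^esub> symm T (FunO F a) (FunO F b)"

definition monoidal_transformation ::
  "('o1, 'm1, 'x) smc_data_scheme \<Rightarrow> ('o2, 'm2, 'y) smc_data_scheme \<Rightarrow>
   ('o1, 'm1, 'o2, 'm2) monoidal_functor_data \<Rightarrow> ('o1, 'm1, 'o2, 'm2) monoidal_functor_data \<Rightarrow>
   ('o1 \<Rightarrow> 'm2) \<Rightarrow> bool" where
  "monoidal_transformation S T F G \<theta> \<longleftrightarrow>
     natural_transformation S T (FunO F) (FunA F) (FunO G) (FunA G) \<theta> \<and>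
     (\<forall>a\<in>Obj S. \<forall>b\<in>Obj S.
        \<theta> (a \<boxdot>\<^bsub>S\<^esub> b) \<cdot>\<^bsub>T\<^esub> Phi2 F a b = Phi2 G a b \<cdot>\<^bsub>T\<^esub> (\<theta> a \<boxtimes>\<^bsub>T\<^esub> \<theta> b)) \<and>
     \<theta> \<I>\<^bsub>S\<^esub> \<cdot>\<^bsub>T\<^esub> Phi0 F = Phi0 G"

text \<open>Extensionality only pins down the value of \<open>FunA F\<close> outside \<open>Arr T\<close>, so that equal functors are
  equal as data; no such condition is needed on objects, every natural number being an object of a
  PROP.\<close>

definition Alg ::
  "(nat, 't, 'x) smc_data_scheme \<Rightarrow> ('o, 'm, 'y) smc_data_scheme \<Rightarrow>
   ((nat, 't, 'o, 'm) monoidal_functor_data,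
    (nat, 't, 'o, 'm) monoidal_functor_data \<times> (nat, 't, 'o, 'm) monoidal_functor_data \<times>
      (nat \<Rightarrow> 'm)) category_data" where
  "Alg T C = hom_category
     {F. symmetric_monoidal_functor T C F \<and> FunA F \<in> extensional (Arr T)}
     (\<lambda>F G. {\<theta>. monoidal_transformation T C F G \<theta>})
     (\<lambda>F n. Idn C (FunO F n))
     (\<lambda>\<psi> \<theta> n. \<psi> n \<cdot>\<^bsub>C\<^esub> \<theta> n)"


section \<open>The PROP of matrices\<close>

text \<open>All matrices over \<open>'r\<close> are arrows; a matrix with \<open>n\<close> rows and \<open>m\<close> columns is an arrow
  from \<open>m\<close> to \<open>n\<close>.\<close>

definition Mat :: "'r::comm_rig itself \<Rightarrow> (nat, 'r mat) smc_data" where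
  "Mat R =
     \<lparr>Obj = UNIV, Arr = UNIV, Dom = dim_col, Cod = dim_row,
      Idn = (\<lambda>n. 1\<^sub>m n), Cmp = (\<lambda>g f. g * f),
      TenO = (\<lambda>m n. m + n),
      TenA = (\<lambda>f g. four_block_mat f (0\<^sub>m (dim_row f) (dim_col g))
                                   (0\<^sub>m (dim_row g) (dim_col f)) g),
      unit = 0,
      assoc = (\<lambda>k m n. 1\<^sub>m (k + m + n)), lunit = (\<lambda>n. 1\<^sub>m n), runit = (\<lambda>n. 1\<^sub>m n),
      symm = (\<lambda>m n. four_block_mat (0\<^sub>m n m) (1\<^sub>m n)
                                    (1\<^sub>m m) (0\<^sub>m m n))\<rparr>"


section \<open>Bicommutative bimonoids\<close>

locale commutative_monoid_in = symmetric_monoidal_category C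
  for C :: "('o, 'm, 'x) smc_data_scheme" (structure) +
  fixes A :: 'o and \<mu> \<eta> :: 'm
  assumes monoid_Obj: "A \<in> Obj C"
    and mul_hom: "in_hom C \<mu> (A \<boxdot> A) A"
    and one_hom: "in_hom C \<eta> \<I> A"
    and mul_assoc: "\<mu> \<cdot> (\<mu> \<boxtimes> Idn C A) = \<mu> \<cdot> (Idn C A \<boxtimes> \<mu>) \<cdot> assoc C A A A"
    and mul_lunit: "\<mu> \<cdot> (\<eta> \<boxtimes> Idn C A) = lunit C A"
    and mul_runit: "\<mu> \<cdot> (Idn C A \<boxtimes> \<eta>) = runit C A"
    and mul_comm: "\<mu> \<cdot> symm C A A = \<mu>"

locale cocommutative_comonoid_in = symmetric_monoidal_category C
  for C :: "('o, 'm, 'x) smc_data_scheme" (structure) +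
  fixes A :: 'o and \<Delta> \<epsilon> :: 'm
  assumes comonoid_Obj: "A \<in> Obj C"
    and comul_hom: "in_hom C \<Delta> A (A \<boxdot> A)"
    and counit_hom: "in_hom C \<epsilon> A \<I>"
    and comul_coassoc: "assoc C A A A \<cdot> (\<Delta> \<boxtimes> Idn C A) \<cdot> \<Delta> = (Idn C A \<boxtimes> \<Delta>) \<cdot> \<Delta>"
    and comul_lcounit: "(\<epsilon> \<boxtimes> Idn C A) \<cdot> \<Delta> = inv_arr C (lunit C A)"
    and comul_rcounit: "(Idn C A \<boxtimes> \<epsilon>) \<cdot> \<Delta> = inv_arr C (runit C A)"
    and comul_cocomm: "symm C A A \<cdot> \<Delta> = \<Delta>"

text \<open>The map \<open>1 \<otimes> \<tau> \<otimes> 1\<close> on \<open>(A \<boxdot> A) \<boxdot> (A \<boxdot> A)\<close>, with the rebracketings written out.\<close>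

definition middle_swap :: "('o, 'm, 'x) smc_data_scheme \<Rightarrow> 'o \<Rightarrow> 'm" where
  "middle_swap C A =
     inv_arr C (assoc C A A (A \<boxdot>\<^bsub>C\<^esub> A)) \<cdot>\<^bsub>C\<^esub>
     (Idn C A \<boxtimes>\<^bsub>C\<^esub>
        (assoc C A A A \<cdot>\<^bsub>C\<^esub> (symm C A A \<boxtimes>\<^bsub>C\<^esub> Idn C A) \<cdot>\<^bsub>C\<^esub> inv_arr C (assoc C A A A))) \<cdot>\<^bsub>C\<^esub>
     assoc C A A (A \<boxdot>\<^bsub>C\<^esub> A)"

record ('o, 'm) bimonoid_data =
  Ob :: 'o
  Mul :: 'm
  One :: 'm
  Comul :: 'm
  Counit :: 'm

locale bicommutative_bimonoid =
  commutative_monoid_in C "Ob A" "Mul A" "One A" +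
  cocommutative_comonoid_in C "Ob A" "Comul A" "Counit A"
  for C :: "('o, 'm, 'x) smc_data_scheme" (structure)
    and A :: "('o, 'm) bimonoid_data" +
  assumes Comul_Mul:
      "Comul A \<cdot> Mul A =
         (Mul A \<boxtimes> Mul A) \<cdot> middle_swap C (Ob A) \<cdot> (Comul A \<boxtimes> Comul A)"
    and Comul_One: "Comul A \<cdot> One A = (One A \<boxtimes> One A) \<cdot> inv_arr C (lunit C \<I>)"
    and Counit_Mul: "Counit A \<cdot> Mul A = lunit C \<I> \<cdot> (Counit A \<boxtimes> Counit A)"
    and Counit_One: "Counit A \<cdot> One A = Idn C \<I>"

definition bimonoid_homs ::
  "('o, 'm, 'x) smc_data_scheme \<Rightarrow> ('o, 'm) bimonoid_data \<Rightarrow> ('o, 'm) bimonoid_data \<Rightarrow> 'm set"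
where
  "bimonoid_homs C A B = {f.
     in_hom C f (Ob A) (Ob B) \<and>
     Mul B \<cdot>\<^bsub>C\<^esub> (f \<boxtimes>\<^bsub>C\<^esub> f) = f \<cdot>\<^bsub>C\<^esub> Mul A \<and> f \<cdot>\<^bsub>C\<^esub> One A = One B \<and>
     Comul B \<cdot>\<^bsub>C\<^esub> f = (f \<boxtimes>\<^bsub>C\<^esub> f) \<cdot>\<^bsub>C\<^esub> Comul A \<and> Counit B \<cdot>\<^bsub>C\<^esub> f = Counit A}"

definition End :: "('o, 'm, 'x) smc_data_scheme \<Rightarrow> ('o, 'm) bimonoid_data \<Rightarrow> 'm ring" where
  "End C A =
     \<lparr>carrier = bimonoid_homs C A A,
      mult = (\<lambda>g f. g \<cdot>\<^bsub>C\<^esub> f),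
      one = Idn C (Ob A),
      zero = One A \<cdot>\<^bsub>C\<^esub> Counit A,
      add = (\<lambda>f g. Mul A \<cdot>\<^bsub>C\<^esub> (f \<boxtimes>\<^bsub>C\<^esub> g) \<cdot>\<^bsub>C\<^esub> Comul A)\<rparr>"

definition BimonR ::
  "'r::comm_rig itself \<Rightarrow> ('o, 'm, 'x) smc_data_scheme \<Rightarrow>
   (('o, 'm) bimonoid_data \<times> ('r \<Rightarrow> 'm),
    (('o, 'm) bimonoid_data \<times> ('r \<Rightarrow> 'm)) \<times> (('o, 'm) bimonoid_data \<times> ('r \<Rightarrow> 'm)) \<times> 'm)
     category_data" where
  "BimonR R C = hom_category
     {(A, \<phi>). bicommutative_bimonoid C A \<and> \<phi> \<in> rig_hom (End C A)}
     (\<lambda>(A, \<phi>) (B, \<psi>). {f \<in> bimonoid_homs C A B. \<forall>r. f \<cdot>\<^bsub>C\<^esub> \<phi> r = \<psi> r \<cdot>\<^bsub>C\<^esub> f})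
     (\<lambda>(A, \<phi>). Idn C (Ob A))
     (\<lambda>g f. g \<cdot>\<^bsub>C\<^esub> f)"

end

theory Submission
  imports Defs
begin

text \<open>
  Cocommutative comonoids in \<open>C\<close> form a cartesian category whose product is \<open>\<otimes>\<close>.  Inside it a
  bicommutative bimonoid \<open>A\<close> with a rig map \<open>\<phi> : R \<rightarrow> End(A)\<close> is an \<open>R\<close>-module object, so a matrix
  acts on the powers of \<open>A\<close> by linear combinations of projections.  That this is a symmetric
  monoidal functor, and that it restores \<open>A\<close>, is checked by composing with projections, which
  replaces all coherence arguments except those needed for the cartesian structure.

  Conversely, an algebra \<open>F\<close> carries the bimonoid \<open>1\<close> of the PROP and its scalar endomorphisms to
  \<open>F 1\<close>.  This assignment is fully faithful: a monoidal transformation is determined by its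
  component at \<open>1\<close>, and the arrows at which a monoidal family is natural are closed under
  composition and direct sums, hence include every matrix once they include the symmetries, the
  bimonoid structure and the scalars.
\<close>

section \<open>Categories\<close>

text \<open>\<open>C\<close> is not strict, so the price of the cartesian structure is the coherence
  of the middle-four interchange with associators, units and symmetry; this is what makes a tensor
  product of comonoids a comonoid again. Cocommutativity is what makes a comultiplication a
  homomorphism, hence a diagonal (Fox's theorem). The bimonoid axioms then say that multiplication
  and unit are arrows of the cartesian category. An arrow \<open>\<phi> r\<close> belongs to that
  category because it respects the comonoid, and is additive for convolution because it respects the
  monoid; the rig laws supply the remaining module axioms. Preservation of composition becomes the
  usual exchange of two finite sums.

  Powers of \<open>A\<close> are left-nested and start at the unit, so the algebra built from
  \<open>A\<close> has \<open>\<I> \<boxdot> A\<close>, not \<open>A\<close>, at the object 1. The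
  left unitor is the comparison, and the equivalence is obtained from essential surjectivity up to
  this isomorphism instead of from an explicit inverse functor.\<close>

context category
begin

lemma Idn_simps [simp]:
  assumes "a \<in> Obj C"
  shows "Idn C a \<in> Arr C" "Dom C (Idn C a) = a" "Cod C (Idn C a) = a"
  using Idn_hom[OF assms] by (auto simp: in_hom_def)

lemma Cmp_simps [simp]:
  assumes "f \<in> Arr C" "g \<in> Arr C" "Dom C g = Cod C f"
  shows "g \<cdot> f \<in> Arr C" "Dom C (g \<cdot> f) = Dom C f" "Cod C (g \<cdot> f) = Cod C g"
  using Cmp_hom[of f _ _ g] assms by (auto simp: in_hom_def)

lemma Cmp_Cmp [simp]:
  assumes "f \<in> Arr C" "g \<in> Arr C" "h \<in> Arr C" "Dom C g = Cod C f" "Dom C h = Cod C g"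
  shows "(h \<cdot> g) \<cdot> f = h \<cdot> g \<cdot> f"
  using Cmp_assoc[of f _ _ g _ h] assms by (auto simp: in_hom_def)

lemma Cmp_Idn' [simp]: "\<lbrakk>f \<in> Arr C; Dom C f = a\<rbrakk> \<Longrightarrow> f \<cdot> Idn C a = f"
  using Cmp_Idn by (auto simp: in_hom_def)

lemma Idn_Cmp' [simp]: "\<lbrakk>f \<in> Arr C; Cod C f = a\<rbrakk> \<Longrightarrow> Idn C a \<cdot> f = f"
  using Idn_Cmp by (auto simp: in_hom_def)

lemma Dom_Cod_Obj [simp]: "f \<in> Arr C \<Longrightarrow> Dom C f \<in> Obj C" "f \<in> Arr C \<Longrightarrow> Cod C f \<in> Obj C"
  by (auto intro: Dom_Obj Cod_Obj)

text \<open>Simplification nests composites to the right, where \<open>x \<cdot> y\<close> is no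
  longer a subterm once another arrow is applied before it. This form of an equation still matches
  there.\<close>

lemma Cmp_reassoc:
  assumes "x \<cdot> y = z" "x \<in> Arr C" "y \<in> Arr C" "Dom C x = Cod C y" "h \<in> Arr C" "Cod C h = Dom C y"
  shows "x \<cdot> y \<cdot> h = z \<cdot> h"
  using assms Cmp_Cmp[of h y x] by simp

lemma inverse_arrows_unique:
  assumes "inverse_arrows C f g" "inverse_arrows C f h"
  shows "g = h"
proof -
  have 1: "f \<in> Arr C" "g \<in> Arr C" "h \<in> Arr C" "Dom C g = Cod C f" "Cod C g = Dom C f"
    "Dom C h = Cod C f" "Cod C h = Dom C f" "g \<cdot> f = Idn C (Dom C f)" "f \<cdot> h = Idn C (Cod C f)"
    using assms by (auto simp: inverse_arrows_def in_hom_def)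
  have "g = g \<cdot> f \<cdot> h" using 1 by simp
  also have "\<dots> = (g \<cdot> f) \<cdot> h" using 1(1-7) by simp
  also have "\<dots> = h" using 1 by simp
  finally show ?thesis .
qed

lemma inv_arr_eqI:
  assumes "f \<in> Arr C" "g \<in> Arr C" "Dom C g = Cod C f" "Cod C g = Dom C f"
    "g \<cdot> f = Idn C (Dom C f)" "f \<cdot> g = Idn C (Cod C f)"
  shows "is_iso C f" "inv_arr C f = g"
proof -
  have g: "inverse_arrows C f g" using assms by (auto simp: inverse_arrows_def in_hom_def)
  then show "is_iso C f" by (auto simp: is_iso_def)
  show "inv_arr C f = g"
    unfolding inv_arr_def using g inverse_arrows_unique by blast
qed

lemma inverse_arrows_inv_arr: "is_iso C f \<Longrightarrow> inverse_arrows C f (inv_arr C f)"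
  unfolding is_iso_def inv_arr_def using inverse_arrows_unique by (metis theI)

lemma iso_Arr: "is_iso C f \<Longrightarrow> f \<in> Arr C"
  by (auto simp: is_iso_def inverse_arrows_def)

lemma inv_arr_simps [simp]:
  assumes "is_iso C f"
  shows "inv_arr C f \<in> Arr C" "Dom C (inv_arr C f) = Cod C f" "Cod C (inv_arr C f) = Dom C f"
    "inv_arr C f \<cdot> f = Idn C (Dom C f)" "f \<cdot> inv_arr C f = Idn C (Cod C f)"
  using inverse_arrows_inv_arr[OF assms] by (auto simp: inverse_arrows_def in_hom_def)

lemma inv_arr_cancel [simp]:
  assumes "is_iso C f" "h \<in> Arr C"
  shows "Cod C h = Dom C f \<Longrightarrow> inv_arr C f \<cdot> f \<cdot> h = h"
    "Cod C h = Cod C f \<Longrightarrow> f \<cdot> inv_arr C f \<cdot> h = h"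
  using assms Cmp_reassoc[OF inv_arr_simps(4)[OF assms(1)]] iso_Arr[OF assms(1)]
    Cmp_reassoc[OF inv_arr_simps(5)[OF assms(1)]]
  by auto

lemma inv_arr_Idn [simp]:
  assumes "a \<in> Obj C"
  shows "is_iso C (Idn C a)" "inv_arr C (Idn C a) = Idn C a"
  using inv_arr_eqI[of "Idn C a" "Idn C a"] assms by auto

lemma is_iso_Cmp:
  assumes "is_iso C f" "is_iso C g" "Dom C g = Cod C f"
  shows "is_iso C (g \<cdot> f)" "inv_arr C (g \<cdot> f) = inv_arr C f \<cdot> inv_arr C g"
proof -
  have "f \<in> Arr C" "g \<in> Arr C" using assms iso_Arr by auto
  then show "is_iso C (g \<cdot> f)" "inv_arr C (g \<cdot> f) = inv_arr C f \<cdot> inv_arr C g"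
    using inv_arr_eqI[of "g \<cdot> f" "inv_arr C f \<cdot> inv_arr C g"] assms by auto
qed

lemma iso_cancel_left:
  assumes "f \<cdot> x = f \<cdot> y" "is_iso C f" "x \<in> Arr C" "y \<in> Arr C" "Cod C x = Dom C f" "Cod C y = Dom C f"
  shows "x = y"
  by (metis assms inv_arr_cancel(1))

lemma iso_cancel_right:
  assumes "x \<cdot> f = y \<cdot> f" "is_iso C f" "x \<in> Arr C" "y \<in> Arr C" "Dom C x = Cod C f" "Dom C y = Cod C f"
  shows "x = y"
proof -
  have f: "f \<in> Arr C" using assms iso_Arr by auto
  have "(x \<cdot> f) \<cdot> inv_arr C f = (y \<cdot> f) \<cdot> inv_arr C f" using assms(1) by (rule arg_cong)
  then show ?thesis using assms(2-) f by simp
qed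

lemma inv_arr_move_left:
  assumes "f \<cdot> x = y" "is_iso C f" "x \<in> Arr C" "Cod C x = Dom C f"
  shows "x = inv_arr C f \<cdot> y"
  using assms by auto

lemma inv_arr_move_right:
  assumes "x \<cdot> f = y" "is_iso C f" "x \<in> Arr C" "Dom C x = Cod C f"
  shows "x = y \<cdot> inv_arr C f"
  using assms iso_Arr[OF assms(2)] by (metis Cmp_Cmp Cmp_Idn' inv_arr_simps(1,3,5))

end

section \<open>Functors, and a criterion for equivalence\<close>

lemma (in category_functor) FA_simps [simp]:
  assumes "f \<in> Arr S"
  shows "FA f \<in> Arr T" "Dom T (FA f) = FO (Dom S f)" "Cod T (FA f) = FO (Cod S f)"
  using FA_hom[of f] assms by (auto simp: in_hom_def)

lemma (in category_functor) FA_Cmp':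
  assumes "f \<in> Arr S" "g \<in> Arr S" "Dom S g = Cod S f"
  shows "FA (g \<cdot>\<^bsub>S\<^esub> f) = FA g \<cdot>\<^bsub>T\<^esub> FA f"
  using FA_Cmp[of f _ _ g] assms by (auto simp: in_hom_def)

lemma (in category_functor) FA_inv_arr:
  assumes "is_iso S f"
  shows "is_iso T (FA f)" "inv_arr T (FA f) = FA (inv_arr S f)"
proof -
  have f: "f \<in> Arr S" using assms by (rule S.iso_Arr)
  show "is_iso T (FA f)" "inv_arr T (FA f) = FA (inv_arr S f)"
    using T.inv_arr_eqI[of "FA f" "FA (inv_arr S f)"] f assms
    by (auto simp: FA_Cmp'[symmetric] FA_Idn)
qed

text \<open>Choice picks a preimage and an isomorphism \<open>\<epsilon> b\<close> for each object
  \<open>b\<close>; the inverse functor conjugates an arrow by these isomorphisms and lifts the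
  result. Equations between lifts are checked after applying \<open>FA\<close>, where the
  isomorphisms cancel.\<close>

lemma (in category_functor) fully_faithful_ess_surj_equivalence:
  assumes full: "\<And>a b g. \<lbrakk>a \<in> Obj S; b \<in> Obj S; in_hom T g (FO a) (FO b)\<rbrakk> \<Longrightarrow>
      \<exists>f. in_hom S f a b \<and> FA f = g"
    and faithful: "\<And>a b f g. \<lbrakk>in_hom S f a b; in_hom S g a b; FA f = FA g\<rbrakk> \<Longrightarrow> f = g"
    and ess_surj: "\<And>b. b \<in> Obj T \<Longrightarrow> \<exists>a\<in>Obj S. \<exists>e. in_hom T e (FO a) b \<and> is_iso T e"
  shows "equivalent_categories S T"
proof -
  obtain GO \<epsilon> where G: "\<And>b. b \<in> Obj T \<Longrightarrow> GO b \<in> Obj S"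
    and \<epsilon>: "\<And>b. b \<in> Obj T \<Longrightarrow> in_hom T (\<epsilon> b) (FO (GO b)) b"
    and iso [simp]: "\<And>b. b \<in> Obj T \<Longrightarrow> is_iso T (\<epsilon> b)"
    using ess_surj by metis
  have \<epsilon>_simps [simp]: "b \<in> Obj T \<Longrightarrow> \<epsilon> b \<in> Arr T" "b \<in> Obj T \<Longrightarrow> Dom T (\<epsilon> b) = FO (GO b)"
    "b \<in> Obj T \<Longrightarrow> Cod T (\<epsilon> b) = b" for b
    using \<epsilon> by (auto simp: in_hom_def)
  \<comment> \<open>The description is legitimate: \<open>full\<close> gives existence of the lift
    and \<open>faithful\<close> its uniqueness.\<close>
  define L where "L a b g = (THE f. in_hom S f a b \<and> FA f = g)" for a b g
  have L: "in_hom S (L a b g) a b \<and> FA (L a b g) = g"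
    if h: "a \<in> Obj S" "b \<in> Obj S" "in_hom T g (FO a) (FO b)" for a b g
  proof -
    obtain f where f: "in_hom S f a b" "FA f = g" using full[OF h] by blast
    then have "L a b g = f" unfolding L_def using faithful by (intro the_equality) auto
    then show ?thesis using f by simp
  qed
  have L_eq: "L a b (FA f) = f" if "in_hom S f a b" for a b f
    unfolding L_def using faithful that by (intro the_equality) auto
  define GA where "GA g = L (GO (Dom T g)) (GO (Cod T g))
      (inv_arr T (\<epsilon> (Cod T g)) \<cdot>\<^bsub>T\<^esub> g \<cdot>\<^bsub>T\<^esub> \<epsilon> (Dom T g))" for g
  have hom: "in_hom T (inv_arr T (\<epsilon> (Cod T g)) \<cdot>\<^bsub>T\<^esub> g \<cdot>\<^bsub>T\<^esub> \<epsilon> (Dom T g))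
      (FO (GO (Dom T g))) (FO (GO (Cod T g)))" if "g \<in> Arr T" for g
    using that by (simp add: in_hom_def)
  have GA: "in_hom S (GA g) (GO (Dom T g)) (GO (Cod T g))"
    "FA (GA g) = inv_arr T (\<epsilon> (Cod T g)) \<cdot>\<^bsub>T\<^esub> g \<cdot>\<^bsub>T\<^esub> \<epsilon> (Dom T g)" if "g \<in> Arr T" for g
    using L[OF _ _ hom[OF that]] that G unfolding GA_def by auto
  have GA_simps [simp]: "GA g \<in> Arr S" "Dom S (GA g) = GO (Dom T g)" "Cod S (GA g) = GO (Cod T g)"
    if "g \<in> Arr T" for g
    using GA(1)[OF that] by (auto simp: in_hom_def)
  have functor_G: "category_functor T S GO GA"
  proof unfold_locales
    fix a assume a: "a \<in> Obj T"
    then show "GO a \<in> Obj S" by (rule G)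
    have "in_hom S (Idn S (GO a)) (GO a) (GO a)" using G[OF a] by (rule S.Idn_hom)
    moreover have "in_hom S (GA (Idn T a)) (GO a) (GO a)" using GA(1)[of "Idn T a"] a by simp
    ultimately show "GA (Idn T a) = Idn S (GO a)"
      using a G[OF a] GA(2)[of "Idn T a"] by (intro faithful) (auto simp: FA_Idn)
  next
    fix f a b assume "in_hom T f a b"
    then show "in_hom S (GA f) (GO a) (GO b)" using GA(1) by (auto simp: in_hom_def)
  next
    fix f a b g c assume "in_hom T f a b" "in_hom T g b c"
    then have h: "f \<in> Arr T" "g \<in> Arr T" "Dom T g = Cod T f" by (auto simp: in_hom_def)
    show "GA (g \<cdot>\<^bsub>T\<^esub> f) = GA g \<cdot>\<^bsub>S\<^esub> GA f"
    proof (rule faithful)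
      show "in_hom S (GA (g \<cdot>\<^bsub>T\<^esub> f)) (GO (Dom T f)) (GO (Cod T g))"
        "in_hom S (GA g \<cdot>\<^bsub>S\<^esub> GA f) (GO (Dom T f)) (GO (Cod T g))"
        using h by (auto simp: in_hom_def)
      show "FA (GA (g \<cdot>\<^bsub>T\<^esub> f)) = FA (GA g \<cdot>\<^bsub>S\<^esub> GA f)"
        using h by (simp add: GA FA_Cmp')
    qed
  qed
  interpret G: category_functor T S GO GA by (rule functor_G)
  \<comment> \<open>The isomorphism \<open>\<epsilon> (FO a)\<close> runs between objects in the
    image, so it lifts to a comparison \<open>GO (FO a) \<rightarrow> a\<close>.\<close>
  define \<theta> where "\<theta> a = L (GO (FO a)) a (\<epsilon> (FO a))" for a
  have \<theta>: "in_hom S (\<theta> a) (GO (FO a)) a" "FA (\<theta> a) = \<epsilon> (FO a)" if "a \<in> Obj S" for a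
    using L[of "GO (FO a)" a "\<epsilon> (FO a)"] that G \<epsilon> FO_Obj unfolding \<theta>_def by auto
  have \<theta>_simps [simp]: "\<theta> a \<in> Arr S" "Dom S (\<theta> a) = GO (FO a)" "Cod S (\<theta> a) = a"
    if "a \<in> Obj S" for a using \<theta>(1)[OF that] by (auto simp: in_hom_def)
  \<comment> \<open>A fully faithful functor reflects isomorphisms: the inverse in \<open>T\<close>
    is lifted. This makes the components of \<open>\<theta>\<close> invertible.\<close>
  have reflect: "is_iso S f" if f: "f \<in> Arr S" and iso_f: "is_iso T (FA f)" for f
  proof -
    obtain g where g: "in_hom S g (Cod S f) (Dom S f)" "FA g = inv_arr T (FA f)"
      using full[of "Cod S f" "Dom S f" "inv_arr T (FA f)"] f iso_f by (auto simp: in_hom_def)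
    then have g': "g \<in> Arr S" "Dom S g = Cod S f" "Cod S g = Dom S f" by (auto simp: in_hom_def)
    show ?thesis
    proof (rule S.inv_arr_eqI)
      show "g \<cdot>\<^bsub>S\<^esub> f = Idn S (Dom S f)"
        by (rule faithful[of _ "Dom S f" "Dom S f"])
          (use that g' g(2) in \<open>auto simp: in_hom_def FA_Cmp' FA_Idn\<close>)
      show "f \<cdot>\<^bsub>S\<^esub> g = Idn S (Cod S f)"
        by (rule faithful[of _ "Cod S f" "Cod S f"])
          (use that g' g(2) in \<open>auto simp: in_hom_def FA_Cmp' FA_Idn\<close>)
    qed (use f g' in auto)
  qed
  have 1: "naturally_isomorphic S S (GO \<circ> FO) (GA \<circ> FA) id id"
    unfolding naturally_isomorphic_def natural_transformation_def
  proof (intro exI[of _ \<theta>] conjI ballI allI impI)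
    fix a assume a: "a \<in> Obj S"
    show "in_hom S (\<theta> a) ((GO \<circ> FO) a) (id a)" using \<theta>(1)[OF a] by simp
    show "is_iso S (\<theta> a)" using reflect a \<theta>(2)[OF a] FO_Obj by simp
  next
    fix f a b assume "in_hom S f a b"
    then have f: "f \<in> Arr S" "a = Dom S f" "b = Cod S f" by (auto simp: in_hom_def)
    have "\<theta> b \<cdot>\<^bsub>S\<^esub> GA (FA f) = f \<cdot>\<^bsub>S\<^esub> \<theta> a"
    proof (rule faithful)
      show "in_hom S (\<theta> b \<cdot>\<^bsub>S\<^esub> GA (FA f)) (GO (FO a)) b" "in_hom S (f \<cdot>\<^bsub>S\<^esub> \<theta> a) (GO (FO a)) b"
        using f by (auto simp: in_hom_def)
      show "FA (\<theta> b \<cdot>\<^bsub>S\<^esub> GA (FA f)) = FA (f \<cdot>\<^bsub>S\<^esub> \<theta> a)"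
        using f \<theta>(2) FO_Obj by (simp add: FA_Cmp' GA(2))
    qed
    then show "\<theta> b \<cdot>\<^bsub>S\<^esub> (GA \<circ> FA) f = id f \<cdot>\<^bsub>S\<^esub> \<theta> a" by simp
  qed
  have 2: "naturally_isomorphic T T (FO \<circ> GO) (FA \<circ> GA) id id"
    unfolding naturally_isomorphic_def natural_transformation_def
    by (intro exI[of _ \<epsilon>] conjI ballI allI impI) (auto simp: \<epsilon> in_hom_def GA(2))
  show ?thesis
    unfolding equivalent_categories_def
    using S.category_axioms T.category_axioms category_functor_axioms functor_G 1 2 by blast
qed

section \<open>Coherence in symmetric monoidal categories\<close>

context symmetric_monoidal_category
begin

abbreviation "\<iota> \<equiv> Idn C"
abbreviation "\<alpha> \<equiv> assoc C"
abbreviation "\<sigma> \<equiv> symm C"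
abbreviation "lu \<equiv> lunit C"
abbreviation "ru \<equiv> runit C"

declare TenO_Obj [simp] unit_Obj [simp] assoc_iso [simp] lunit_iso [simp] runit_iso [simp]

lemma TenA_simps [simp]:
  assumes "f \<in> Arr C" "g \<in> Arr C"
  shows "f \<boxtimes> g \<in> Arr C" "Dom C (f \<boxtimes> g) = Dom C f \<boxdot> Dom C g" "Cod C (f \<boxtimes> g) = Cod C f \<boxdot> Cod C g"
  using TenA_hom[of f _ _ g] assms by (auto simp: in_hom_def)

lemma structure_simps [simp]:
  "\<lbrakk>a \<in> Obj C; b \<in> Obj C; c \<in> Obj C\<rbrakk> \<Longrightarrow> \<alpha> a b c \<in> Arr C"
  "\<lbrakk>a \<in> Obj C; b \<in> Obj C; c \<in> Obj C\<rbrakk> \<Longrightarrow> Dom C (\<alpha> a b c) = (a \<boxdot> b) \<boxdot> c"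
  "\<lbrakk>a \<in> Obj C; b \<in> Obj C; c \<in> Obj C\<rbrakk> \<Longrightarrow> Cod C (\<alpha> a b c) = a \<boxdot> (b \<boxdot> c)"
  "a \<in> Obj C \<Longrightarrow> lu a \<in> Arr C" "a \<in> Obj C \<Longrightarrow> Dom C (lu a) = \<I> \<boxdot> a" "a \<in> Obj C \<Longrightarrow> Cod C (lu a) = a"
  "a \<in> Obj C \<Longrightarrow> ru a \<in> Arr C" "a \<in> Obj C \<Longrightarrow> Dom C (ru a) = a \<boxdot> \<I>" "a \<in> Obj C \<Longrightarrow> Cod C (ru a) = a"
  "\<lbrakk>a \<in> Obj C; b \<in> Obj C\<rbrakk> \<Longrightarrow> \<sigma> a b \<in> Arr C"
  "\<lbrakk>a \<in> Obj C; b \<in> Obj C\<rbrakk> \<Longrightarrow> Dom C (\<sigma> a b) = a \<boxdot> b"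
  "\<lbrakk>a \<in> Obj C; b \<in> Obj C\<rbrakk> \<Longrightarrow> Cod C (\<sigma> a b) = b \<boxdot> a"
  using assoc_hom[of a b c] lunit_hom[of a] runit_hom[of a] symm_hom[of a b] by (auto simp: in_hom_def)

declare TenA_Idn [simp]

lemma TenA_Cmp':
  assumes "f \<in> Arr C" "g \<in> Arr C" "f' \<in> Arr C" "g' \<in> Arr C" "Dom C g = Cod C f" "Dom C g' = Cod C f'"
  shows "(g \<boxtimes> g') \<cdot> (f \<boxtimes> f') = (g \<cdot> f) \<boxtimes> (g' \<cdot> f')"
  using TenA_Cmp[of f _ _ g _ f' _ _ g'] assms by (auto simp: in_hom_def)

text \<open>The second rule of such a pair rewrites inside a right-nested composite.\<close>

lemmas TenA_merge = TenA_Cmp' Cmp_reassoc[OF TenA_Cmp']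

lemma is_iso_TenA [simp]:
  assumes "is_iso C f" "is_iso C g"
  shows "is_iso C (f \<boxtimes> g)" "inv_arr C (f \<boxtimes> g) = inv_arr C f \<boxtimes> inv_arr C g"
proof -
  have "f \<in> Arr C" "g \<in> Arr C" using assms iso_Arr by auto
  then show "is_iso C (f \<boxtimes> g)" "inv_arr C (f \<boxtimes> g) = inv_arr C f \<boxtimes> inv_arr C g"
    using inv_arr_eqI[of "f \<boxtimes> g" "inv_arr C f \<boxtimes> inv_arr C g"] assms by (auto simp: TenA_merge)
qed

lemmas symm_symm' [simp] = symm_symm Cmp_reassoc[OF symm_symm]

lemma symm_iso [simp]:
  assumes "a \<in> Obj C" "b \<in> Obj C"
  shows "is_iso C (\<sigma> a b)" "inv_arr C (\<sigma> a b) = \<sigma> b a"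
  using inv_arr_eqI[of "\<sigma> a b" "\<sigma> b a"] assms by auto

lemma assoc_natural':
  assumes "f \<in> Arr C" "g \<in> Arr C" "h \<in> Arr C" "Cod C f = a" "Cod C g = b" "Cod C h = c"
  shows "\<alpha> a b c \<cdot> ((f \<boxtimes> g) \<boxtimes> h) = (f \<boxtimes> (g \<boxtimes> h)) \<cdot> \<alpha> (Dom C f) (Dom C g) (Dom C h)"
  using assoc_natural[of f _ a g _ b h _ c] assms by (auto simp: in_hom_def)

lemmas assoc_nat = assoc_natural' Cmp_reassoc[OF assoc_natural']

lemma assoc_natural_Idn:
  assumes "h \<in> Arr C" "Cod C h = c" "a \<in> Obj C" "b \<in> Obj C"
  shows "\<alpha> a b c \<cdot> (\<iota> (a \<boxdot> b) \<boxtimes> h) = (\<iota> a \<boxtimes> (\<iota> b \<boxtimes> h)) \<cdot> \<alpha> a b (Dom C h)"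
  using assoc_nat(1)[of "\<iota> a" "\<iota> b" h a b c] assms by simp

lemmas assoc_nat_Idn_left = assoc_natural_Idn Cmp_reassoc[OF assoc_natural_Idn]

lemma lunit_natural':
  assumes "f \<in> Arr C" "Cod C f = b"
  shows "lu b \<cdot> (\<iota> \<I> \<boxtimes> f) = f \<cdot> lu (Dom C f)"
  using lunit_natural[of f _ b] assms by (auto simp: in_hom_def)

lemmas lunit_nat = lunit_natural' Cmp_reassoc[OF lunit_natural']

lemma runit_natural':
  assumes "f \<in> Arr C" "Cod C f = b"
  shows "ru b \<cdot> (f \<boxtimes> \<iota> \<I>) = f \<cdot> ru (Dom C f)"
  using runit_natural[of f _ b] assms by (auto simp: in_hom_def)

lemmas runit_nat = runit_natural' Cmp_reassoc[OF runit_natural']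

lemma symm_natural':
  assumes "f \<in> Arr C" "g \<in> Arr C" "Cod C f = a" "Cod C g = b"
  shows "\<sigma> a b \<cdot> (f \<boxtimes> g) = (g \<boxtimes> f) \<cdot> \<sigma> (Dom C f) (Dom C g)"
  using symm_natural[of f _ a g _ b] assms by (auto simp: in_hom_def)

lemmas symm_nat = symm_natural' Cmp_reassoc[OF symm_natural']

lemmas pentagon_tail = Cmp_reassoc[OF pentagon]

lemmas triangle_tail = Cmp_reassoc[OF triangle]

text \<open>By naturality of the unitors, tensoring with the unit is conjugation by an isomorphism.
  Hence a unit law may be proved after adding a unit factor, where pentagon, triangle or hexagon
  become applicable.\<close>

lemma unit_TenA_faithful:
  assumes "f \<in> Arr C" "g \<in> Arr C" "Dom C f = Dom C g" "Cod C f = Cod C g"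
  shows "\<iota> \<I> \<boxtimes> f = \<iota> \<I> \<boxtimes> g \<Longrightarrow> f = g" "f \<boxtimes> \<iota> \<I> = g \<boxtimes> \<iota> \<I> \<Longrightarrow> f = g"
proof -
  assume "\<iota> \<I> \<boxtimes> f = \<iota> \<I> \<boxtimes> g"
  then have "f \<cdot> lu (Dom C f) = g \<cdot> lu (Dom C f)"
    using lunit_nat(1)[of f] lunit_nat(1)[of g] assms by simp
  then show "f = g" by (rule iso_cancel_right) (use assms in simp_all)
next
  assume "f \<boxtimes> \<iota> \<I> = g \<boxtimes> \<iota> \<I>"
  then have "f \<cdot> ru (Dom C f) = g \<cdot> ru (Dom C f)"
    using runit_nat(1)[of f] runit_nat(1)[of g] assms by simp
  then show "f = g" by (rule iso_cancel_right) (use assms in simp_all)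
qed

text \<open>Kelly's argument: with one more unit on the left, the claim follows from the pentagon on
  \<open>\<I>\<close>, \<open>\<I>\<close>, \<open>a\<close>, \<open>b\<close> and two
  triangles.\<close>

lemma lunit_TenO:
  assumes [simp]: "a \<in> Obj C" "b \<in> Obj C"
  shows "lu (a \<boxdot> b) \<cdot> \<alpha> \<I> a b = lu a \<boxtimes> \<iota> b"
proof (rule unit_TenA_faithful(1), simp_all)
  \<comment> \<open>The source becomes the fully left-nested product, so that \<open>?e\<close>
    followed by \<open>\<iota> \<I> \<boxtimes> \<alpha> \<I> a b\<close> is one side of the
    pentagon.\<close>
  let ?e = "\<alpha> \<I> (\<I> \<boxdot> a) b \<cdot> (\<alpha> \<I> \<I> a \<boxtimes> \<iota> b)"
  show "\<iota> \<I> \<boxtimes> (lu (a \<boxdot> b) \<cdot> \<alpha> \<I> a b) = \<iota> \<I> \<boxtimes> (lu a \<boxtimes> \<iota> b)"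
  proof (rule iso_cancel_right[where f = ?e])
    have "(\<iota> \<I> \<boxtimes> (lu (a \<boxdot> b) \<cdot> \<alpha> \<I> a b)) \<cdot> ?e =
        (\<iota> \<I> \<boxtimes> lu (a \<boxdot> b)) \<cdot> (\<iota> \<I> \<boxtimes> \<alpha> \<I> a b) \<cdot> ?e"
      by (simp add: TenA_merge)
    also have "\<dots> = (\<iota> \<I> \<boxtimes> lu (a \<boxdot> b)) \<cdot> \<alpha> \<I> \<I> (a \<boxdot> b) \<cdot> \<alpha> (\<I> \<boxdot> \<I>) a b"
      by (simp add: pentagon)
    also have "\<dots> = (ru \<I> \<boxtimes> \<iota> (a \<boxdot> b)) \<cdot> \<alpha> (\<I> \<boxdot> \<I>) a b"
      by (simp add: triangle_tail del: TenA_Idn)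
    also have "\<dots> = \<alpha> \<I> a b \<cdot> ((ru \<I> \<boxtimes> \<iota> a) \<boxtimes> \<iota> b)"
      by (simp add: assoc_nat)
    also have "\<dots> = \<alpha> \<I> a b \<cdot> ((\<iota> \<I> \<boxtimes> lu a) \<boxtimes> \<iota> b) \<cdot> (\<alpha> \<I> \<I> a \<boxtimes> \<iota> b)"
      by (simp add: TenA_merge triangle)
    also have "\<dots> = (\<iota> \<I> \<boxtimes> (lu a \<boxtimes> \<iota> b)) \<cdot> ?e"
      by (simp add: assoc_nat)
    finally show "(\<iota> \<I> \<boxtimes> (lu (a \<boxdot> b) \<cdot> \<alpha> \<I> a b)) \<cdot> ?e = (\<iota> \<I> \<boxtimes> (lu a \<boxtimes> \<iota> b)) \<cdot> ?e" .
  qed (simp_all add: is_iso_Cmp)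
qed

text \<open>Mirror image of the previous argument, with the pentagon on \<open>a\<close>,
  \<open>b\<close>, \<open>\<I>\<close>, \<open>\<I>\<close>.\<close>

lemma runit_TenO:
  assumes [simp]: "a \<in> Obj C" "b \<in> Obj C"
  shows "(\<iota> a \<boxtimes> ru b) \<cdot> \<alpha> a b \<I> = ru (a \<boxdot> b)"
proof (rule unit_TenA_faithful(2), simp_all)
  show "((\<iota> a \<boxtimes> ru b) \<cdot> \<alpha> a b \<I>) \<boxtimes> \<iota> \<I> = ru (a \<boxdot> b) \<boxtimes> \<iota> \<I>"
  proof (rule iso_cancel_left[where f = "\<alpha> a b \<I>"])
    have "\<alpha> a b \<I> \<cdot> (((\<iota> a \<boxtimes> ru b) \<cdot> \<alpha> a b \<I>) \<boxtimes> \<iota> \<I>) =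
        \<alpha> a b \<I> \<cdot> ((\<iota> a \<boxtimes> ru b) \<boxtimes> \<iota> \<I>) \<cdot> (\<alpha> a b \<I> \<boxtimes> \<iota> \<I>)"
      by (simp add: TenA_merge)
    also have "\<dots> = (\<iota> a \<boxtimes> (ru b \<boxtimes> \<iota> \<I>)) \<cdot> \<alpha> a (b \<boxdot> \<I>) \<I> \<cdot> (\<alpha> a b \<I> \<boxtimes> \<iota> \<I>)"
      by (simp add: assoc_nat)
    also have "\<dots> = (\<iota> a \<boxtimes> (\<iota> b \<boxtimes> lu \<I>)) \<cdot> (\<iota> a \<boxtimes> \<alpha> b \<I> \<I>) \<cdot> \<alpha> a (b \<boxdot> \<I>) \<I> \<cdot> (\<alpha> a b \<I> \<boxtimes> \<iota> \<I>)"
      by (simp add: TenA_merge triangle)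
    also have "\<dots> = (\<iota> a \<boxtimes> (\<iota> b \<boxtimes> lu \<I>)) \<cdot> \<alpha> a b (\<I> \<boxdot> \<I>) \<cdot> \<alpha> (a \<boxdot> b) \<I> \<I>"
      by (simp add: pentagon)
    also have "\<dots> = \<alpha> a b \<I> \<cdot> (\<iota> (a \<boxdot> b) \<boxtimes> lu \<I>) \<cdot> \<alpha> (a \<boxdot> b) \<I> \<I>"
      by (simp add: assoc_nat_Idn_left)
    also have "\<dots> = \<alpha> a b \<I> \<cdot> (ru (a \<boxdot> b) \<boxtimes> \<iota> \<I>)"
      by (simp add: triangle)
    finally show "\<alpha> a b \<I> \<cdot> (((\<iota> a \<boxtimes> ru b) \<cdot> \<alpha> a b \<I>) \<boxtimes> \<iota> \<I>) = \<alpha> a b \<I> \<cdot> (ru (a \<boxdot> b) \<boxtimes> \<iota> \<I>)" .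
  qed simp_all
qed

lemmas lunit_TenO_tail = Cmp_reassoc[OF lunit_TenO]

lemmas runit_TenO_tail = Cmp_reassoc[OF runit_TenO]

lemma runit_unit: "ru \<I> = lu \<I>"
proof (rule unit_TenA_faithful(2), simp_all)
  \<comment> \<open>Naturality of the unitor with respect to itself; the outer
    \<open>lu \<I>\<close> is then cancelled.\<close>
  have 1: "lu (\<I> \<boxdot> \<I>) = \<iota> \<I> \<boxtimes> lu \<I>"
    by (rule iso_cancel_left[where f = "lu \<I>"]) (simp_all add: lunit_nat)
  have "ru \<I> \<boxtimes> \<iota> \<I> = (\<iota> \<I> \<boxtimes> lu \<I>) \<cdot> \<alpha> \<I> \<I> \<I>" by (simp add: triangle)
  also have "\<dots> = lu \<I> \<boxtimes> \<iota> \<I>" by (simp add: 1[symmetric] lunit_TenO)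
  finally show "ru \<I> \<boxtimes> \<iota> \<I> = lu \<I> \<boxtimes> \<iota> \<I>" .
qed

text \<open>The hexagon on \<open>a\<close>, \<open>\<I>\<close>, \<open>\<I>\<close>, read after
  adding a unit factor and composing with the symmetry.\<close>

lemma lunit_symm:
  assumes [simp]: "a \<in> Obj C"
  shows "lu a \<cdot> \<sigma> a \<I> = ru a"
proof (rule unit_TenA_faithful(2), simp_all)
  show "(lu a \<cdot> \<sigma> a \<I>) \<boxtimes> \<iota> \<I> = ru a \<boxtimes> \<iota> \<I>"
  proof (rule iso_cancel_left[where f = "\<sigma> a \<I>"])
    have "\<sigma> a \<I> \<cdot> ((lu a \<cdot> \<sigma> a \<I>) \<boxtimes> \<iota> \<I>) =
        \<sigma> a \<I> \<cdot> (lu a \<boxtimes> \<iota> \<I>) \<cdot> (\<sigma> a \<I> \<boxtimes> \<iota> \<I>)"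
      by (simp add: TenA_merge)
    also have "\<dots> = \<sigma> a \<I> \<cdot> lu (a \<boxdot> \<I>) \<cdot> \<alpha> \<I> a \<I> \<cdot> (\<sigma> a \<I> \<boxtimes> \<iota> \<I>)"
      by (simp add: lunit_TenO_tail)
    also have "\<dots> = lu (\<I> \<boxdot> a) \<cdot> (\<iota> \<I> \<boxtimes> \<sigma> a \<I>) \<cdot> \<alpha> \<I> a \<I> \<cdot> (\<sigma> a \<I> \<boxtimes> \<iota> \<I>)"
      by (simp add: lunit_nat)
    also have "\<dots> = lu (\<I> \<boxdot> a) \<cdot> \<alpha> \<I> \<I> a \<cdot> \<sigma> a (\<I> \<boxdot> \<I>) \<cdot> \<alpha> a \<I> \<I>"
      by (simp add: hexagon)
    also have "\<dots> = (lu \<I> \<boxtimes> \<iota> a) \<cdot> \<sigma> a (\<I> \<boxdot> \<I>) \<cdot> \<alpha> a \<I> \<I>"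
      by (simp add: lunit_TenO_tail)
    also have "\<dots> = \<sigma> a \<I> \<cdot> (\<iota> a \<boxtimes> lu \<I>) \<cdot> \<alpha> a \<I> \<I>"
      by (simp add: symm_nat)
    also have "\<dots> = \<sigma> a \<I> \<cdot> (ru a \<boxtimes> \<iota> \<I>)"
      by (simp add: triangle)
    finally show "\<sigma> a \<I> \<cdot> ((lu a \<cdot> \<sigma> a \<I>) \<boxtimes> \<iota> \<I>) = \<sigma> a \<I> \<cdot> (ru a \<boxtimes> \<iota> \<I>)" .
  qed simp_all
qed

lemma runit_symm:
  assumes [simp]: "a \<in> Obj C"
  shows "ru a \<cdot> \<sigma> \<I> a = lu a"
  by (simp add: lunit_symm[symmetric])

lemma symm_unit: "\<sigma> \<I> \<I> = \<iota> (\<I> \<boxdot> \<I>)"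
  by (rule iso_cancel_left[where f = "lu \<I>"]) (simp_all add: lunit_symm runit_unit)


section \<open>Transposing the first two factors of a right-nested product\<close>

definition shift :: "'o \<Rightarrow> 'o \<Rightarrow> 'o \<Rightarrow> 'm" where
  "shift b c d = \<alpha> c b d \<cdot> (\<sigma> b c \<boxtimes> \<iota> d) \<cdot> inv_arr C (\<alpha> b c d)"

lemma shift_simps [simp]:
  assumes "b \<in> Obj C" "c \<in> Obj C" "d \<in> Obj C"
  shows "shift b c d \<in> Arr C" "Dom C (shift b c d) = b \<boxdot> (c \<boxdot> d)" "Cod C (shift b c d) = c \<boxdot> (b \<boxdot> d)"
  using assms by (simp_all add: shift_def)

lemma shift_involution:
  assumes "b \<in> Obj C" "c \<in> Obj C" "d \<in> Obj C"
  shows "shift c b d \<cdot> shift b c d = \<iota> (b \<boxdot> (c \<boxdot> d))"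
  using assms by (simp add: shift_def TenA_merge)

lemmas shift_shift = shift_involution Cmp_reassoc[OF shift_involution]

lemma shift_Cmp_assoc:
  assumes "b \<in> Obj C" "c \<in> Obj C" "d \<in> Obj C"
  shows "shift b c d \<cdot> \<alpha> b c d = \<alpha> c b d \<cdot> (\<sigma> b c \<boxtimes> \<iota> d)"
  using assms by (simp add: shift_def)

lemmas shift_assoc = shift_Cmp_assoc Cmp_reassoc[OF shift_Cmp_assoc]

lemma shift_natural:
  assumes [simp]: "f \<in> Arr C" "g \<in> Arr C" "h \<in> Arr C" and "Cod C f = b" "Cod C g = c" "Cod C h = d"
  shows "shift b c d \<cdot> (f \<boxtimes> (g \<boxtimes> h)) = (g \<boxtimes> (f \<boxtimes> h)) \<cdot> shift (Dom C f) (Dom C g) (Dom C h)"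
    (is "?L = ?R")
proof -
  note [simp] = assms(4-6)[symmetric]
  let ?\<alpha> = "\<alpha> (Dom C f) (Dom C g) (Dom C h)"
  have "?L \<cdot> ?\<alpha> = shift b c d \<cdot> \<alpha> b c d \<cdot> ((f \<boxtimes> g) \<boxtimes> h)"
    by (simp add: assoc_nat)
  also have "\<dots> = \<alpha> c b d \<cdot> ((g \<boxtimes> f) \<boxtimes> h) \<cdot> (\<sigma> (Dom C f) (Dom C g) \<boxtimes> \<iota> (Dom C h))"
    by (simp add: shift_assoc TenA_merge symm_nat)
  also have "\<dots> = ?R \<cdot> ?\<alpha>"
    by (simp add: assoc_nat shift_assoc)
  finally show ?thesis
    by (rule iso_cancel_right) simp_all
qed

lemmas shift_nat = shift_natural Cmp_reassoc[OF shift_natural]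

text \<open>A spectator factor \<open>w\<close> on the right can be absorbed into the third factor.
  Two pentagons move the brackets; they become visible after undoing the first associator inside
  \<open>shift\<close>.\<close>

lemma shift_whisker:
  assumes [simp]: "b \<in> Obj C" "c \<in> Obj C" "d \<in> Obj C" "w \<in> Obj C"
  shows "(\<iota> c \<boxtimes> \<alpha> b d w) \<cdot> \<alpha> c (b \<boxdot> d) w \<cdot> (shift b c d \<boxtimes> \<iota> w) =
    shift b c (d \<boxdot> w) \<cdot> (\<iota> b \<boxtimes> \<alpha> c d w) \<cdot> \<alpha> b (c \<boxdot> d) w" (is "?L = ?R")
proof (rule iso_cancel_right[where f = "\<alpha> b c d \<boxtimes> \<iota> w"])
  have "?L \<cdot> (\<alpha> b c d \<boxtimes> \<iota> w) =
      (\<iota> c \<boxtimes> \<alpha> b d w) \<cdot> \<alpha> c (b \<boxdot> d) w \<cdot> (\<alpha> c b d \<boxtimes> \<iota> w) \<cdot> ((\<sigma> b c \<boxtimes> \<iota> d) \<boxtimes> \<iota> w)"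
    by (simp add: TenA_merge shift_assoc)
  also have "\<dots> = \<alpha> c b (d \<boxdot> w) \<cdot> \<alpha> (c \<boxdot> b) d w \<cdot> ((\<sigma> b c \<boxtimes> \<iota> d) \<boxtimes> \<iota> w)"
    by (simp add: pentagon_tail)
  also have "\<dots> = \<alpha> c b (d \<boxdot> w) \<cdot> (\<sigma> b c \<boxtimes> \<iota> (d \<boxdot> w)) \<cdot> \<alpha> (b \<boxdot> c) d w"
    by (simp add: assoc_nat)
  also have "\<dots> = shift b c (d \<boxdot> w) \<cdot> \<alpha> b c (d \<boxdot> w) \<cdot> \<alpha> (b \<boxdot> c) d w"
    by (simp add: shift_assoc)
  also have "\<dots> = ?R \<cdot> (\<alpha> b c d \<boxtimes> \<iota> w)"
    by (simp add: pentagon)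
  finally show "?L \<cdot> (\<alpha> b c d \<boxtimes> \<iota> w) = ?R \<cdot> (\<alpha> b c d \<boxtimes> \<iota> w)" .
qed simp_all

text \<open>The hexagon with a spectator \<open>z\<close>: moving \<open>b\<close> past
  \<open>c \<boxdot> e\<close> means moving it past \<open>c\<close> and then past
  \<open>e\<close>.\<close>

lemma shift_TenO_right:
  assumes [simp]: "b \<in> Obj C" "c \<in> Obj C" "e \<in> Obj C" "z \<in> Obj C"
  shows "\<alpha> c e (b \<boxdot> z) \<cdot> shift b (c \<boxdot> e) z =
    (\<iota> c \<boxtimes> shift b e z) \<cdot> shift b c (e \<boxdot> z) \<cdot> (\<iota> b \<boxtimes> \<alpha> c e z)" (is "?L = ?R")
proof (rule iso_cancel_right[where f = "\<alpha> b (c \<boxdot> e) z \<cdot> (\<alpha> b c e \<boxtimes> \<iota> z)"])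
  let ?e = "\<alpha> b (c \<boxdot> e) z \<cdot> (\<alpha> b c e \<boxtimes> \<iota> z)"
  have hex: "\<alpha> c e b \<cdot> \<sigma> b (c \<boxdot> e) \<cdot> \<alpha> b c e =
      (\<iota> c \<boxtimes> \<sigma> b e) \<cdot> \<alpha> c b e \<cdot> (\<sigma> b c \<boxtimes> \<iota> e)"
    by (simp add: hexagon)
  have "?L \<cdot> ?e = \<alpha> c e (b \<boxdot> z) \<cdot> \<alpha> (c \<boxdot> e) b z \<cdot> ((\<sigma> b (c \<boxdot> e) \<cdot> \<alpha> b c e) \<boxtimes> \<iota> z)"
    by (simp add: shift_assoc TenA_merge)
  also have "\<dots> = (\<iota> c \<boxtimes> \<alpha> e b z) \<cdot> \<alpha> c (e \<boxdot> b) z \<cdot> ((\<alpha> c e b \<cdot> \<sigma> b (c \<boxdot> e) \<cdot> \<alpha> b c e) \<boxtimes> \<iota> z)"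
    by (simp add: pentagon_tail TenA_merge)
  also have "\<dots> = (\<iota> c \<boxtimes> \<alpha> e b z) \<cdot> \<alpha> c (e \<boxdot> b) z \<cdot>
      ((\<iota> c \<boxtimes> \<sigma> b e) \<boxtimes> \<iota> z) \<cdot> (\<alpha> c b e \<boxtimes> \<iota> z) \<cdot> ((\<sigma> b c \<boxtimes> \<iota> e) \<boxtimes> \<iota> z)"
    unfolding hex by (simp add: TenA_merge)
  also have "\<dots> = (\<iota> c \<boxtimes> \<alpha> e b z) \<cdot> (\<iota> c \<boxtimes> (\<sigma> b e \<boxtimes> \<iota> z)) \<cdot> \<alpha> c (b \<boxdot> e) z \<cdot>
      (\<alpha> c b e \<boxtimes> \<iota> z) \<cdot> ((\<sigma> b c \<boxtimes> \<iota> e) \<boxtimes> \<iota> z)"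
    by (simp add: assoc_nat)
  also have "\<dots> = (\<iota> c \<boxtimes> shift b e z) \<cdot> (\<iota> c \<boxtimes> \<alpha> b e z) \<cdot> \<alpha> c (b \<boxdot> e) z \<cdot>
      (\<alpha> c b e \<boxtimes> \<iota> z) \<cdot> ((\<sigma> b c \<boxtimes> \<iota> e) \<boxtimes> \<iota> z)"
    by (simp add: shift_assoc[symmetric] TenA_merge)
  also have "\<dots> = (\<iota> c \<boxtimes> shift b e z) \<cdot> \<alpha> c b (e \<boxdot> z) \<cdot> \<alpha> (c \<boxdot> b) e z \<cdot> ((\<sigma> b c \<boxtimes> \<iota> e) \<boxtimes> \<iota> z)"
    by (simp add: pentagon_tail)
  also have "\<dots> = (\<iota> c \<boxtimes> shift b e z) \<cdot> shift b c (e \<boxdot> z) \<cdot> \<alpha> b c (e \<boxdot> z) \<cdot> \<alpha> (b \<boxdot> c) e z"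
    by (simp add: assoc_nat shift_assoc)
  also have "\<dots> = ?R \<cdot> ?e" by (simp add: pentagon)
  finally show "?L \<cdot> ?e = ?R \<cdot> ?e" .
qed (simp_all add: is_iso_Cmp)

text \<open>This is the inverse of \<open>shift_TenO_right\<close> with the roles exchanged, since
  \<open>shift\<close> is inverted by swapping its first two arguments.\<close>

lemma shift_TenO_left:
  assumes [simp]: "b \<in> Obj C" "d \<in> Obj C" "e \<in> Obj C" "f \<in> Obj C"
  shows "(\<iota> e \<boxtimes> \<alpha> b d f) \<cdot> shift (b \<boxdot> d) e f =
    shift b e (d \<boxdot> f) \<cdot> (\<iota> b \<boxtimes> shift d e f) \<cdot> \<alpha> b d (e \<boxdot> f)" (is "?L = ?R")
proof -
  let ?X = "\<alpha> b d (e \<boxdot> f) \<cdot> shift e (b \<boxdot> d) f"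
  let ?Y = "(\<iota> b \<boxtimes> shift e d f) \<cdot> shift e b (d \<boxdot> f) \<cdot> (\<iota> e \<boxtimes> \<alpha> b d f)"
  have XY: "?X = ?Y" by (rule shift_TenO_right) simp_all
  \<comment> \<open>Inserting \<open>?Y\<close> next to its inverse and replacing it by
    \<open>?X\<close> inverts the equation \<open>XY\<close>.\<close>
  have "?L = shift b e (d \<boxdot> f) \<cdot> (\<iota> b \<boxtimes> shift d e f) \<cdot> ?X \<cdot> shift (b \<boxdot> d) e f"
    unfolding XY by (simp add: shift_shift TenA_merge(2))
  also have "\<dots> = ?R"
    by (simp add: shift_shift)
  finally show ?thesis .
qed

lemma symm_TenO_right:
  assumes [simp]: "a \<in> Obj C" "b \<in> Obj C" "c \<in> Obj C"
  shows "\<alpha> b c a \<cdot> \<sigma> a (b \<boxdot> c) = (\<iota> b \<boxtimes> \<sigma> a c) \<cdot> shift a b c"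
  by (rule iso_cancel_right[where f = "\<alpha> a b c"]) (simp_all add: shift_assoc hexagon)

text \<open>Obtained from \<open>symm_TenO_right\<close> by passing to inverses, so a second hexagon
  axiom is not assumed.\<close>

lemma symm_TenO_left:
  assumes [simp]: "a \<in> Obj C" "c \<in> Obj C" "d \<in> Obj C"
  shows "\<sigma> (a \<boxdot> c) d = shift a d c \<cdot> (\<iota> a \<boxtimes> \<sigma> c d) \<cdot> \<alpha> a c d"
proof -
  let ?R = "shift a d c \<cdot> (\<iota> a \<boxtimes> \<sigma> c d) \<cdot> \<alpha> a c d"
  let ?X = "\<alpha> a c d \<cdot> \<sigma> d (a \<boxdot> c)" and ?Y = "(\<iota> a \<boxtimes> \<sigma> d c) \<cdot> shift d a c"
  have XY: "?X = ?Y" by (rule symm_TenO_right) simp_all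
  have "?R = shift a d c \<cdot> (\<iota> a \<boxtimes> \<sigma> c d) \<cdot> ?X \<cdot> \<sigma> (a \<boxdot> c) d"
    by simp
  also have "\<dots> = \<sigma> (a \<boxdot> c) d"
    unfolding XY by (simp add: TenA_merge shift_shift)
  finally show ?thesis by simp
qed

section \<open>The middle-four interchange: \<open>middle_swap\<close> for four possibly different
  objects, and its coherence\<close>

definition mid :: "'o \<Rightarrow> 'o \<Rightarrow> 'o \<Rightarrow> 'o \<Rightarrow> 'm" where
  "mid a b c d = inv_arr C (\<alpha> a c (b \<boxdot> d)) \<cdot> (\<iota> a \<boxtimes> shift b c d) \<cdot> \<alpha> a b (c \<boxdot> d)"

lemma mid_simps [simp]:
  assumes "a \<in> Obj C" "b \<in> Obj C" "c \<in> Obj C" "d \<in> Obj C"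
  shows "mid a b c d \<in> Arr C" "Dom C (mid a b c d) = (a \<boxdot> b) \<boxdot> (c \<boxdot> d)"
    "Cod C (mid a b c d) = (a \<boxdot> c) \<boxdot> (b \<boxdot> d)"
  using assms by (simp_all add: mid_def)

lemma middle_swap_eq_mid: "middle_swap C a = mid a a a a"
  by (simp add: middle_swap_def mid_def shift_def)

lemma assoc_Cmp_mid:
  assumes "a \<in> Obj C" "b \<in> Obj C" "c \<in> Obj C" "d \<in> Obj C"
  shows "\<alpha> a c (b \<boxdot> d) \<cdot> mid a b c d = (\<iota> a \<boxtimes> shift b c d) \<cdot> \<alpha> a b (c \<boxdot> d)"
  using assms by (simp add: mid_def)

lemmas assoc_mid = assoc_Cmp_mid Cmp_reassoc[OF assoc_Cmp_mid]

lemma mid_involution: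
  assumes [simp]: "a \<in> Obj C" "b \<in> Obj C" "c \<in> Obj C" "d \<in> Obj C"
  shows "mid a c b d \<cdot> mid a b c d = \<iota> ((a \<boxdot> b) \<boxdot> (c \<boxdot> d))"
  by (rule iso_cancel_left[where f = "\<alpha> a b (c \<boxdot> d)"])
    (simp_all add: assoc_mid TenA_merge shift_shift)

lemmas mid_mid = mid_involution Cmp_reassoc[OF mid_involution]

lemma mid_natural:
  assumes [simp]: "f \<in> Arr C" "g \<in> Arr C" "h \<in> Arr C" "k \<in> Arr C"
    and "Cod C f = a" "Cod C g = b" "Cod C h = c" "Cod C k = d"
  shows "mid a b c d \<cdot> ((f \<boxtimes> g) \<boxtimes> (h \<boxtimes> k)) =
      ((f \<boxtimes> h) \<boxtimes> (g \<boxtimes> k)) \<cdot> mid (Dom C f) (Dom C g) (Dom C h) (Dom C k)"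
proof -
  note [simp] = assms(5-8)[symmetric]
  show ?thesis
    by (rule iso_cancel_left[where f = "\<alpha> a c (b \<boxdot> d)"])
      (simp_all add: assoc_mid assoc_nat shift_nat TenA_merge)
qed

lemmas mid_nat = mid_natural Cmp_reassoc[OF mid_natural]

text \<open>Associativity coherence of the interchange, the law that makes the tensor product itself
  a monoidal functor. Both sides are brought to one normal form in which \<open>b\<close> and
  \<open>d\<close> are moved past the other factors one \<open>shift\<close> at a time.\<close>

lemma mid_assoc:
  assumes [simp]: "a \<in> Obj C" "b \<in> Obj C" "c \<in> Obj C" "d \<in> Obj C" "e \<in> Obj C" "f \<in> Obj C"
  shows "(\<alpha> a c e \<boxtimes> \<alpha> b d f) \<cdot> mid (a \<boxdot> c) (b \<boxdot> d) e f \<cdot> (mid a b c d \<boxtimes> \<iota> (e \<boxdot> f)) =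
    mid a b (c \<boxdot> e) (d \<boxdot> f) \<cdot> (\<iota> (a \<boxdot> b) \<boxtimes> mid c d e f) \<cdot> \<alpha> (a \<boxdot> b) (c \<boxdot> d) (e \<boxdot> f)"
    (is "?L = ?R")
proof -
  define w where "w = e \<boxdot> f"
  define X where "X = b \<boxdot> (d \<boxdot> f)"
  have w [simp]: "w \<in> Obj C" and X [simp]: "X \<in> Obj C" by (simp_all add: w_def X_def)
  \<comment> \<open>Postcomposing with \<open>?K\<close> brackets the common target fully to the
    right; \<open>?N\<close> below is the value both sides then take.\<close>
  let ?K = "(\<iota> a \<boxtimes> \<alpha> c e X) \<cdot> \<alpha> a (c \<boxdot> e) X"
  let ?S = "shift b e (d \<boxdot> f)" and ?T = "\<iota> b \<boxtimes> shift d e f"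
  let ?U = "(\<iota> c \<boxtimes> ?S) \<cdot> (\<iota> c \<boxtimes> ?T) \<cdot> shift b c (d \<boxdot> w) \<cdot> (\<iota> b \<boxtimes> \<alpha> c d w)"
  let ?N = "(\<iota> a \<boxtimes> ?U) \<cdot> \<alpha> a b ((c \<boxdot> d) \<boxdot> w) \<cdot> \<alpha> (a \<boxdot> b) (c \<boxdot> d) w"
  have "?K \<cdot> ?R = (\<iota> a \<boxtimes> \<alpha> c e X) \<cdot> (\<iota> a \<boxtimes> shift b (c \<boxdot> e) (d \<boxdot> f)) \<cdot>
      (\<iota> a \<boxtimes> (\<iota> b \<boxtimes> mid c d e f)) \<cdot> \<alpha> a b ((c \<boxdot> d) \<boxdot> w) \<cdot> \<alpha> (a \<boxdot> b) (c \<boxdot> d) w"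
    by (simp add: assoc_mid assoc_nat_Idn_left X_def w_def)
  also have "\<dots> = (\<iota> a \<boxtimes> ((\<alpha> c e X \<cdot> shift b (c \<boxdot> e) (d \<boxdot> f)) \<cdot> (\<iota> b \<boxtimes> mid c d e f))) \<cdot>
      \<alpha> a b ((c \<boxdot> d) \<boxdot> w) \<cdot> \<alpha> (a \<boxdot> b) (c \<boxdot> d) w"
    by (simp add: TenA_merge X_def w_def)
  also have "(\<alpha> c e X \<cdot> shift b (c \<boxdot> e) (d \<boxdot> f)) \<cdot> (\<iota> b \<boxtimes> mid c d e f) =
      (\<iota> c \<boxtimes> ?S) \<cdot> shift b c (e \<boxdot> (d \<boxdot> f)) \<cdot> (\<iota> b \<boxtimes> (\<alpha> c e (d \<boxdot> f) \<cdot> mid c d e f))"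
    unfolding X_def by (subst shift_TenO_right) (simp_all add: TenA_merge)
  also have "\<iota> b \<boxtimes> (\<alpha> c e (d \<boxdot> f) \<cdot> mid c d e f) =
      (\<iota> b \<boxtimes> (\<iota> c \<boxtimes> shift d e f)) \<cdot> (\<iota> b \<boxtimes> \<alpha> c d w)"
    by (simp add: assoc_mid TenA_merge w_def)
  also have "(\<iota> c \<boxtimes> ?S) \<cdot> shift b c (e \<boxdot> (d \<boxdot> f)) \<cdot>
      (\<iota> b \<boxtimes> (\<iota> c \<boxtimes> shift d e f)) \<cdot> (\<iota> b \<boxtimes> \<alpha> c d w) = ?U"
    by (simp add: shift_nat w_def)
  finally have R: "?K \<cdot> ?R = ?N" .
  have split: "\<alpha> a c e \<boxtimes> \<alpha> b d f = (\<alpha> a c e \<boxtimes> \<iota> X) \<cdot> (\<iota> ((a \<boxdot> c) \<boxdot> e) \<boxtimes> \<alpha> b d f)"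
    by (simp add: TenA_merge X_def)
  have "?K \<cdot> ?L = \<alpha> a c (e \<boxdot> X) \<cdot> \<alpha> (a \<boxdot> c) e X \<cdot> (\<iota> ((a \<boxdot> c) \<boxdot> e) \<boxtimes> \<alpha> b d f) \<cdot>
      mid (a \<boxdot> c) (b \<boxdot> d) e f \<cdot> (mid a b c d \<boxtimes> \<iota> w)"
    unfolding split by (simp add: pentagon_tail X_def w_def)
  also have "\<dots> = \<alpha> a c (e \<boxdot> X) \<cdot> (\<iota> (a \<boxdot> c) \<boxtimes> (\<iota> e \<boxtimes> \<alpha> b d f)) \<cdot>
      (\<iota> (a \<boxdot> c) \<boxtimes> shift (b \<boxdot> d) e f) \<cdot> \<alpha> (a \<boxdot> c) (b \<boxdot> d) w \<cdot> (mid a b c d \<boxtimes> \<iota> w)"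
    by (simp add: assoc_nat_Idn_left assoc_mid X_def w_def)
  also have "\<dots> = \<alpha> a c (e \<boxdot> X) \<cdot> (\<iota> (a \<boxdot> c) \<boxtimes> ((\<iota> e \<boxtimes> \<alpha> b d f) \<cdot> shift (b \<boxdot> d) e f)) \<cdot>
      \<alpha> (a \<boxdot> c) (b \<boxdot> d) w \<cdot> (mid a b c d \<boxtimes> \<iota> w)"
    by (simp add: TenA_merge X_def w_def)
  also have "(\<iota> e \<boxtimes> \<alpha> b d f) \<cdot> shift (b \<boxdot> d) e f = ?S \<cdot> ?T \<cdot> \<alpha> b d w"
    by (simp add: shift_TenO_left w_def)
  also have "\<alpha> a c (e \<boxdot> X) \<cdot> (\<iota> (a \<boxdot> c) \<boxtimes> (?S \<cdot> ?T \<cdot> \<alpha> b d w)) \<cdot>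
      \<alpha> (a \<boxdot> c) (b \<boxdot> d) w \<cdot> (mid a b c d \<boxtimes> \<iota> w) =
      (\<iota> a \<boxtimes> (\<iota> c \<boxtimes> (?S \<cdot> ?T \<cdot> \<alpha> b d w))) \<cdot> \<alpha> a c ((b \<boxdot> d) \<boxdot> w) \<cdot>
      \<alpha> (a \<boxdot> c) (b \<boxdot> d) w \<cdot> (mid a b c d \<boxtimes> \<iota> w)"
    by (simp add: assoc_nat_Idn_left X_def w_def)
  also have "\<alpha> a c ((b \<boxdot> d) \<boxdot> w) \<cdot> \<alpha> (a \<boxdot> c) (b \<boxdot> d) w \<cdot> (mid a b c d \<boxtimes> \<iota> w) =
      (\<iota> a \<boxtimes> \<alpha> c (b \<boxdot> d) w) \<cdot> \<alpha> a (c \<boxdot> (b \<boxdot> d)) w \<cdot> ((\<alpha> a c (b \<boxdot> d) \<cdot> mid a b c d) \<boxtimes> \<iota> w)"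
    by (simp add: pentagon_tail TenA_merge)
  also have "(\<alpha> a c (b \<boxdot> d) \<cdot> mid a b c d) \<boxtimes> \<iota> w =
      ((\<iota> a \<boxtimes> shift b c d) \<boxtimes> \<iota> w) \<cdot> (\<alpha> a b (c \<boxdot> d) \<boxtimes> \<iota> w)"
    by (simp add: assoc_mid TenA_merge)
  also have "(\<iota> a \<boxtimes> \<alpha> c (b \<boxdot> d) w) \<cdot> \<alpha> a (c \<boxdot> (b \<boxdot> d)) w \<cdot>
      ((\<iota> a \<boxtimes> shift b c d) \<boxtimes> \<iota> w) \<cdot> (\<alpha> a b (c \<boxdot> d) \<boxtimes> \<iota> w) =
      (\<iota> a \<boxtimes> (\<alpha> c (b \<boxdot> d) w \<cdot> (shift b c d \<boxtimes> \<iota> w))) \<cdot>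
      \<alpha> a (b \<boxdot> (c \<boxdot> d)) w \<cdot> (\<alpha> a b (c \<boxdot> d) \<boxtimes> \<iota> w)"
    by (simp add: assoc_nat TenA_merge(2))
  also have "(\<iota> a \<boxtimes> (\<iota> c \<boxtimes> (?S \<cdot> ?T \<cdot> \<alpha> b d w))) \<cdot>
      (\<iota> a \<boxtimes> (\<alpha> c (b \<boxdot> d) w \<cdot> (shift b c d \<boxtimes> \<iota> w))) \<cdot>
      \<alpha> a (b \<boxdot> (c \<boxdot> d)) w \<cdot> (\<alpha> a b (c \<boxdot> d) \<boxtimes> \<iota> w) =
      (\<iota> a \<boxtimes> ((\<iota> c \<boxtimes> ?S) \<cdot> (\<iota> c \<boxtimes> ?T) \<cdot>
        (\<iota> c \<boxtimes> \<alpha> b d w) \<cdot> \<alpha> c (b \<boxdot> d) w \<cdot> (shift b c d \<boxtimes> \<iota> w))) \<cdot>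
      \<alpha> a (b \<boxdot> (c \<boxdot> d)) w \<cdot> (\<alpha> a b (c \<boxdot> d) \<boxtimes> \<iota> w)"
    by (simp add: TenA_merge X_def w_def)
  also have "(\<iota> c \<boxtimes> \<alpha> b d w) \<cdot> \<alpha> c (b \<boxdot> d) w \<cdot> (shift b c d \<boxtimes> \<iota> w) =
      shift b c (d \<boxdot> w) \<cdot> (\<iota> b \<boxtimes> \<alpha> c d w) \<cdot> \<alpha> b (c \<boxdot> d) w"
    by (simp add: shift_whisker)
  also have "(\<iota> a \<boxtimes> ((\<iota> c \<boxtimes> ?S) \<cdot> (\<iota> c \<boxtimes> ?T) \<cdot>
        shift b c (d \<boxdot> w) \<cdot> (\<iota> b \<boxtimes> \<alpha> c d w) \<cdot> \<alpha> b (c \<boxdot> d) w)) \<cdot>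
      \<alpha> a (b \<boxdot> (c \<boxdot> d)) w \<cdot> (\<alpha> a b (c \<boxdot> d) \<boxtimes> \<iota> w) =
      (\<iota> a \<boxtimes> ?U) \<cdot> (\<iota> a \<boxtimes> \<alpha> b (c \<boxdot> d) w) \<cdot> \<alpha> a (b \<boxdot> (c \<boxdot> d)) w \<cdot> (\<alpha> a b (c \<boxdot> d) \<boxtimes> \<iota> w)"
    by (simp add: TenA_merge X_def w_def)
  also have "\<dots> = ?N"
    by (simp add: pentagon)
  finally have L: "?K \<cdot> ?L = ?N" .
  show ?thesis
    by (rule iso_cancel_left[where f = ?K]) (simp_all only: L R, simp_all add: is_iso_Cmp X_def)
qed

text \<open>\<open>mid_assoc\<close> with the interchanges moved to the opposite sides by inversion.
  Coassociativity of a tensor product of comonoids needs it in this direction.\<close>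

lemma assoc_mid_mid:
  assumes [simp]: "a \<in> Obj C" "b \<in> Obj C" "c \<in> Obj C" "d \<in> Obj C" "e \<in> Obj C" "f \<in> Obj C"
  shows "\<alpha> (a \<boxdot> b) (c \<boxdot> d) (e \<boxdot> f) \<cdot> (mid a c b d \<boxtimes> \<iota> (e \<boxdot> f)) \<cdot> mid (a \<boxdot> c) e (b \<boxdot> d) f =
    (\<iota> (a \<boxdot> b) \<boxtimes> mid c e d f) \<cdot> mid a (c \<boxdot> e) b (d \<boxdot> f) \<cdot> (\<alpha> a c e \<boxtimes> \<alpha> b d f)" (is "?L = ?R")
proof -
  let ?l = "(\<alpha> a c e \<boxtimes> \<alpha> b d f) \<cdot> mid (a \<boxdot> c) (b \<boxdot> d) e f \<cdot> (mid a b c d \<boxtimes> \<iota> (e \<boxdot> f))"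
  let ?r = "mid a b (c \<boxdot> e) (d \<boxdot> f) \<cdot> (\<iota> (a \<boxdot> b) \<boxtimes> mid c d e f) \<cdot> \<alpha> (a \<boxdot> b) (c \<boxdot> d) (e \<boxdot> f)"
  let ?x = "(mid a c b d \<boxtimes> \<iota> (e \<boxdot> f)) \<cdot> mid (a \<boxdot> c) e (b \<boxdot> d) f"
  let ?y = "(\<iota> (a \<boxdot> b) \<boxtimes> mid c e d f) \<cdot> mid a (c \<boxdot> e) b (d \<boxdot> f)"
  have "?R = ?y \<cdot> ?l \<cdot> ?x"
    by (simp add: TenA_merge mid_mid)
  also have "\<dots> = ?y \<cdot> ?r \<cdot> ?x"
    by (simp only: mid_assoc assms)
  also have "\<dots> = ?L"
    by (simp add: mid_mid TenA_merge(2))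
  finally show ?thesis by simp
qed

text \<open>Both symmetries of composite objects are decomposed into shifts, and the shifts
  contained in \<open>mid\<close> cancel against some of them. This yields cocommutativity of tensor
  products of comonoids.\<close>

lemma symm_mid:
  assumes [simp]: "a \<in> Obj C" "b \<in> Obj C" "c \<in> Obj C" "d \<in> Obj C"
  shows "\<sigma> (a \<boxdot> c) (b \<boxdot> d) \<cdot> mid a b c d = mid b a d c \<cdot> (\<sigma> a b \<boxtimes> \<sigma> c d)" (is "?L = ?R")
proof (rule iso_cancel_left[where f = "\<alpha> b d (a \<boxdot> c)"])
  let ?f = "\<alpha> b d (a \<boxdot> c)"
  have "?f \<cdot> ?L = (\<iota> b \<boxtimes> \<sigma> (a \<boxdot> c) d) \<cdot> shift (a \<boxdot> c) b d \<cdot> mid a b c d"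
    using Cmp_reassoc[OF symm_TenO_right[of "a \<boxdot> c" b d], of "mid a b c d"] by simp
  also have "\<dots> = (\<iota> b \<boxtimes> (shift a d c \<cdot> (\<iota> a \<boxtimes> \<sigma> c d))) \<cdot>
      ((\<iota> b \<boxtimes> \<alpha> a c d) \<cdot> shift (a \<boxdot> c) b d) \<cdot> mid a b c d"
    by (simp add: symm_TenO_left TenA_merge)
  also have "((\<iota> b \<boxtimes> \<alpha> a c d) \<cdot> shift (a \<boxdot> c) b d) \<cdot> mid a b c d =
      shift a b (c \<boxdot> d) \<cdot> (\<iota> a \<boxtimes> shift c b d) \<cdot> \<alpha> a c (b \<boxdot> d) \<cdot> mid a b c d"
    by (subst shift_TenO_left) simp_all
  also have "\<dots> = shift a b (c \<boxdot> d) \<cdot> \<alpha> a b (c \<boxdot> d)"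
    by (simp add: assoc_mid TenA_merge shift_shift)
  also have "(\<iota> b \<boxtimes> (shift a d c \<cdot> (\<iota> a \<boxtimes> \<sigma> c d))) \<cdot> shift a b (c \<boxdot> d) \<cdot> \<alpha> a b (c \<boxdot> d) =
      (\<iota> b \<boxtimes> shift a d c) \<cdot> (\<iota> b \<boxtimes> (\<iota> a \<boxtimes> \<sigma> c d)) \<cdot> \<alpha> b a (c \<boxdot> d) \<cdot> (\<sigma> a b \<boxtimes> \<iota> (c \<boxdot> d))"
    by (simp add: shift_assoc TenA_merge)
  also have "\<dots> = (\<iota> b \<boxtimes> shift a d c) \<cdot> \<alpha> b a (d \<boxdot> c) \<cdot> (\<iota> (b \<boxdot> a) \<boxtimes> \<sigma> c d) \<cdot> (\<sigma> a b \<boxtimes> \<iota> (c \<boxdot> d))"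
    by (simp add: assoc_nat_Idn_left)
  also have "\<dots> = ?f \<cdot> ?R"
    by (simp add: assoc_mid TenA_merge)
  finally show "?f \<cdot> ?L = ?f \<cdot> ?R" .
qed simp_all

lemma shift_unit_left:
  assumes [simp]: "a \<in> Obj C" "b \<in> Obj C"
  shows "(\<iota> a \<boxtimes> lu b) \<cdot> shift \<I> a b = lu (a \<boxdot> b)"
proof (rule iso_cancel_right[where f = "\<alpha> \<I> a b"])
  have "((\<iota> a \<boxtimes> lu b) \<cdot> shift \<I> a b) \<cdot> \<alpha> \<I> a b = (ru a \<boxtimes> \<iota> b) \<cdot> (\<sigma> \<I> a \<boxtimes> \<iota> b)"
    by (simp add: shift_assoc triangle_tail)
  also have "\<dots> = lu (a \<boxdot> b) \<cdot> \<alpha> \<I> a b"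
    by (simp add: TenA_merge runit_symm lunit_TenO)
  finally show "((\<iota> a \<boxtimes> lu b) \<cdot> shift \<I> a b) \<cdot> \<alpha> \<I> a b = lu (a \<boxdot> b) \<cdot> \<alpha> \<I> a b" .
qed simp_all

lemma shift_unit_middle:
  assumes [simp]: "b \<in> Obj C" "d \<in> Obj C"
  shows "lu (b \<boxdot> d) \<cdot> shift b \<I> d = \<iota> b \<boxtimes> lu d"
proof (rule iso_cancel_right[where f = "\<alpha> b \<I> d"])
  have "(lu (b \<boxdot> d) \<cdot> shift b \<I> d) \<cdot> \<alpha> b \<I> d = (lu b \<boxtimes> \<iota> d) \<cdot> (\<sigma> b \<I> \<boxtimes> \<iota> d)"
    by (simp add: shift_assoc lunit_TenO_tail)
  also have "\<dots> = (\<iota> b \<boxtimes> lu d) \<cdot> \<alpha> b \<I> d"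
    by (simp add: TenA_merge lunit_symm triangle)
  finally show "(lu (b \<boxdot> d) \<cdot> shift b \<I> d) \<cdot> \<alpha> b \<I> d = (\<iota> b \<boxtimes> lu d) \<cdot> \<alpha> b \<I> d" .
qed simp_all

text \<open>Unit coherence of the interchange. It serves the counit law of a tensor product and the
  proof that the second projection is a homomorphism; \<open>mid_runit\<close> does the same for the
  first projection.\<close>

lemma mid_lunit:
  assumes [simp]: "a \<in> Obj C" "b \<in> Obj C"
  shows "(lu a \<boxtimes> lu b) \<cdot> mid \<I> \<I> a b = lu (a \<boxdot> b) \<cdot> (lu \<I> \<boxtimes> \<iota> (a \<boxdot> b))"
proof -
  have "(lu a \<boxtimes> lu b) \<cdot> mid \<I> \<I> a b = (\<iota> a \<boxtimes> lu b) \<cdot> (lu a \<boxtimes> \<iota> (\<I> \<boxdot> b)) \<cdot> mid \<I> \<I> a b"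
    by (simp add: TenA_merge)
  also have "\<dots> = (\<iota> a \<boxtimes> lu b) \<cdot> lu (a \<boxdot> (\<I> \<boxdot> b)) \<cdot> \<alpha> \<I> a (\<I> \<boxdot> b) \<cdot> mid \<I> \<I> a b"
    by (simp add: lunit_TenO_tail)
  also have "\<dots> = ((\<iota> a \<boxtimes> lu b) \<cdot> shift \<I> a b) \<cdot> lu (\<I> \<boxdot> (a \<boxdot> b)) \<cdot> \<alpha> \<I> \<I> (a \<boxdot> b)"
    by (simp add: assoc_mid lunit_nat)
  also have "\<dots> = lu (a \<boxdot> b) \<cdot> (lu \<I> \<boxtimes> \<iota> (a \<boxdot> b))"
    by (simp only: shift_unit_left lunit_TenO unit_Obj TenO_Obj assms)
  finally show ?thesis .
qed

lemma mid_runit: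
  assumes [simp]: "a \<in> Obj C" "b \<in> Obj C"
  shows "(ru a \<boxtimes> ru b) \<cdot> mid a b \<I> \<I> = ru (a \<boxdot> b) \<cdot> (\<iota> (a \<boxdot> b) \<boxtimes> lu \<I>)"
proof -
  have "(ru a \<boxtimes> ru b) \<cdot> mid a b \<I> \<I> = (\<iota> a \<boxtimes> ru b) \<cdot> (ru a \<boxtimes> \<iota> (b \<boxdot> \<I>)) \<cdot> mid a b \<I> \<I>"
    by (simp add: TenA_merge)
  also have "\<dots> = (\<iota> a \<boxtimes> ru b) \<cdot> (\<iota> a \<boxtimes> lu (b \<boxdot> \<I>)) \<cdot> \<alpha> a \<I> (b \<boxdot> \<I>) \<cdot> mid a b \<I> \<I>"
    by (simp add: triangle_tail)
  also have "\<dots> = (\<iota> a \<boxtimes> (ru b \<cdot> lu (b \<boxdot> \<I>) \<cdot> shift b \<I> \<I>)) \<cdot> \<alpha> a b (\<I> \<boxdot> \<I>)"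
    by (simp add: assoc_mid TenA_merge)
  also have "\<dots> = (\<iota> a \<boxtimes> ru b) \<cdot> (\<iota> a \<boxtimes> (\<iota> b \<boxtimes> lu \<I>)) \<cdot> \<alpha> a b (\<I> \<boxdot> \<I>)"
    by (simp add: shift_unit_middle TenA_merge)
  also have "\<dots> = (\<iota> a \<boxtimes> ru b) \<cdot> \<alpha> a b \<I> \<cdot> (\<iota> (a \<boxdot> b) \<boxtimes> lu \<I>)"
    by (simp add: assoc_nat_Idn_left)
  also have "\<dots> = ru (a \<boxdot> b) \<cdot> (\<iota> (a \<boxdot> b) \<boxtimes> lu \<I>)"
    by (simp add: runit_TenO_tail)
  finally show ?thesis .
qed

text \<open>Only two units are exchanged, and their symmetry is the identity.\<close>

lemma mid_unit_middle:
  assumes [simp]: "a \<in> Obj C" "b \<in> Obj C"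
  shows "mid a \<I> \<I> b = \<iota> ((a \<boxdot> \<I>) \<boxdot> (\<I> \<boxdot> b))"
  by (simp add: mid_def shift_def symm_unit)

end

section \<open>Cocommutative comonoids form a cartesian category\<close>

record ('o, 'm) comonoid_data =
  Car :: 'o
  Dup :: 'm
  Del :: 'm

context symmetric_monoidal_category
begin

definition cocomm :: "('o, 'm) comonoid_data \<Rightarrow> bool" where
  "cocomm X \<longleftrightarrow> cocommutative_comonoid_in C (Car X) (Dup X) (Del X)"

text \<open>Validity of both comonoids is part of the predicate, so a single hypothesis supplies all
  typing facts.\<close>

definition chom :: "('o, 'm) comonoid_data \<Rightarrow> ('o, 'm) comonoid_data \<Rightarrow> 'm \<Rightarrow> bool" where
  "chom X Y f \<longleftrightarrow> cocomm X \<and> cocomm Y \<and> in_hom C f (Car X) (Car Y) \<and>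
    Dup Y \<cdot> f = (f \<boxtimes> f) \<cdot> Dup X \<and> Del Y \<cdot> f = Del X"

definition tens :: "('o, 'm) comonoid_data \<Rightarrow> ('o, 'm) comonoid_data \<Rightarrow> ('o, 'm) comonoid_data" where
  "tens X Y = \<lparr>Car = Car X \<boxdot> Car Y,
    Dup = mid (Car X) (Car X) (Car Y) (Car Y) \<cdot> (Dup X \<boxtimes> Dup Y),
    Del = lu \<I> \<cdot> (Del X \<boxtimes> Del Y)\<rparr>"

definition triv :: "('o, 'm) comonoid_data" where
  "triv = \<lparr>Car = \<I>, Dup = inv_arr C (lu \<I>), Del = \<iota> \<I>\<rparr>"

definition pr1 :: "('o, 'm) comonoid_data \<Rightarrow> ('o, 'm) comonoid_data \<Rightarrow> 'm" where
  "pr1 X Y = ru (Car X) \<cdot> (\<iota> (Car X) \<boxtimes> Del Y)"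

definition pr2 :: "('o, 'm) comonoid_data \<Rightarrow> ('o, 'm) comonoid_data \<Rightarrow> 'm" where
  "pr2 X Y = lu (Car Y) \<cdot> (Del X \<boxtimes> \<iota> (Car Y))"

text \<open>The diagonal of \<open>X\<close> followed by \<open>f\<close> and \<open>g\<close>. Only
  the source comonoid enters; those on the targets matter only when the result has to be a
  homomorphism.\<close>

definition pair :: "('o, 'm) comonoid_data \<Rightarrow> 'm \<Rightarrow> 'm \<Rightarrow> 'm" where
  "pair X f g = (f \<boxtimes> g) \<cdot> Dup X"

text \<open>The right counit law follows from the left one by cocommutativity. The counit law is
  stated with the unitor moved to the other side, which avoids its inverse.\<close>

lemma cocommI:
  assumes [simp]: "a \<in> Obj C" and d [simp]: "d \<in> Arr C" "Dom C d = a" "Cod C d = a \<boxdot> a"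
    and e [simp]: "e \<in> Arr C" "Dom C e = a" "Cod C e = \<I>"
    and coassoc: "\<alpha> a a a \<cdot> (d \<boxtimes> \<iota> a) \<cdot> d = (\<iota> a \<boxtimes> d) \<cdot> d"
    and counit: "lu a \<cdot> (e \<boxtimes> \<iota> a) \<cdot> d = \<iota> a"
    and comm: "\<sigma> a a \<cdot> d = d"
  shows "cocomm \<lparr>Car = a, Dup = d, Del = e\<rparr>"
proof -
  have l: "(e \<boxtimes> \<iota> a) \<cdot> d = inv_arr C (lu a)"
    by (rule iso_cancel_left[where f = "lu a"]) (simp_all add: counit)
  have "(\<iota> a \<boxtimes> e) \<cdot> d = (\<iota> a \<boxtimes> e) \<cdot> \<sigma> a a \<cdot> d" by (simp add: comm)
  also have "\<dots> = \<sigma> \<I> a \<cdot> (e \<boxtimes> \<iota> a) \<cdot> d" by (simp add: symm_nat)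
  also have "\<dots> = inv_arr C (ru a)"
    by (rule iso_cancel_left[where f = "ru a"])
      (simp_all add: l Cmp_reassoc[OF runit_symm])
  finally have r: "(\<iota> a \<boxtimes> e) \<cdot> d = inv_arr C (ru a)" .
  show ?thesis
    unfolding cocomm_def by unfold_locales (simp_all add: in_hom_def coassoc comm l r)
qed

lemma cocomm_simps [simp]:
  assumes "cocomm X"
  shows "Car X \<in> Obj C" "Dup X \<in> Arr C" "Dom C (Dup X) = Car X" "Cod C (Dup X) = Car X \<boxdot> Car X"
    "Del X \<in> Arr C" "Dom C (Del X) = Car X" "Cod C (Del X) = \<I>"
  using cocommutative_comonoid_in.comonoid_Obj[OF assms[unfolded cocomm_def]]
    cocommutative_comonoid_in.comul_hom[OF assms[unfolded cocomm_def]]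
    cocommutative_comonoid_in.counit_hom[OF assms[unfolded cocomm_def]]
  by (auto simp: in_hom_def)

lemma cocomm_laws:
  assumes "cocomm X"
  shows "\<alpha> (Car X) (Car X) (Car X) \<cdot> (Dup X \<boxtimes> \<iota> (Car X)) \<cdot> Dup X = (\<iota> (Car X) \<boxtimes> Dup X) \<cdot> Dup X"
    "(Del X \<boxtimes> \<iota> (Car X)) \<cdot> Dup X = inv_arr C (lu (Car X))"
    "(\<iota> (Car X) \<boxtimes> Del X) \<cdot> Dup X = inv_arr C (ru (Car X))"
    "\<sigma> (Car X) (Car X) \<cdot> Dup X = Dup X"
  using assms unfolding cocomm_def
  by (rule cocommutative_comonoid_in.comul_coassoc cocommutative_comonoid_in.comul_lcounit
      cocommutative_comonoid_in.comul_rcounit cocommutative_comonoid_in.comul_cocomm)+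

lemma chomD:
  assumes "chom X Y f"
  shows "cocomm X" "cocomm Y" "f \<in> Arr C" "Dom C f = Car X" "Cod C f = Car Y"
    "Dup Y \<cdot> f = (f \<boxtimes> f) \<cdot> Dup X" "Del Y \<cdot> f = Del X"
  using assms by (auto simp: chom_def in_hom_def)

lemma chomI:
  assumes "cocomm X" "cocomm Y" "f \<in> Arr C" "Dom C f = Car X" "Cod C f = Car Y"
    "Dup Y \<cdot> f = (f \<boxtimes> f) \<cdot> Dup X" "Del Y \<cdot> f = Del X"
  shows "chom X Y f"
  using assms by (auto simp: chom_def in_hom_def)

lemma chom_Idn: "cocomm X \<Longrightarrow> chom X X (\<iota> (Car X))"
  by (rule chomI) auto

lemma chom_Cmp:
  assumes f: "chom X Y f" and g: "chom Y Z g"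
  shows "chom X Z (g \<cdot> f)"
proof (rule chomI)
  note [simp] = chomD(1-5)[OF f] chomD(1-5)[OF g]
  show "Dup Z \<cdot> g \<cdot> f = ((g \<cdot> f) \<boxtimes> (g \<cdot> f)) \<cdot> Dup X"
    using chomD(6)[OF f] Cmp_reassoc[OF chomD(6)[OF g], of f] by (simp add: TenA_merge)
  show "Del Z \<cdot> g \<cdot> f = Del X"
    using chomD(7)[OF f] Cmp_reassoc[OF chomD(7)[OF g], of f] by simp
qed (use f g chomD in auto)

lemma tens_simps [simp]:
  "Car (tens X Y) = Car X \<boxdot> Car Y"
  "Dup (tens X Y) = mid (Car X) (Car X) (Car Y) (Car Y) \<cdot> (Dup X \<boxtimes> Dup Y)"
  "Del (tens X Y) = lu \<I> \<cdot> (Del X \<boxtimes> Del Y)"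
  by (simp_all add: tens_def)

lemma triv_simps [simp]: "Car triv = \<I>" "Dup triv = inv_arr C (lu \<I>)" "Del triv = \<iota> \<I>"
  by (simp_all add: triv_def)

lemma cocomm_triv [simp]: "cocomm triv"
  unfolding triv_def
proof (rule cocommI)
  let ?i = "inv_arr C (lu \<I>)"
  have "\<alpha> \<I> \<I> \<I> \<cdot> (?i \<boxtimes> \<iota> \<I>) \<cdot> ?i = (\<iota> \<I> \<boxtimes> ?i) \<cdot> (\<iota> \<I> \<boxtimes> lu \<I>) \<cdot> \<alpha> \<I> \<I> \<I> \<cdot> (?i \<boxtimes> \<iota> \<I>) \<cdot> ?i"
    by (simp add: TenA_merge)
  also have "\<dots> = (\<iota> \<I> \<boxtimes> ?i) \<cdot> ?i"
    by (simp add: triangle_tail runit_unit TenA_merge)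
  finally show "\<alpha> \<I> \<I> \<I> \<cdot> (?i \<boxtimes> \<iota> \<I>) \<cdot> ?i = (\<iota> \<I> \<boxtimes> ?i) \<cdot> ?i" .
qed (simp_all add: symm_unit)

text \<open>The counit law makes deleting both copies the same as deleting the original; this is the
  statement that \<open>Del X\<close> is compatible with the comultiplication of the unit.\<close>

lemma Del_Del:
  assumes "cocomm X"
  shows "lu \<I> \<cdot> (Del X \<boxtimes> Del X) \<cdot> Dup X = Del X"
proof -
  note [simp] = assms
  have "lu \<I> \<cdot> (Del X \<boxtimes> Del X) \<cdot> Dup X =
      lu \<I> \<cdot> (\<iota> \<I> \<boxtimes> Del X) \<cdot> (Del X \<boxtimes> \<iota> (Car X)) \<cdot> Dup X"
    by (simp add: TenA_merge)
  then show ?thesis by (simp add: cocomm_laws lunit_nat)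
qed

text \<open>Naturality of the interchange gathers the parts belonging to \<open>X\<close> and those
  belonging to \<open>Y\<close>. What remains are the laws of the factors together with
  \<open>assoc_mid_mid\<close>, \<open>mid_lunit\<close> and \<open>symm_mid\<close>.\<close>

lemma cocomm_tens [simp]:
  assumes [simp]: "cocomm X" "cocomm Y"
  shows "cocomm (tens X Y)"
  unfolding tens_def
proof (rule cocommI)
  let ?x = "Car X" and ?dx = "Dup X" and ?ex = "Del X" and ?y = "Car Y" and ?dy = "Dup Y" and ?ey = "Del Y"
  let ?d = "mid ?x ?x ?y ?y \<cdot> (?dx \<boxtimes> ?dy)" and ?e = "lu \<I> \<cdot> (?ex \<boxtimes> ?ey)" and ?t = "?x \<boxdot> ?y"
  let ?p = "(?dx \<boxtimes> \<iota> ?x) \<cdot> ?dx" and ?q = "(?dy \<boxtimes> \<iota> ?y) \<cdot> ?dy"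
  have "\<alpha> ?t ?t ?t \<cdot> (?d \<boxtimes> \<iota> ?t) \<cdot> ?d =
      \<alpha> ?t ?t ?t \<cdot> (mid ?x ?x ?y ?y \<boxtimes> \<iota> ?t) \<cdot> ((?dx \<boxtimes> ?dy) \<boxtimes> (\<iota> ?x \<boxtimes> \<iota> ?y)) \<cdot> ?d"
    by (simp add: TenA_merge)
  also have "((?dx \<boxtimes> ?dy) \<boxtimes> (\<iota> ?x \<boxtimes> \<iota> ?y)) \<cdot> ?d = mid (?x \<boxdot> ?x) ?x (?y \<boxdot> ?y) ?y \<cdot> (?p \<boxtimes> ?q)"
    using Cmp_reassoc[OF mid_natural[of ?dx "\<iota> ?x" ?dy "\<iota> ?y" "?x \<boxdot> ?x" ?x "?y \<boxdot> ?y" ?y],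
        of "?dx \<boxtimes> ?dy", symmetric]
    by (simp add: TenA_merge del: TenA_Idn)
  also have "\<alpha> ?t ?t ?t \<cdot> (mid ?x ?x ?y ?y \<boxtimes> \<iota> ?t) \<cdot> \<dots> =
      (\<alpha> ?t ?t ?t \<cdot> (mid ?x ?x ?y ?y \<boxtimes> \<iota> ?t) \<cdot> mid (?x \<boxdot> ?x) ?x (?y \<boxdot> ?y) ?y) \<cdot> (?p \<boxtimes> ?q)"
    by simp
  also have "\<dots> = (\<iota> ?t \<boxtimes> mid ?x ?x ?y ?y) \<cdot> mid ?x (?x \<boxdot> ?x) ?y (?y \<boxdot> ?y) \<cdot>
      ((\<alpha> ?x ?x ?x \<cdot> ?p) \<boxtimes> (\<alpha> ?y ?y ?y \<cdot> ?q))"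
    by (subst assoc_mid_mid) (simp_all add: TenA_merge)
  also have "\<dots> = (\<iota> ?t \<boxtimes> mid ?x ?x ?y ?y) \<cdot> mid ?x (?x \<boxdot> ?x) ?y (?y \<boxdot> ?y) \<cdot>
      ((\<iota> ?x \<boxtimes> ?dx) \<boxtimes> (\<iota> ?y \<boxtimes> ?dy)) \<cdot> (?dx \<boxtimes> ?dy)"
    by (simp add: cocomm_laws(1) TenA_merge)
  also have "\<dots> = (\<iota> ?t \<boxtimes> mid ?x ?x ?y ?y) \<cdot> ((\<iota> ?x \<boxtimes> \<iota> ?y) \<boxtimes> (?dx \<boxtimes> ?dy)) \<cdot> ?d"
    by (subst mid_nat(2)) simp_all
  also have "\<dots> = (\<iota> ?t \<boxtimes> ?d) \<cdot> ?d"
    by (simp add: TenA_merge)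
  finally show "\<alpha> ?t ?t ?t \<cdot> (?d \<boxtimes> \<iota> ?t) \<cdot> ?d = (\<iota> ?t \<boxtimes> ?d) \<cdot> ?d" .
  let ?p = "(?ex \<boxtimes> \<iota> ?x) \<cdot> ?dx" and ?q = "(?ey \<boxtimes> \<iota> ?y) \<cdot> ?dy"
  have "lu ?t \<cdot> (?e \<boxtimes> \<iota> ?t) \<cdot> ?d =
      lu ?t \<cdot> (lu \<I> \<boxtimes> \<iota> ?t) \<cdot> ((?ex \<boxtimes> ?ey) \<boxtimes> (\<iota> ?x \<boxtimes> \<iota> ?y)) \<cdot> ?d"
    by (simp add: TenA_merge)
  also have "((?ex \<boxtimes> ?ey) \<boxtimes> (\<iota> ?x \<boxtimes> \<iota> ?y)) \<cdot> ?d = mid \<I> ?x \<I> ?y \<cdot> (?p \<boxtimes> ?q)"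
    using Cmp_reassoc[OF mid_natural[of ?ex "\<iota> ?x" ?ey "\<iota> ?y" \<I> ?x \<I> ?y], of "?dx \<boxtimes> ?dy", symmetric]
    by (simp add: TenA_merge del: TenA_Idn)
  also have "lu ?t \<cdot> (lu \<I> \<boxtimes> \<iota> ?t) \<cdot> \<dots> =
      (lu ?t \<cdot> (lu \<I> \<boxtimes> \<iota> ?t)) \<cdot> mid \<I> ?x \<I> ?y \<cdot> (?p \<boxtimes> ?q)"
    by simp
  also have "\<dots> = \<iota> ?t"
    by (simp add: mid_lunit[symmetric] mid_mid cocomm_laws(2) TenA_merge)
  finally show "lu ?t \<cdot> (?e \<boxtimes> \<iota> ?t) \<cdot> ?d = \<iota> ?t" .
  show "\<sigma> ?t ?t \<cdot> ?d = ?d"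
    using Cmp_reassoc[OF symm_mid[of ?x ?x ?y ?y], of "?dx \<boxtimes> ?dy"]
    by (simp add: TenA_merge cocomm_laws)
qed simp_all

section \<open>Projections, pairing and the universal property of the tensor product\<close>

lemma pr_simps [simp]:
  assumes "cocomm X" "cocomm Y"
  shows "pr1 X Y \<in> Arr C" "Dom C (pr1 X Y) = Car X \<boxdot> Car Y" "Cod C (pr1 X Y) = Car X"
    "pr2 X Y \<in> Arr C" "Dom C (pr2 X Y) = Car X \<boxdot> Car Y" "Cod C (pr2 X Y) = Car Y"
  using assms by (simp_all add: pr1_def pr2_def)

lemma chom_pr2:
  assumes [simp]: "cocomm X" "cocomm Y"
  shows "chom (tens X Y) Y (pr2 X Y)"
proof (rule chomI)
  let ?x = "Car X" and ?y = "Car Y"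
  have "(pr2 X Y \<boxtimes> pr2 X Y) \<cdot> Dup (tens X Y) =
      (lu ?y \<boxtimes> lu ?y) \<cdot> ((Del X \<boxtimes> \<iota> ?y) \<boxtimes> (Del X \<boxtimes> \<iota> ?y)) \<cdot> mid ?x ?x ?y ?y \<cdot> (Dup X \<boxtimes> Dup Y)"
    by (simp add: pr2_def TenA_merge)
  also have "((Del X \<boxtimes> \<iota> ?y) \<boxtimes> (Del X \<boxtimes> \<iota> ?y)) \<cdot> mid ?x ?x ?y ?y \<cdot> (Dup X \<boxtimes> Dup Y) =
      mid \<I> \<I> ?y ?y \<cdot> ((Del X \<boxtimes> Del X) \<boxtimes> (\<iota> ?y \<boxtimes> \<iota> ?y)) \<cdot> (Dup X \<boxtimes> Dup Y)"
    by (subst mid_nat(2)) simp_all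
  also have "(lu ?y \<boxtimes> lu ?y) \<cdot> \<dots> =
      ((lu ?y \<boxtimes> lu ?y) \<cdot> mid \<I> \<I> ?y ?y) \<cdot> (((Del X \<boxtimes> Del X) \<cdot> Dup X) \<boxtimes> Dup Y)"
    by (simp add: TenA_merge)
  also have "\<dots> = lu (?y \<boxdot> ?y) \<cdot> (Del X \<boxtimes> Dup Y)"
    by (simp add: mid_lunit TenA_merge Del_Del)
  also have "\<dots> = lu (?y \<boxdot> ?y) \<cdot> (\<iota> \<I> \<boxtimes> Dup Y) \<cdot> (Del X \<boxtimes> \<iota> ?y)"
    by (simp add: TenA_merge)
  also have "\<dots> = Dup Y \<cdot> pr2 X Y"
    by (simp add: lunit_nat pr2_def)
  finally show "Dup Y \<cdot> pr2 X Y = (pr2 X Y \<boxtimes> pr2 X Y) \<cdot> Dup (tens X Y)" by simp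
  have "Del (tens X Y) = lu \<I> \<cdot> (\<iota> \<I> \<boxtimes> Del Y) \<cdot> (Del X \<boxtimes> \<iota> ?y)"
    by (simp add: TenA_merge)
  also have "\<dots> = Del Y \<cdot> pr2 X Y"
    by (simp add: lunit_nat pr2_def)
  finally show "Del Y \<cdot> pr2 X Y = Del (tens X Y)" by simp
qed simp_all

lemma chom_pr1:
  assumes [simp]: "cocomm X" "cocomm Y"
  shows "chom (tens X Y) X (pr1 X Y)"
proof (rule chomI)
  let ?x = "Car X" and ?y = "Car Y"
  have "(pr1 X Y \<boxtimes> pr1 X Y) \<cdot> Dup (tens X Y) =
      (ru ?x \<boxtimes> ru ?x) \<cdot> ((\<iota> ?x \<boxtimes> Del Y) \<boxtimes> (\<iota> ?x \<boxtimes> Del Y)) \<cdot> mid ?x ?x ?y ?y \<cdot> (Dup X \<boxtimes> Dup Y)"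
    by (simp add: pr1_def TenA_merge)
  also have "((\<iota> ?x \<boxtimes> Del Y) \<boxtimes> (\<iota> ?x \<boxtimes> Del Y)) \<cdot> mid ?x ?x ?y ?y \<cdot> (Dup X \<boxtimes> Dup Y) =
      mid ?x ?x \<I> \<I> \<cdot> ((\<iota> ?x \<boxtimes> \<iota> ?x) \<boxtimes> (Del Y \<boxtimes> Del Y)) \<cdot> (Dup X \<boxtimes> Dup Y)"
    by (subst mid_nat(2)) simp_all
  also have "(ru ?x \<boxtimes> ru ?x) \<cdot> \<dots> =
      ((ru ?x \<boxtimes> ru ?x) \<cdot> mid ?x ?x \<I> \<I>) \<cdot> (Dup X \<boxtimes> ((Del Y \<boxtimes> Del Y) \<cdot> Dup Y))"
    by (simp add: TenA_merge)
  also have "\<dots> = ru (?x \<boxdot> ?x) \<cdot> (Dup X \<boxtimes> Del Y)"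
    by (simp add: mid_runit TenA_merge Del_Del)
  also have "\<dots> = ru (?x \<boxdot> ?x) \<cdot> (Dup X \<boxtimes> \<iota> \<I>) \<cdot> (\<iota> ?x \<boxtimes> Del Y)"
    by (simp add: TenA_merge)
  also have "\<dots> = Dup X \<cdot> pr1 X Y"
    by (simp add: runit_nat pr1_def)
  finally show "Dup X \<cdot> pr1 X Y = (pr1 X Y \<boxtimes> pr1 X Y) \<cdot> Dup (tens X Y)" by simp
  have "Del (tens X Y) = ru \<I> \<cdot> (Del X \<boxtimes> \<iota> \<I>) \<cdot> (\<iota> ?x \<boxtimes> Del Y)"
    by (simp add: TenA_merge runit_unit)
  also have "\<dots> = Del X \<cdot> pr1 X Y"
    by (simp add: runit_nat pr1_def)
  finally show "Del X \<cdot> pr1 X Y = Del (tens X Y)" by simp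
qed simp_all

text \<open>Exchanging the two inner ones of four copies changes nothing. By coassociativity the
  exchange acts on adjacent copies, where cocommutativity removes it. This makes the
  comultiplication, and hence any pairing, a comonoid homomorphism.\<close>

lemma mid_Dup:
  assumes [simp]: "cocomm X"
  shows "mid (Car X) (Car X) (Car X) (Car X) \<cdot> (Dup X \<boxtimes> Dup X) \<cdot> Dup X = (Dup X \<boxtimes> Dup X) \<cdot> Dup X"
proof (rule iso_cancel_left[where f = "\<alpha> (Car X) (Car X) (Car X \<boxdot> Car X)"])
  let ?x = "Car X" and ?d = "Dup X"
  have "\<alpha> ?x ?x (?x \<boxdot> ?x) \<cdot> (?d \<boxtimes> ?d) \<cdot> ?d =
      \<alpha> ?x ?x (?x \<boxdot> ?x) \<cdot> (\<iota> (?x \<boxdot> ?x) \<boxtimes> ?d) \<cdot> (?d \<boxtimes> \<iota> ?x) \<cdot> ?d"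
    by (simp add: TenA_merge)
  also have "\<dots> = (\<iota> ?x \<boxtimes> (\<iota> ?x \<boxtimes> ?d)) \<cdot> (\<iota> ?x \<boxtimes> ?d) \<cdot> ?d"
    by (simp add: assoc_nat_Idn_left cocomm_laws)
  also have "\<dots> = (\<iota> ?x \<boxtimes> (\<alpha> ?x ?x ?x \<cdot> (?d \<boxtimes> \<iota> ?x) \<cdot> ?d)) \<cdot> ?d"
    by (simp add: TenA_merge cocomm_laws)
  finally have 1: "\<alpha> ?x ?x (?x \<boxdot> ?x) \<cdot> (?d \<boxtimes> ?d) \<cdot> ?d =
      (\<iota> ?x \<boxtimes> (\<alpha> ?x ?x ?x \<cdot> (?d \<boxtimes> \<iota> ?x) \<cdot> ?d)) \<cdot> ?d" .
  \<comment> \<open>The only use of cocommutativity in this proof: the transposition meets the two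
    copies made by the inner comultiplication.\<close>
  have 2: "shift ?x ?x ?x \<cdot> \<alpha> ?x ?x ?x \<cdot> (?d \<boxtimes> \<iota> ?x) \<cdot> ?d = \<alpha> ?x ?x ?x \<cdot> (?d \<boxtimes> \<iota> ?x) \<cdot> ?d"
    by (simp add: shift_assoc TenA_merge cocomm_laws(4))
  have "\<alpha> ?x ?x (?x \<boxdot> ?x) \<cdot> mid ?x ?x ?x ?x \<cdot> (?d \<boxtimes> ?d) \<cdot> ?d =
      (\<iota> ?x \<boxtimes> shift ?x ?x ?x) \<cdot> \<alpha> ?x ?x (?x \<boxdot> ?x) \<cdot> (?d \<boxtimes> ?d) \<cdot> ?d"
    by (simp add: assoc_mid)
  also have "\<dots> = (\<iota> ?x \<boxtimes> (shift ?x ?x ?x \<cdot> \<alpha> ?x ?x ?x \<cdot> (?d \<boxtimes> \<iota> ?x) \<cdot> ?d)) \<cdot> ?d"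
    unfolding 1 by (simp add: TenA_merge)
  finally show "\<alpha> ?x ?x (?x \<boxdot> ?x) \<cdot> mid ?x ?x ?x ?x \<cdot> (?d \<boxtimes> ?d) \<cdot> ?d =
      \<alpha> ?x ?x (?x \<boxdot> ?x) \<cdot> (?d \<boxtimes> ?d) \<cdot> ?d"
    unfolding 1 2 .
qed simp_all

lemma pair_simps [simp]:
  assumes "cocomm X" "f \<in> Arr C" "g \<in> Arr C" "Dom C f = Car X" "Dom C g = Car X"
  shows "pair X f g \<in> Arr C" "Dom C (pair X f g) = Car X" "Cod C (pair X f g) = Cod C f \<boxdot> Cod C g"
  using assms by (simp_all add: pair_def)

lemma chom_pair:
  assumes f: "chom X Y f" and g: "chom X Z g"
  shows "chom X (tens Y Z) (pair X f g)"
proof (rule chomI)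
  note [simp] = chomD(1-5)[OF f] chomD(1-5)[OF g]
  let ?y = "Car Y" and ?z = "Car Z" and ?d = "Dup X"
  have "Dup (tens Y Z) \<cdot> pair X f g = mid ?y ?y ?z ?z \<cdot> ((Dup Y \<cdot> f) \<boxtimes> (Dup Z \<cdot> g)) \<cdot> ?d"
    by (simp add: pair_def TenA_merge)
  also have "\<dots> = mid ?y ?y ?z ?z \<cdot> ((f \<boxtimes> f) \<boxtimes> (g \<boxtimes> g)) \<cdot> (?d \<boxtimes> ?d) \<cdot> ?d"
    by (simp add: chomD(6)[OF f] chomD(6)[OF g] TenA_merge)
  also have "\<dots> = ((f \<boxtimes> g) \<boxtimes> (f \<boxtimes> g)) \<cdot> (?d \<boxtimes> ?d) \<cdot> ?d"
    by (subst mid_nat(2)) (simp_all add: mid_Dup)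
  also have "\<dots> = (pair X f g \<boxtimes> pair X f g) \<cdot> ?d"
    by (simp add: pair_def TenA_merge)
  finally show "Dup (tens Y Z) \<cdot> pair X f g = (pair X f g \<boxtimes> pair X f g) \<cdot> ?d" .
  show "Del (tens Y Z) \<cdot> pair X f g = Del X"
    by (simp add: pair_def TenA_merge chomD(7)[OF f] chomD(7)[OF g] Del_Del)
qed (use chomD[OF f] chomD[OF g] in auto)

lemma pr_pair:
  assumes f: "chom X Y f" and g: "chom X Z g"
  shows "pr1 Y Z \<cdot> pair X f g = f" "pr2 Y Z \<cdot> pair X f g = g"
proof -
  note [simp] = chomD(1-5)[OF f] chomD(1-5)[OF g]
  have "pr1 Y Z \<cdot> pair X f g = ru (Car Y) \<cdot> (f \<boxtimes> \<iota> \<I>) \<cdot> (\<iota> (Car X) \<boxtimes> Del X) \<cdot> Dup X"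
    by (simp add: pr1_def pair_def TenA_merge chomD(7)[OF g])
  then show "pr1 Y Z \<cdot> pair X f g = f"
    by (simp add: cocomm_laws runit_nat)
  have "pr2 Y Z \<cdot> pair X f g = lu (Car Z) \<cdot> (\<iota> \<I> \<boxtimes> g) \<cdot> (Del X \<boxtimes> \<iota> (Car X)) \<cdot> Dup X"
    by (simp add: pr2_def pair_def TenA_merge chomD(7)[OF f])
  then show "pr2 Y Z \<cdot> pair X f g = g"
    by (simp add: cocomm_laws lunit_nat)
qed

text \<open>Interchange puts each unwanted copy next to its counit. The interchange that is left
  over involves two units and is an identity.\<close>

lemma pair_pr:
  assumes [simp]: "cocomm X" "cocomm Y"
  shows "pair (tens X Y) (pr1 X Y) (pr2 X Y) = \<iota> (Car X \<boxdot> Car Y)"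
proof -
  let ?x = "Car X" and ?y = "Car Y"
  have "pair (tens X Y) (pr1 X Y) (pr2 X Y) =
      (ru ?x \<boxtimes> lu ?y) \<cdot> ((\<iota> ?x \<boxtimes> Del Y) \<boxtimes> (Del X \<boxtimes> \<iota> ?y)) \<cdot> mid ?x ?x ?y ?y \<cdot> (Dup X \<boxtimes> Dup Y)"
    by (simp add: pair_def pr1_def pr2_def TenA_merge)
  also have "((\<iota> ?x \<boxtimes> Del Y) \<boxtimes> (Del X \<boxtimes> \<iota> ?y)) \<cdot> mid ?x ?x ?y ?y \<cdot> (Dup X \<boxtimes> Dup Y) =
      mid ?x \<I> \<I> ?y \<cdot> ((\<iota> ?x \<boxtimes> Del X) \<boxtimes> (Del Y \<boxtimes> \<iota> ?y)) \<cdot> (Dup X \<boxtimes> Dup Y)"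
    by (subst mid_nat(2)) simp_all
  finally show ?thesis
    by (simp add: mid_unit_middle TenA_merge cocomm_laws)
qed

text \<open>Uniqueness part of the universal property: insert \<open>pair_pr\<close> after
  \<open>h\<close>, then slide \<open>h\<close> through the comultiplication, which is allowed
  because \<open>h\<close> is a homomorphism.\<close>

lemma chom_eq_pair:
  assumes h: "chom X (tens Y Z) h" and [simp]: "cocomm Y" "cocomm Z"
  shows "h = pair X (pr1 Y Z \<cdot> h) (pr2 Y Z \<cdot> h)"
proof -
  note [simp] = chomD(1)[OF h] chomD(3-5)[OF h, simplified]
  have dup: "mid (Car Y) (Car Y) (Car Z) (Car Z) \<cdot> (Dup Y \<boxtimes> Dup Z) \<cdot> h = (h \<boxtimes> h) \<cdot> Dup X"
    using chomD(6)[OF h] by simp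
  have "h = pair (tens Y Z) (pr1 Y Z) (pr2 Y Z) \<cdot> h"
    by (simp add: pair_pr)
  also have "\<dots> = (pr1 Y Z \<boxtimes> pr2 Y Z) \<cdot> (h \<boxtimes> h) \<cdot> Dup X"
    by (simp add: pair_def dup)
  also have "\<dots> = pair X (pr1 Y Z \<cdot> h) (pr2 Y Z \<cdot> h)"
    by (simp add: pair_def TenA_merge)
  finally show ?thesis .
qed

lemma chom_tens_ext:
  assumes "chom X (tens Y Z) h" "chom X (tens Y Z) k" "cocomm Y" "cocomm Z"
    "pr1 Y Z \<cdot> h = pr1 Y Z \<cdot> k" "pr2 Y Z \<cdot> h = pr2 Y Z \<cdot> k"
  shows "h = k"
  using chom_eq_pair[OF assms(1,3,4)] chom_eq_pair[OF assms(2,3,4)] assms(5,6) by simp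

lemma pair_Cmp:
  assumes f: "chom X Y f" and g: "chom X Z g" and h: "chom W X h"
  shows "pair X f g \<cdot> h = pair W (f \<cdot> h) (g \<cdot> h)"
proof -
  note [simp] = chomD(1-5)[OF f] chomD(1-5)[OF g] chomD(1-5)[OF h]
  show ?thesis by (simp add: pair_def chomD(6)[OF h] TenA_merge)
qed

lemma Dup_eq_pair: "cocomm X \<Longrightarrow> Dup X = pair X (\<iota> (Car X)) (\<iota> (Car X))"
  by (simp add: pair_def)

lemma chom_Dup: "cocomm X \<Longrightarrow> chom X (tens X X) (Dup X)"
  unfolding Dup_eq_pair by (intro chom_pair chom_Idn)

lemma pr_Dup:
  assumes [simp]: "cocomm X"
  shows "pr1 X X \<cdot> Dup X = \<iota> (Car X)" "pr2 X X \<cdot> Dup X = \<iota> (Car X)"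
  using pr_pair[OF chom_Idn chom_Idn, of X] by (simp_all add: Dup_eq_pair[symmetric])

lemma chom_Del: "cocomm X \<Longrightarrow> chom X triv (Del X)"
proof (rule chomI)
  assume [simp]: "cocomm X"
  show "Dup triv \<cdot> Del X = (Del X \<boxtimes> Del X) \<cdot> Dup X"
    by (rule iso_cancel_left[where f = "lu \<I>"]) (simp_all add: Del_Del)
qed simp_all

lemma chom_triv_unique: "chom X triv f \<Longrightarrow> f = Del X"
  using chomD[of X triv f] by simp

lemma chom_TenA:
  assumes f: "chom X X' f" and g: "chom Y Y' g"
  shows "chom (tens X Y) (tens X' Y') (f \<boxtimes> g)"
proof (rule chomI)
  note [simp] = chomD(1-5)[OF f] chomD(1-5)[OF g]
  show "Dup (tens X' Y') \<cdot> (f \<boxtimes> g) = ((f \<boxtimes> g) \<boxtimes> (f \<boxtimes> g)) \<cdot> Dup (tens X Y)"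
    using Cmp_reassoc[OF mid_natural[of f f g g "Car X'" "Car X'" "Car Y'" "Car Y'"], of "Dup X \<boxtimes> Dup Y"]
    by (simp add: TenA_merge chomD(6)[OF f] chomD(6)[OF g])
  show "Del (tens X' Y') \<cdot> (f \<boxtimes> g) = Del (tens X Y)"
    by (simp add: TenA_merge chomD(7)[OF f] chomD(7)[OF g])
qed (use chomD[OF f] chomD[OF g] in auto)

lemma pr_TenA:
  assumes f: "chom X X' f" and g: "chom Y Y' g"
  shows "pr1 X' Y' \<cdot> (f \<boxtimes> g) = f \<cdot> pr1 X Y" "pr2 X' Y' \<cdot> (f \<boxtimes> g) = g \<cdot> pr2 X Y"
proof -
  note [simp] = chomD(1-5)[OF f] chomD(1-5)[OF g]
  have "pr1 X' Y' \<cdot> (f \<boxtimes> g) = ru (Car X') \<cdot> (f \<boxtimes> \<iota> \<I>) \<cdot> (\<iota> (Car X) \<boxtimes> Del Y)"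
    by (simp add: pr1_def TenA_merge chomD(7)[OF g])
  then show "pr1 X' Y' \<cdot> (f \<boxtimes> g) = f \<cdot> pr1 X Y"
    by (simp add: runit_nat pr1_def)
  have "pr2 X' Y' \<cdot> (f \<boxtimes> g) = lu (Car Y') \<cdot> (\<iota> \<I> \<boxtimes> g) \<cdot> (Del X \<boxtimes> \<iota> (Car Y))"
    by (simp add: pr2_def TenA_merge chomD(7)[OF f])
  then show "pr2 X' Y' \<cdot> (f \<boxtimes> g) = g \<cdot> pr2 X Y"
    by (simp add: lunit_nat pr2_def)
qed

text \<open>By coassociativity the right-nested triple of projections is the associator after the
  left-nested triple, and the latter is the identity. From here on associators are handled through
  their projections alone.\<close>

lemma assoc_eq_pair:
  assumes [simp]: "cocomm X" "cocomm Y" "cocomm Z"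
  defines "T \<equiv> tens (tens X Y) Z"
  defines "p \<equiv> pr1 (tens X Y) Z" and "q \<equiv> pr2 (tens X Y) Z"
  shows "\<alpha> (Car X) (Car Y) (Car Z) = pair T (pr1 X Y \<cdot> p) (pair T (pr2 X Y \<cdot> p) q)"
proof -
  have T [simp]: "cocomm T" and CT: "Car T = (Car X \<boxdot> Car Y) \<boxdot> Car Z" by (simp_all add: T_def)
  have p: "chom T (tens X Y) p" and q: "chom T Z q"
    unfolding T_def p_def q_def by (simp_all add: chom_pr1 chom_pr2)
  note [simp] = chomD(3-5)[OF p, simplified] chomD(3-5)[OF q]
  let ?a = "pr1 X Y \<cdot> p" and ?b = "pr2 X Y \<cdot> p"
  let ?\<alpha> = "\<alpha> (Car X) (Car Y) (Car Z)"
  have "pair T ?a (pair T ?b q) = (?a \<boxtimes> (?b \<boxtimes> q)) \<cdot> (\<iota> (Car T) \<boxtimes> Dup T) \<cdot> Dup T"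
    by (simp add: pair_def TenA_merge)
  also have "\<dots> = (?a \<boxtimes> (?b \<boxtimes> q)) \<cdot> \<alpha> (Car T) (Car T) (Car T) \<cdot> (Dup T \<boxtimes> \<iota> (Car T)) \<cdot> Dup T"
    by (simp only: cocomm_laws(1) T)
  also have "\<dots> = ?\<alpha> \<cdot> ((?a \<boxtimes> ?b) \<boxtimes> q) \<cdot> (Dup T \<boxtimes> \<iota> (Car T)) \<cdot> Dup T"
    by (subst assoc_nat(2)) simp_all
  also have "\<dots> = ?\<alpha> \<cdot> (pair T ?a ?b \<boxtimes> q) \<cdot> Dup T"
    by (simp add: pair_def TenA_merge)
  also have "pair T ?a ?b = p"
    using chom_eq_pair[OF p] by simp
  also have "(p \<boxtimes> q) \<cdot> Dup T = \<iota> (Car T)"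
    using pair_pr[of "tens X Y" Z] by (simp add: pair_def T_def p_def q_def)
  finally show ?thesis by (simp add: CT)
qed

lemma chom_assoc:
  assumes [simp]: "cocomm X" "cocomm Y" "cocomm Z"
  shows "chom (tens (tens X Y) Z) (tens X (tens Y Z)) (\<alpha> (Car X) (Car Y) (Car Z))"
  unfolding assoc_eq_pair[OF assms]
  by (intro chom_pair chom_Cmp[OF chom_pr1] chom_pr1 chom_pr2) simp_all

lemma pr_assoc:
  assumes [simp]: "cocomm X" "cocomm Y" "cocomm Z"
  shows "pr1 X (tens Y Z) \<cdot> \<alpha> (Car X) (Car Y) (Car Z) = pr1 X Y \<cdot> pr1 (tens X Y) Z" (is ?thesis1)
    "pr1 Y Z \<cdot> pr2 X (tens Y Z) \<cdot> \<alpha> (Car X) (Car Y) (Car Z) = pr2 X Y \<cdot> pr1 (tens X Y) Z" (is ?thesis2)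
    "pr2 Y Z \<cdot> pr2 X (tens Y Z) \<cdot> \<alpha> (Car X) (Car Y) (Car Z) = pr2 (tens X Y) Z" (is ?thesis3)
proof -
  have 1: "chom (tens (tens X Y) Z) X (pr1 X Y \<cdot> pr1 (tens X Y) Z)"
    and 2: "chom (tens (tens X Y) Z) Y (pr2 X Y \<cdot> pr1 (tens X Y) Z)"
    and 3: "chom (tens (tens X Y) Z) Z (pr2 (tens X Y) Z)"
    by (auto intro!: chom_Cmp[OF chom_pr1] chom_pr1 chom_pr2)
  show ?thesis1 ?thesis2 ?thesis3
    unfolding assoc_eq_pair[OF assms]
    by (simp_all only: pr_pair[OF 1 chom_pair[OF 2 3]] pr_pair[OF 2 3])
qed

text \<open>Cocommutativity of the tensor product allows its two copies to be swapped before
  projecting.\<close>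

lemma symm_eq_pair:
  assumes [simp]: "cocomm X" "cocomm Y"
  shows "\<sigma> (Car X) (Car Y) = pair (tens X Y) (pr2 X Y) (pr1 X Y)"
proof -
  let ?T = "tens X Y"
  have "pair ?T (pr2 X Y) (pr1 X Y) = (pr2 X Y \<boxtimes> pr1 X Y) \<cdot> \<sigma> (Car ?T) (Car ?T) \<cdot> Dup ?T"
    by (simp only: cocomm_laws(4) cocomm_tens assms pair_def)
  also have "\<dots> = \<sigma> (Car X) (Car Y) \<cdot> pair ?T (pr1 X Y) (pr2 X Y)"
    by (simp add: symm_nat pair_def)
  finally show ?thesis by (simp add: pair_pr)
qed

lemma chom_symm:
  assumes [simp]: "cocomm X" "cocomm Y"
  shows "chom (tens X Y) (tens Y X) (\<sigma> (Car X) (Car Y))"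
  unfolding symm_eq_pair[OF assms] by (intro chom_pair chom_pr1 chom_pr2) simp_all

lemma pr_symm:
  assumes [simp]: "cocomm X" "cocomm Y"
  shows "pr1 Y X \<cdot> \<sigma> (Car X) (Car Y) = pr2 X Y" "pr2 Y X \<cdot> \<sigma> (Car X) (Car Y) = pr1 X Y"
  unfolding symm_eq_pair[OF assms] by (simp_all add: pr_pair[OF chom_pr2 chom_pr1])

lemma lunit_eq_pr2: "cocomm X \<Longrightarrow> lu (Car X) = pr2 triv X"
  by (simp add: pr2_def)

lemma runit_eq_pr1: "cocomm X \<Longrightarrow> ru (Car X) = pr1 X triv"
  by (simp add: pr1_def)

end

section \<open>The PROP of matrices\<close>

definition dsum :: "'r::zero mat \<Rightarrow> 'r mat \<Rightarrow> 'r mat" where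
  "dsum f g = four_block_mat f (0\<^sub>m (dim_row f) (dim_col g)) (0\<^sub>m (dim_row g) (dim_col f)) g"

text \<open>Left multiplication selects row \<open>p i\<close> as the new row \<open>i\<close>.
  Identities, symmetries and diagonals all have this form, and composition reverses the order of the
  index functions, so equations between such matrices become equations between functions.\<close>

definition fun_mat :: "nat \<Rightarrow> nat \<Rightarrow> (nat \<Rightarrow> nat) \<Rightarrow> 'r::comm_rig mat" where
  "fun_mat n k p = mat n k (\<lambda>(i, j). if j = p i then 1 else 0)"

lemma dim_dsum [simp]:
  "dim_row (dsum f g) = dim_row f + dim_row g" "dim_col (dsum f g) = dim_col f + dim_col g"
  by (simp_all add: dsum_def)

lemma index_dsum:
  assumes "i < dim_row f + dim_row g" "j < dim_col f + dim_col g"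
  shows "dsum f g $$ (i, j) =
    (if i < dim_row f then if j < dim_col f then f $$ (i, j) else 0
     else if j < dim_col f then 0 else g $$ (i - dim_row f, j - dim_col f))"
  using assms by (auto simp: dsum_def)

lemma dim_fun_mat [simp]: "dim_row (fun_mat n k p) = n" "dim_col (fun_mat n k p) = k"
  by (simp_all add: fun_mat_def)

lemma index_fun_mat: "\<lbrakk>i < n; j < k\<rbrakk> \<Longrightarrow> fun_mat n k p $$ (i, j) = (if j = p i then 1 else 0)"
  by (simp add: fun_mat_def)

lemma fun_mat_mult:
  fixes Q :: "'r::comm_rig mat"
  assumes "dim_row Q = k" "\<And>i. i < n \<Longrightarrow> p i < k"
  shows "fun_mat n k p * Q = mat n (dim_col Q) (\<lambda>(i, j). Q $$ (p i, j))"
proof (rule eq_matI)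
  fix i j
  assume "i < dim_row (mat n (dim_col Q) (\<lambda>(i, j). Q $$ (p i, j)))"
    and "j < dim_col (mat n (dim_col Q) (\<lambda>(i, j). Q $$ (p i, j)))"
  then have ij: "i < n" "j < dim_col Q" by simp_all
  have "(fun_mat n k p * Q) $$ (i, j) = (\<Sum>l = 0..<k. fun_mat n k p $$ (i, l) * Q $$ (l, j))"
    using ij assms by (simp add: scalar_prod_def)
  also have "\<dots> = (\<Sum>l = 0..<k. if l = p i then Q $$ (p i, j) else 0)"
    using ij by (intro sum.cong) (auto simp: index_fun_mat)
  also have "\<dots> = Q $$ (p i, j)" using assms(2)[OF ij(1)] by simp
  finally show "(fun_mat n k p * Q) $$ (i, j) = mat n (dim_col Q) (\<lambda>(i, j). Q $$ (p i, j)) $$ (i, j)"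
    using ij by simp
qed simp_all

lemma one_eq_fun_mat: "1\<^sub>m n = fun_mat n n (\<lambda>i. i)"
  by (rule eq_matI) (auto simp: index_fun_mat)

lemma one_mult_mat [simp]:
  fixes A :: "'r::comm_rig mat"
  shows "dim_row A = n \<Longrightarrow> 1\<^sub>m n * A = A"
  unfolding one_eq_fun_mat by (subst fun_mat_mult) (auto intro!: eq_matI)

lemma mult_one_mat [simp]:
  fixes A :: "'r::comm_rig mat"
  assumes "dim_col A = n"
  shows "A * 1\<^sub>m n = A"
proof (rule eq_matI)
  fix i j assume ij: "i < dim_row A" "j < dim_col A"
  have "(A * 1\<^sub>m n) $$ (i, j) = (\<Sum>l = 0..<n. A $$ (i, l) * 1\<^sub>m n $$ (l, j))"
    using ij assms by (simp add: scalar_prod_def)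
  also have "\<dots> = (\<Sum>l = 0..<n. if l = j then A $$ (i, j) else 0)"
    using ij assms by (intro sum.cong) auto
  also have "\<dots> = A $$ (i, j)" using ij assms by simp
  finally show "(A * 1\<^sub>m n) $$ (i, j) = A $$ (i, j)" .
qed (use assms in simp_all)

lemma dsum_mult:
  fixes f g f' g' :: "'r::comm_rig mat"
  assumes "dim_col g = dim_row f" "dim_col g' = dim_row f'"
  shows "dsum g g' * dsum f f' = dsum (g * f) (g' * f')"
  unfolding dsum_def
  by (subst mult_four_block_mat[where ?nr1.0 = "dim_row g" and ?nr2.0 = "dim_row g'" and
        ?n1.0 = "dim_row f" and ?n2.0 = "dim_row f'" and ?nc1.0 = "dim_col f" and ?nc2.0 = "dim_col f'"])
    (use assms in \<open>auto intro!: cong_four_block_mat carrier_matI\<close>)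

lemma dsum_one [simp]: "dsum (1\<^sub>m m) (1\<^sub>m n) = (1\<^sub>m (m + n) :: 'r::comm_rig mat)"
  by (simp add: dsum_def)

lemma dsum_assoc: "dsum (dsum f g) h = dsum f (dsum g h)"
  using assoc_four_block_mat[of f g h] by (simp add: dsum_def)

lemma dsum_fun_mat:
  assumes "\<And>i. i < n \<Longrightarrow> p i < k"
  shows "dsum (fun_mat n k p) (fun_mat n' k' p') =
    (fun_mat (n + n') (k + k') (\<lambda>i. if i < n then p i else k + p' (i - n)) :: 'r::comm_rig mat)"
  by (rule eq_matI) (use assms in \<open>auto simp: index_dsum index_fun_mat\<close>)

lemma fun_mat_comp:
  assumes "\<And>i. i < n \<Longrightarrow> p i < k"
  shows "fun_mat n k p * fun_mat k l q = (fun_mat n l (\<lambda>i. q (p i)) :: 'r::comm_rig mat)"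
  by (subst fun_mat_mult) (use assms in \<open>auto intro!: eq_matI simp: index_fun_mat\<close>)

lemma fun_mat_cong:
  assumes "\<And>i. i < n \<Longrightarrow> p i = q i"
  shows "fun_mat n k p = fun_mat n k q"
  by (rule eq_matI) (use assms in \<open>auto simp: index_fun_mat\<close>)

definition swap_mat :: "nat \<Rightarrow> nat \<Rightarrow> 'r::comm_rig mat" where
  "swap_mat m n = four_block_mat (0\<^sub>m n m) (1\<^sub>m n) (1\<^sub>m m) (0\<^sub>m m n)"

lemma swap_mat_eq_fun_mat: "swap_mat m n = fun_mat (n + m) (m + n) (\<lambda>i. if i < n then m + i else i - n)"
  unfolding swap_mat_def by (rule eq_matI) (auto simp: index_fun_mat)

lemma dim_swap_mat [simp]: "dim_row (swap_mat m n) = n + m" "dim_col (swap_mat m n) = m + n"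
  by (simp_all add: swap_mat_def)

lemma swap_mat_natural:
  fixes f g :: "'r::comm_rig mat"
  shows "swap_mat (dim_row f) (dim_row g) * dsum f g = dsum g f * swap_mat (dim_col f) (dim_col g)"
proof -
  have "swap_mat (dim_row f) (dim_row g) * dsum f g =
      four_block_mat (0\<^sub>m (dim_row g) (dim_col f)) g f (0\<^sub>m (dim_row f) (dim_col g))"
    unfolding dsum_def swap_mat_def
    by (subst mult_four_block_mat[where ?nr1.0 = "dim_row g" and ?nr2.0 = "dim_row f" and
        ?n1.0 = "dim_row f" and ?n2.0 = "dim_row g" and ?nc1.0 = "dim_col f" and ?nc2.0 = "dim_col g"])
      (auto intro!: cong_four_block_mat carrier_matI)
  also have "\<dots> = dsum g f * swap_mat (dim_col f) (dim_col g)"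
    unfolding dsum_def swap_mat_def
    by (subst mult_four_block_mat[where ?nr1.0 = "dim_row g" and ?nr2.0 = "dim_row f" and
        ?n1.0 = "dim_col g" and ?n2.0 = "dim_col f" and ?nc1.0 = "dim_col f" and ?nc2.0 = "dim_col g"])
      (auto intro!: cong_four_block_mat carrier_matI)
  finally show ?thesis .
qed

lemma swap_mat_swap_mat: "swap_mat n m * swap_mat m n = (1\<^sub>m (m + n) :: 'r::comm_rig mat)"
  unfolding swap_mat_eq_fun_mat one_eq_fun_mat
  by (subst fun_mat_comp) (auto intro!: fun_mat_cong)

lemma swap_mat_hexagon:
  "dsum (1\<^sub>m b) (swap_mat a c) * dsum (swap_mat a b) (1\<^sub>m c) = (swap_mat a (b + c) :: 'r::comm_rig mat)"
proof -
  have 1: "dsum (1\<^sub>m b) (swap_mat a c) = (fun_mat (b + (c + a)) (b + (a + c))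
      (\<lambda>i. if i < b then i else b + (if i - b < c then a + (i - b) else i - b - c)) :: 'r mat)"
    unfolding swap_mat_eq_fun_mat one_eq_fun_mat by (subst dsum_fun_mat) auto
  have 2: "dsum (swap_mat a b) (1\<^sub>m c) = (fun_mat (b + (a + c)) (a + (b + c))
      (\<lambda>i. if i < b + a then if i < b then a + i else i - b else a + b + (i - (b + a))) :: 'r mat)"
    unfolding swap_mat_eq_fun_mat one_eq_fun_mat by (subst dsum_fun_mat) (auto simp: add.assoc)
  show ?thesis
    unfolding 1 2 unfolding swap_mat_eq_fun_mat
    by (subst fun_mat_comp) (auto simp: add.assoc intro!: fun_mat_cong)
qed

lemma dsum_one_zero [simp]: "dsum (1\<^sub>m 0) f = (f :: 'r::comm_rig mat)" "dsum f (1\<^sub>m 0) = (f :: 'r::comm_rig mat)"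
  by (auto intro!: eq_matI simp: index_dsum)

lemma Mat_simps [simp]:
  "Obj (Mat R) = UNIV" "Arr (Mat R) = UNIV" "Dom (Mat R) = dim_col" "Cod (Mat R) = dim_row"
  "Idn (Mat R) n = 1\<^sub>m n" "Cmp (Mat R) g f = g * f" "TenO (Mat R) m n = m + n"
  "TenA (Mat R) f g = dsum f g" "unit (Mat R) = 0" "assoc (Mat R) k m n = 1\<^sub>m (k + m + n)"
  "lunit (Mat R) n = 1\<^sub>m n" "runit (Mat R) n = 1\<^sub>m n" "symm (Mat R) m n = swap_mat m n"
  by (simp_all add: Mat_def dsum_def swap_mat_def)

lemma in_hom_Mat [simp]: "in_hom (Mat R) f a b \<longleftrightarrow> dim_col f = a \<and> dim_row f = b"
  by (simp add: in_hom_def)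

lemma category_Mat: "category (Mat (R :: 'r::comm_rig itself))"
  by unfold_locales (auto intro!: assoc_mult_mat carrier_matI)

lemma symmetric_monoidal_category_Mat: "symmetric_monoidal_category (Mat (R :: 'r::comm_rig itself))"
proof -
  interpret category "Mat R" by (rule category_Mat)
  have iso: "is_iso (Mat R) (1\<^sub>m n)" for n using inv_arr_Idn(1)[of n] by simp
  show ?thesis
  proof (unfold_locales, goal_cases)
    \<comment> \<open>Naturality of the symmetry, the one axiom whose dimensions have to be
      instantiated from the arrows.\<close>
    case (18 f a b g c d)
    then show ?case using swap_mat_natural[of f g] by auto
  qed (auto simp: iso dsum_mult dsum_assoc add.assoc swap_mat_swap_mat swap_mat_hexagon)
qed

lemma is_PROP_Mat: "is_PROP (Mat (R :: 'r::comm_rig itself))"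
  using symmetric_monoidal_category_Mat[of R] by (simp add: is_PROP_def)

section \<open>The functor induced by a bimonoid with an action\<close>

definition mul_mat :: "'r::comm_rig mat" where "mul_mat = mat 1 2 (\<lambda>_. 1)"
definition unit_mat :: "'r::comm_rig mat" where "unit_mat = 0\<^sub>m 1 0"
definition comul_mat :: "'r::comm_rig mat" where "comul_mat = mat 2 1 (\<lambda>_. 1)"
definition counit_mat :: "'r::comm_rig mat" where "counit_mat = 0\<^sub>m 0 1"
definition scalar_mat :: "'r::comm_rig \<Rightarrow> 'r mat" where "scalar_mat r = mat 1 1 (\<lambda>_. r)"

lemma dim_generators [simp]:
  "dim_row mul_mat = 1" "dim_col mul_mat = 2" "dim_row unit_mat = 1" "dim_col unit_mat = 0"
  "dim_row comul_mat = 2" "dim_col comul_mat = 1" "dim_row counit_mat = 0" "dim_col counit_mat = 1"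
  "dim_row (scalar_mat r) = 1" "dim_col (scalar_mat r) = 1"
  by (simp_all add: mul_mat_def unit_mat_def comul_mat_def counit_mat_def scalar_mat_def)

locale rig_module = bicommutative_bimonoid C A
  for C :: "('o, 'm, 'x) smc_data_scheme" (structure) and A :: "('o, 'm) bimonoid_data" +
  fixes \<phi> :: "'r::comm_rig \<Rightarrow> 'm"
  assumes action: "\<phi> \<in> rig_hom (End C A)"
begin

definition K :: "('o, 'm) comonoid_data" where
  "K = \<lparr>Car = Ob A, Dup = Comul A, Del = Counit A\<rparr>"

lemma K_simps: "Car K = Ob A" "Dup K = Comul A" "Del K = Counit A"
  by (simp_all add: K_def)

lemma cocomm_K [simp]: "cocomm K"
  unfolding cocomm_def K_simps by (rule cocommutative_comonoid_in_axioms)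

lemma monoid_simps [simp]:
  "Mul A \<in> Arr C" "Dom C (Mul A) = Car K \<boxdot> Car K" "Cod C (Mul A) = Car K"
  "One A \<in> Arr C" "Dom C (One A) = \<I>" "Cod C (One A) = Car K"
  using mul_hom one_hom by (auto simp: in_hom_def K_simps)

text \<open>Two of the bimonoid axioms, read as the statement that the multiplication is a
  homomorphism out of the tensor comonoid; the other two do the same for the unit in
  \<open>chom_One\<close>.\<close>

lemma chom_Mul: "chom (tens K K) K (Mul A)"
  by (rule chomI) (use Comul_Mul Counit_Mul in \<open>simp_all add: K_simps(2,3) middle_swap_eq_mid\<close>, simp_all add: K_simps)

lemma chom_One: "chom triv K (One A)"
  by (rule chomI) (use Comul_One Counit_One in \<open>simp_all add: K_simps\<close>)

lemma action_laws:
  "chom K K (\<phi> r)" "Mul A \<cdot> (\<phi> r \<boxtimes> \<phi> r) = \<phi> r \<cdot> Mul A" "\<phi> r \<cdot> One A = One A"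
  "\<phi> 0 = One A \<cdot> Del K" "\<phi> (r + s) = Mul A \<cdot> pair K (\<phi> r) (\<phi> s)"
  "\<phi> 1 = \<iota> (Car K)" "\<phi> (r * s) = \<phi> r \<cdot> \<phi> s"
  using action cocomm_K
  by (auto simp: rig_hom_def End_def bimonoid_homs_def chom_def K_simps pair_def)

lemmas action_simps [simp] = chomD(3-5)[OF action_laws(1)]

section \<open>Convolution: the homomorphisms from a comonoid \<open>X\<close> to \<open>A\<close>
  form a module over the rig\<close>

definition add :: "('o, 'm) comonoid_data \<Rightarrow> 'm \<Rightarrow> 'm \<Rightarrow> 'm" where
  "add X f g = Mul A \<cdot> pair X f g"

definition nil :: "('o, 'm) comonoid_data \<Rightarrow> 'm" where
  "nil X = One A \<cdot> Del X"

lemma chom_add: "\<lbrakk>chom X K f; chom X K g\<rbrakk> \<Longrightarrow> chom X K (add X f g)"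
  unfolding add_def by (rule chom_Cmp[OF chom_pair chom_Mul])

lemma chom_nil: "cocomm X \<Longrightarrow> chom X K (nil X)"
  unfolding nil_def by (rule chom_Cmp[OF chom_Del chom_One])

lemma add_Cmp:
  assumes f: "chom X K f" and g: "chom X K g" and h: "chom W X h"
  shows "add X f g \<cdot> h = add W (f \<cdot> h) (g \<cdot> h)"
  using chomD(1-5)[OF f] chomD(1-5)[OF g] chomD(1-5)[OF h]
  by (simp add: add_def pair_Cmp[OF f g h])

lemma nil_Cmp: "chom W X h \<Longrightarrow> nil X \<cdot> h = nil W"
  using chomD[of W X h] by (simp add: nil_def)

text \<open>Commutativity of the multiplication inserts a symmetry, and cocommutativity of
  \<open>X\<close> absorbs it.\<close>

lemma add_commute:
  assumes f: "chom X K f" and g: "chom X K g"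
  shows "add X f g = add X g f"
proof -
  note [simp] = chomD(1-5)[OF f] chomD(1-5)[OF g]
  have "add X f g = Mul A \<cdot> \<sigma> (Car K) (Car K) \<cdot> pair X f g"
    using Cmp_reassoc[OF mul_comm, of "pair X f g"] by (simp add: K_simps[symmetric] add_def)
  also have "\<dots> = add X g f"
    by (simp add: add_def pair_def symm_nat cocomm_laws)
  finally show ?thesis .
qed

lemma add_assoc:
  assumes f: "chom X K f" and g: "chom X K g" and h: "chom X K h"
  shows "add X (add X f g) h = add X f (add X g h)"
proof -
  note [simp] = chomD(1-5)[OF f] chomD(1-5)[OF g] chomD(1-5)[OF h]
  let ?a = "Car K"
  have "add X (add X f g) h = Mul A \<cdot> (Mul A \<boxtimes> \<iota> ?a) \<cdot> ((f \<boxtimes> g) \<boxtimes> h) \<cdot> (Dup X \<boxtimes> \<iota> (Car X)) \<cdot> Dup X"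
    by (simp add: add_def pair_def TenA_merge)
  also have "\<dots> = Mul A \<cdot> (\<iota> ?a \<boxtimes> Mul A) \<cdot> \<alpha> ?a ?a ?a \<cdot>
      ((f \<boxtimes> g) \<boxtimes> h) \<cdot> (Dup X \<boxtimes> \<iota> (Car X)) \<cdot> Dup X"
    using Cmp_reassoc[OF mul_assoc, of "((f \<boxtimes> g) \<boxtimes> h) \<cdot> (Dup X \<boxtimes> \<iota> (Car X)) \<cdot> Dup X"]
    by (simp add: K_simps[symmetric])
  also have "\<dots> = Mul A \<cdot> (\<iota> ?a \<boxtimes> Mul A) \<cdot> (f \<boxtimes> (g \<boxtimes> h)) \<cdot> (\<iota> (Car X) \<boxtimes> Dup X) \<cdot> Dup X"
    by (simp add: assoc_nat(2) cocomm_laws)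
  also have "\<dots> = add X f (add X g h)"
    by (simp add: add_def pair_def TenA_merge)
  finally show ?thesis .
qed

lemma add_nil:
  assumes f: "chom X K f"
  shows "add X (nil X) f = f" "add X f (nil X) = f"
proof -
  note [simp] = chomD(1-5)[OF f]
  let ?a = "Car K"
  have "add X (nil X) f = (Mul A \<cdot> (One A \<boxtimes> \<iota> ?a)) \<cdot> (\<iota> \<I> \<boxtimes> f) \<cdot> (Del X \<boxtimes> \<iota> (Car X)) \<cdot> Dup X"
    by (simp add: add_def nil_def pair_def TenA_merge)
  also have "Mul A \<cdot> (One A \<boxtimes> \<iota> ?a) = lu ?a"
    using mul_lunit by (simp add: K_simps)
  finally show *: "add X (nil X) f = f"
    by (simp add: cocomm_laws lunit_nat)
  show "add X f (nil X) = f"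
    using add_commute[OF f chom_nil[of X]] * by simp
qed

lemma add_medial:
  assumes f: "chom X K f" and g: "chom X K g" and h: "chom X K h" and k: "chom X K k"
  shows "add X (add X f g) (add X h k) = add X (add X f h) (add X g k)"
  by (metis add_assoc add_commute chom_add assms)

text \<open>Additivity of the action is precisely compatibility of \<open>\<phi> r\<close> with the
  multiplication of \<open>A\<close>.\<close>

lemma action_add:
  assumes f: "chom X K f" and g: "chom X K g"
  shows "\<phi> r \<cdot> add X f g = add X (\<phi> r \<cdot> f) (\<phi> r \<cdot> g)"
proof -
  note [simp] = chomD(1-5)[OF f] chomD(1-5)[OF g]
  have "\<phi> r \<cdot> add X f g = (Mul A \<cdot> (\<phi> r \<boxtimes> \<phi> r)) \<cdot> (f \<boxtimes> g) \<cdot> Dup X"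
    by (subst action_laws(2)) (simp add: add_def pair_def)
  then show ?thesis by (simp add: add_def pair_def TenA_merge)
qed

lemma action_nil: "cocomm X \<Longrightarrow> \<phi> r \<cdot> nil X = nil X"
  using Cmp_reassoc[OF action_laws(3)[of r], of "Del X"] by (simp add: nil_def)

lemma action_plus:
  assumes f: "chom X K f"
  shows "\<phi> (r + s) \<cdot> f = add X (\<phi> r \<cdot> f) (\<phi> s \<cdot> f)"
  using chomD(1-5)[OF f] pair_Cmp[OF action_laws(1) action_laws(1) f, of r s]
  by (simp add: action_laws(5) add_def)

lemma action_zero: "chom X K f \<Longrightarrow> \<phi> 0 \<cdot> f = nil X"
  using chomD[of X K f] by (simp add: action_laws(4) nil_def)

lemma action_one: "chom X K f \<Longrightarrow> \<phi> 1 \<cdot> f = f"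
  using chomD[of X K f] by (simp add: action_laws(6))

lemma action_times: "chom X K f \<Longrightarrow> \<phi> (r * s) \<cdot> f = \<phi> r \<cdot> \<phi> s \<cdot> f"
  using chomD[of X K f] by (simp add: action_laws(7))

lemma chom_action: "chom X K f \<Longrightarrow> chom X K (\<phi> r \<cdot> f)"
  by (rule chom_Cmp[OF _ action_laws(1)])

text \<open>Finite sums for convolution. The monoid varies with \<open>X\<close> and lives on a
  subset of the arrows, so the comonoid is carried as an argument.\<close>

primrec lsum :: "('o, 'm) comonoid_data \<Rightarrow> nat \<Rightarrow> (nat \<Rightarrow> 'm) \<Rightarrow> 'm" where
  "lsum X 0 f = nil X"
| "lsum X (Suc n) f = add X (lsum X n f) (f n)"

lemma lsum_cong: "(\<And>i. i < n \<Longrightarrow> f i = g i) \<Longrightarrow> lsum X n f = lsum X n g"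
  by (induction n) auto

lemma chom_lsum: "\<lbrakk>cocomm X; \<And>i. i < n \<Longrightarrow> chom X K (f i)\<rbrakk> \<Longrightarrow> chom X K (lsum X n f)"
  by (induction n) (auto intro: chom_nil chom_add)

lemma lsum_Cmp:
  assumes h: "chom W X h"
  shows "(\<And>i. i < n \<Longrightarrow> chom X K (f i)) \<Longrightarrow> lsum X n f \<cdot> h = lsum W n (\<lambda>i. f i \<cdot> h)"
proof (induction n)
  case (Suc n)
  then show ?case using chomD(1)[OF chom_nil] chomD(2)[OF h]
    by (simp add: add_Cmp[OF chom_lsum _ h])
qed (use h in \<open>simp add: nil_Cmp\<close>)

lemma action_lsum:
  assumes [simp]: "cocomm X"
  shows "(\<And>i. i < n \<Longrightarrow> chom X K (f i)) \<Longrightarrow> \<phi> r \<cdot> lsum X n f = lsum X n (\<lambda>i. \<phi> r \<cdot> f i)"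
proof (induction n)
  case (Suc n)
  then show ?case by (simp add: action_add[OF chom_lsum])
qed (simp add: action_nil)

lemma lsum_nil: "cocomm X \<Longrightarrow> lsum X n (\<lambda>i. nil X) = nil X"
  by (induction n) (simp_all add: add_nil chom_nil)

lemma lsum_add:
  assumes [simp]: "cocomm X"
  shows "\<lbrakk>\<And>i. i < n \<Longrightarrow> chom X K (f i); \<And>i. i < n \<Longrightarrow> chom X K (g i)\<rbrakk> \<Longrightarrow>
    lsum X n (\<lambda>i. add X (f i) (g i)) = add X (lsum X n f) (lsum X n g)"
proof (induction n)
  case (Suc n)
  then show ?case by (simp add: add_medial chom_lsum)
qed (simp add: add_nil chom_nil)

text \<open>The exchange of sums on which multiplicativity of the matrix action rests; it goes back
  to \<open>add_medial\<close>, hence to commutativity of convolution.\<close>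

lemma lsum_swap:
  assumes [simp]: "cocomm X"
  shows "(\<And>i j. i < m \<Longrightarrow> j < n \<Longrightarrow> chom X K (f i j)) \<Longrightarrow>
    lsum X m (\<lambda>i. lsum X n (f i)) = lsum X n (\<lambda>j. lsum X m (\<lambda>i. f i j))"
proof (induction m)
  case (Suc m)
  then show ?case by (simp add: lsum_add chom_lsum)
qed (simp add: lsum_nil)

lemma action_sum:
  assumes f: "chom X K f"
  shows "\<phi> (\<Sum>k<n. c k) \<cdot> f = lsum X n (\<lambda>k. \<phi> (c k) \<cdot> f)"
  by (induction n) (simp_all add: action_zero[OF f] action_plus[OF f])

lemma lsum_split:
  assumes [simp]: "cocomm X"
  shows "(\<And>i. i < m + n \<Longrightarrow> chom X K (f i)) \<Longrightarrow>
    lsum X (m + n) f = add X (lsum X m f) (lsum X n (\<lambda>j. f (m + j)))"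
proof (induction n)
  case (Suc n)
  then show ?case by (simp add: add_assoc chom_lsum)
qed (simp add: add_nil chom_lsum)

lemma lsum_delta:
  assumes [simp]: "cocomm X" and g: "chom X K g"
  shows "lsum X n (\<lambda>j. if j = i then g else nil X) = (if i < n then g else nil X)"
proof (induction n)
  case (Suc n)
  then show ?case using g by (auto simp: add_nil chom_nil less_Suc_eq)
qed simp

section \<open>Left-nested powers of \<open>A\<close> as iterated products; \<open>T 1\<close> is
  \<open>\<I> \<boxdot> A\<close> and not \<open>A\<close>\<close>

primrec T :: "nat \<Rightarrow> ('o, 'm) comonoid_data" where
  "T 0 = triv"
| "T (Suc n) = tens (T n) K"

text \<open>Coordinates count from 0, and the last factor has index \<open>n\<close> in
  \<open>T (Suc n)\<close>. The value at 0 is a placeholder, since the empty power has no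
  coordinates.\<close>

primrec proj :: "nat \<Rightarrow> nat \<Rightarrow> 'm" where
  "proj 0 i = nil triv"
| "proj (Suc n) i = (if i = n then pr2 (T n) K else proj n i \<cdot> pr1 (T n) K)"

primrec tup :: "('o, 'm) comonoid_data \<Rightarrow> nat \<Rightarrow> (nat \<Rightarrow> 'm) \<Rightarrow> 'm" where
  "tup X 0 f = Del X"
| "tup X (Suc n) f = pair X (tup X n f) (f n)"

lemma cocomm_T [simp]: "cocomm (T n)"
  by (induction n) auto

lemma chom_proj: "i < n \<Longrightarrow> chom (T n) K (proj n i)"
proof (induction n)
  case (Suc n)
  then show ?case using chom_Cmp[OF chom_pr1] chom_pr2 by (auto simp: less_Suc_eq)
qed simp

lemmas proj_simps [simp] = chomD(3-5)[OF chom_proj]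

lemma chom_tup: "\<lbrakk>cocomm X; \<And>i. i < n \<Longrightarrow> chom X K (f i)\<rbrakk> \<Longrightarrow> chom X (T n) (tup X n f)"
  by (induction n) (auto intro: chom_Del chom_pair)

lemma proj_tup:
  assumes [simp]: "cocomm X"
  shows "\<lbrakk>\<And>i. i < n \<Longrightarrow> chom X K (f i); i < n\<rbrakk> \<Longrightarrow> proj n i \<cdot> tup X n f = f i"
proof (induction n)
  case (Suc n)
  have t: "chom X (T n) (tup X n f)" and fn: "chom X K (f n)"
    using Suc.prems by (auto intro: chom_tup)
  note [simp] = chomD(3-5)[OF t] chomD(3-5)[OF fn]
  show ?case using Suc by (auto simp: pr_pair[OF t fn] less_Suc_eq)
qed simp

text \<open>Coordinates are jointly monic on homomorphisms. Later equations between arrows into a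
  power are reduced to coordinates by this rule, which replaces coherence chases.\<close>

lemma T_ext:
  "\<lbrakk>chom X (T n) h; chom X (T n) k; \<And>i. i < n \<Longrightarrow> proj n i \<cdot> h = proj n i \<cdot> k\<rbrakk> \<Longrightarrow> h = k"
proof (induction n arbitrary: h k)
  case 0
  then show ?case using chom_triv_unique by (metis T.simps(1))
next
  case (Suc n)
  note [simp] = chomD(3)[OF Suc.prems(1)] chomD(4,5)[OF Suc.prems(1), simplified]
    chomD(3)[OF Suc.prems(2)] chomD(4,5)[OF Suc.prems(2), simplified]
  show ?case
  proof (rule chom_tens_ext)
    show "chom X (tens (T n) K) h" "chom X (tens (T n) K) k" using Suc.prems by simp_all
    then have "chom X (T n) (pr1 (T n) K \<cdot> h)" "chom X (T n) (pr1 (T n) K \<cdot> k)"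
      by (auto intro: chom_Cmp[OF _ chom_pr1])
    moreover have "proj n i \<cdot> pr1 (T n) K \<cdot> h = proj n i \<cdot> pr1 (T n) K \<cdot> k" if "i < n" for i
      using Suc.prems(3)[of i] that by simp
    ultimately show "pr1 (T n) K \<cdot> h = pr1 (T n) K \<cdot> k" by (rule Suc.IH)
    show "pr2 (T n) K \<cdot> h = pr2 (T n) K \<cdot> k" using Suc.prems(3)[of n] by simp
  qed simp_all
qed

section \<open>The action of matrices: a row is a linear combination of coordinates\<close>

definition row_map :: "'r mat \<Rightarrow> nat \<Rightarrow> 'm" where
  "row_map M i = lsum (T (dim_col M)) (dim_col M) (\<lambda>j. \<phi> (M $$ (i, j)) \<cdot> proj (dim_col M) j)"

definition mat_map :: "'r mat \<Rightarrow> 'm" where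
  "mat_map M = tup (T (dim_col M)) (dim_row M) (row_map M)"

lemma chom_row_map: "chom (T (dim_col M)) K (row_map M i)"
  unfolding row_map_def by (intro chom_lsum chom_action chom_proj) simp_all

lemma chom_mat_map: "chom (T (dim_col M)) (T (dim_row M)) (mat_map M)"
  unfolding mat_map_def by (intro chom_tup chom_row_map) simp_all

lemmas mat_map_simps [simp] = chomD(3-5)[OF chom_mat_map]

lemma proj_mat_map: "i < dim_row M \<Longrightarrow> proj (dim_row M) i \<cdot> mat_map M = row_map M i"
  unfolding mat_map_def by (intro proj_tup chom_row_map) simp_all

lemma row_map_Cmp:
  assumes h: "chom W (T (dim_col M)) h"
  shows "row_map M i \<cdot> h = lsum W (dim_col M) (\<lambda>j. \<phi> (M $$ (i, j)) \<cdot> proj (dim_col M) j \<cdot> h)"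
  using chomD(1-5)[OF h] unfolding row_map_def
  by (subst lsum_Cmp[OF h]) (auto intro!: chom_action chom_proj lsum_cong)

lemma proj_mat_map_Cmp:
  assumes h: "chom W (T (dim_col M)) h" and "i < dim_row M"
  shows "proj (dim_row M) i \<cdot> mat_map M \<cdot> h =
    lsum W (dim_col M) (\<lambda>j. \<phi> (M $$ (i, j)) \<cdot> proj (dim_col M) j \<cdot> h)"
  using Cmp_reassoc[OF proj_mat_map[OF assms(2)]] chomD(1-5)[OF h] assms
  by (simp add: row_map_Cmp[OF h])

text \<open>A row with a single 1 is a sum with one surviving term, because 0 acts as the zero of
  convolution and 1 as the identity.\<close>

lemma proj_fun_mat_Cmp:
  assumes h: "chom W (T k) h" and i: "i < n" and p: "p i < k"
  shows "proj n i \<cdot> mat_map (fun_mat n k p) \<cdot> h = proj k (p i) \<cdot> h"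
proof -
  note [simp] = chomD(1-5)[OF h]
  have hom: "chom W K (proj k j \<cdot> h)" if "j < k" for j
    by (rule chom_Cmp[OF h chom_proj[OF that]])
  have "proj n i \<cdot> mat_map (fun_mat n k p) \<cdot> h =
      lsum W k (\<lambda>j. \<phi> (fun_mat n k p $$ (i, j)) \<cdot> proj k j \<cdot> h)"
    using proj_mat_map_Cmp[of W "fun_mat n k p" h i] h i by simp
  also have "\<dots> = lsum W k (\<lambda>j. if j = p i then proj k (p i) \<cdot> h else nil W)"
    by (intro lsum_cong) (auto simp: index_fun_mat i action_one[OF hom] action_zero[OF hom])
  also have "\<dots> = proj k (p i) \<cdot> h"
    using lsum_delta[OF _ hom[OF p]] p by simp
  finally show ?thesis .
qed

lemma proj_fun_mat:
  assumes "i < n" "p i < k"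
  shows "proj n i \<cdot> mat_map (fun_mat n k p) = proj k (p i)"
  using proj_fun_mat_Cmp[OF chom_Idn, of k i n p] assms mat_map_simps[of "fun_mat n k p"] by simp

lemma mat_map_one: "mat_map (1\<^sub>m n) = \<iota> (Car (T n))"
proof (rule T_ext)
  show "chom (T n) (T n) (mat_map (1\<^sub>m n))" using chom_mat_map[of "1\<^sub>m n"] by simp
  show "chom (T n) (T n) (\<iota> (Car (T n)))" by (rule chom_Idn) simp
  show "proj n i \<cdot> mat_map (1\<^sub>m n) = proj n i \<cdot> \<iota> (Car (T n))" if "i < n" for i
    using that by (simp add: one_eq_fun_mat proj_fun_mat)
qed

text \<open>In each coordinate this is the formula for the entries of a product: substitute the rows
  of \<open>M\<close> into a row of \<open>N\<close>, distribute the action, exchange the sums and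
  collect scalars.\<close>

lemma mat_map_mult:
  assumes dim: "dim_col N = dim_row M"
  shows "mat_map (N * M) = mat_map N \<cdot> mat_map M"
proof (rule T_ext)
  let ?m = "dim_col M" and ?n = "dim_row M"
  note M = chom_mat_map[of M]
  note NM = chom_mat_map[of "N * M"]
  have N: "chom (T ?n) (T (dim_row N)) (mat_map N)" using chom_mat_map[of N] dim by simp
  show "chom (T ?m) (T (dim_row N)) (mat_map (N * M))" using NM by simp
  show "chom (T ?m) (T (dim_row N)) (mat_map N \<cdot> mat_map M)" by (rule chom_Cmp[OF M N])
  fix i assume i: "i < dim_row N"
  have "proj (dim_row N) i \<cdot> mat_map N \<cdot> mat_map M =
      lsum (T ?m) ?n (\<lambda>k. \<phi> (N $$ (i, k)) \<cdot> proj ?n k \<cdot> mat_map M)"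
    using proj_mat_map_Cmp[of "T ?m" N "mat_map M" i] M dim i by simp
  also have "\<dots> = lsum (T ?m) ?n (\<lambda>k. \<phi> (N $$ (i, k)) \<cdot> row_map M k)"
    by (intro lsum_cong) (simp add: proj_mat_map)
  also have "\<dots> = lsum (T ?m) ?n (\<lambda>k. lsum (T ?m) ?m (\<lambda>j. \<phi> (N $$ (i, k) * M $$ (k, j)) \<cdot> proj ?m j))"
    by (intro lsum_cong)
      (auto simp: row_map_def action_lsum chom_action chom_proj action_times[OF chom_proj] intro!: lsum_cong)
  \<comment> \<open>With the column index outermost, the inner sum acts on one fixed coordinate, so
    \<open>action_sum\<close> turns it into the action of an entry of the product.\<close>
  also have "\<dots> = lsum (T ?m) ?m (\<lambda>j. lsum (T ?m) ?n (\<lambda>k. \<phi> (N $$ (i, k) * M $$ (k, j)) \<cdot> proj ?m j))"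
    by (intro lsum_swap chom_action chom_proj) simp_all
  also have "\<dots> = lsum (T ?m) ?m (\<lambda>j. \<phi> ((N * M) $$ (i, j)) \<cdot> proj ?m j)"
    using i dim by (intro lsum_cong)
      (simp add: action_sum[OF chom_proj, symmetric] scalar_prod_def atLeast0LessThan)
  also have "\<dots> = proj (dim_row N) i \<cdot> mat_map (N * M)"
    using proj_mat_map[of i "N * M"] i by (simp add: row_map_def)
  finally show "proj (dim_row N) i \<cdot> mat_map (N * M) = proj (dim_row N) i \<cdot> mat_map N \<cdot> mat_map M" ..
qed

section \<open>Concatenation of coordinates, which supplies the structure maps of the
  functor\<close>

definition join :: "nat \<Rightarrow> nat \<Rightarrow> 'm" where
  "join m n = tup (tens (T m) (T n)) (m + n)
    (\<lambda>i. if i < m then proj m i \<cdot> pr1 (T m) (T n) else proj n (i - m) \<cdot> pr2 (T m) (T n))"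

definition split :: "nat \<Rightarrow> nat \<Rightarrow> 'm" where
  "split m n = pair (T (m + n)) (tup (T (m + n)) m (proj (m + n))) (tup (T (m + n)) n (\<lambda>i. proj (m + n) (m + i)))"

lemma join_component:
  "i < m + n \<Longrightarrow> chom (tens (T m) (T n)) K
    (if i < m then proj m i \<cdot> pr1 (T m) (T n) else proj n (i - m) \<cdot> pr2 (T m) (T n))"
  by (auto intro!: chom_Cmp[OF chom_pr1] chom_Cmp[OF chom_pr2] chom_proj)

lemma chom_join: "chom (tens (T m) (T n)) (T (m + n)) (join m n)"
  unfolding join_def by (intro chom_tup join_component) simp_all

lemma join_simps [simp]:
  "join m n \<in> Arr C" "Dom C (join m n) = Car (T m) \<boxdot> Car (T n)" "Cod C (join m n) = Car (T (m + n))"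
  using chomD(3-5)[OF chom_join[of m n]] by simp_all

lemma proj_join:
  assumes "i < m + n"
  shows "proj (m + n) i \<cdot> join m n =
    (if i < m then proj m i \<cdot> pr1 (T m) (T n) else proj n (i - m) \<cdot> pr2 (T m) (T n))"
  unfolding join_def by (rule proj_tup[OF _ join_component]) (use assms in simp_all)

lemma proj_join_Cmp:
  assumes "i < m + n" "h \<in> Arr C" "Cod C h = Car (T m) \<boxdot> Car (T n)"
  shows "proj (m + n) i \<cdot> join m n \<cdot> h =
    (if i < m then proj m i \<cdot> (pr1 (T m) (T n) \<cdot> h) else proj n (i - m) \<cdot> pr2 (T m) (T n) \<cdot> h)"
  using Cmp_reassoc[OF proj_join[OF assms(1)], of h] assms by simp

lemma chom_split_components:
  "chom (T (m + n)) (T m) (tup (T (m + n)) m (proj (m + n)))"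
  "chom (T (m + n)) (T n) (tup (T (m + n)) n (\<lambda>i. proj (m + n) (m + i)))"
  by (intro chom_tup chom_proj; simp)+

lemma chom_split: "chom (T (m + n)) (tens (T m) (T n)) (split m n)"
  unfolding split_def by (intro chom_pair chom_split_components)

lemma split_simps [simp]:
  "split m n \<in> Arr C" "Dom C (split m n) = Car (T (m + n))" "Cod C (split m n) = Car (T m) \<boxdot> Car (T n)"
  using chomD(3-5)[OF chom_split[of m n]] by simp_all

lemma proj_split:
  "i < m \<Longrightarrow> proj m i \<cdot> pr1 (T m) (T n) \<cdot> split m n = proj (m + n) i"
  "i < n \<Longrightarrow> proj n i \<cdot> pr2 (T m) (T n) \<cdot> split m n = proj (m + n) (m + i)"
  unfolding split_def pr_pair[OF chom_split_components]
  by (rule proj_tup, auto intro: chom_proj)+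

text \<open>The counterpart of \<open>T_ext\<close> for a product of two powers; it is needed to see
  that \<open>split\<close> follows \<open>join\<close> to the identity.\<close>

lemma T_tens_ext:
  assumes h: "chom X (tens (T m) (T n)) h" and k: "chom X (tens (T m) (T n)) k"
    and 1: "\<And>i. i < m \<Longrightarrow> proj m i \<cdot> pr1 (T m) (T n) \<cdot> h = proj m i \<cdot> pr1 (T m) (T n) \<cdot> k"
    and 2: "\<And>i. i < n \<Longrightarrow> proj n i \<cdot> pr2 (T m) (T n) \<cdot> h = proj n i \<cdot> pr2 (T m) (T n) \<cdot> k"
  shows "h = k"
proof (rule chom_tens_ext[OF h k])
  show "pr1 (T m) (T n) \<cdot> h = pr1 (T m) (T n) \<cdot> k"
    by (rule T_ext[OF chom_Cmp[OF h chom_pr1] chom_Cmp[OF k chom_pr1] 1]) simp_all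
  show "pr2 (T m) (T n) \<cdot> h = pr2 (T m) (T n) \<cdot> k"
    by (rule T_ext[OF chom_Cmp[OF h chom_pr2] chom_Cmp[OF k chom_pr2] 2]) simp_all
qed simp_all

lemma join_iso: "is_iso C (join m n)" "inv_arr C (join m n) = split m n"
proof -
  have js: "join m n \<cdot> split m n = \<iota> (Car (T (m + n)))"
    by (rule T_ext[OF chom_Cmp[OF chom_split chom_join] chom_Idn]) (auto simp: proj_join_Cmp proj_split)
  have sj: "split m n \<cdot> join m n = \<iota> (Car (tens (T m) (T n)))"
    by (rule T_tens_ext[OF chom_Cmp[OF chom_join chom_split] chom_Idn])
      (use Cmp_reassoc[OF proj_split(1), of _ m n "join m n"] Cmp_reassoc[OF proj_split(2), of _ n m "join m n"]
        in \<open>auto simp: proj_join\<close>)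
  show "is_iso C (join m n)" "inv_arr C (join m n) = split m n"
    using inv_arr_eqI[of "join m n" "split m n"] js sj by simp_all
qed

text \<open>Row \<open>i\<close> of the block sum is a sum over concatenated columns. Splitting it
  at the block boundary leaves one half with zero entries only, and the other half is a row of
  \<open>f\<close> or of \<open>g\<close>.\<close>

lemma join_nat:
  "join (dim_row f) (dim_row g) \<cdot> (mat_map f \<boxtimes> mat_map g) = mat_map (dsum f g) \<cdot> join (dim_col f) (dim_col g)"
proof (rule T_ext)
  let ?m = "dim_col f" and ?n = "dim_col g" and ?m' = "dim_row f" and ?n' = "dim_row g"
  let ?X = "tens (T ?m) (T ?n)" and ?D = "dsum f g"
  let ?p = "pr1 (T ?m) (T ?n)" and ?q = "pr2 (T ?m) (T ?n)"
  note fg = chom_TenA[OF chom_mat_map[of f] chom_mat_map[of g]]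
  show "chom ?X (T (?m' + ?n')) (join ?m' ?n' \<cdot> (mat_map f \<boxtimes> mat_map g))"
    by (rule chom_Cmp[OF fg chom_join])
  show "chom ?X (T (?m' + ?n')) (mat_map ?D \<cdot> join ?m ?n)"
    using chom_Cmp[OF chom_join[of ?m ?n], of "T (?m' + ?n')"] chom_mat_map[of ?D] by simp
  fix i assume i: "i < ?m' + ?n'"
  have p: "chom ?X (T ?m) ?p" and q: "chom ?X (T ?n) ?q" by (simp_all add: chom_pr1 chom_pr2)
  have "proj (?m' + ?n') i \<cdot> mat_map ?D \<cdot> join ?m ?n =
      lsum ?X (?m + ?n) (\<lambda>j. \<phi> (?D $$ (i, j)) \<cdot> proj (?m + ?n) j \<cdot> join ?m ?n)"
    using proj_mat_map_Cmp[of ?X ?D "join ?m ?n" i] chom_join[of ?m ?n] i by simp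
  also have "\<dots> = add ?X
      (lsum ?X ?m (\<lambda>j. \<phi> (?D $$ (i, j)) \<cdot> proj (?m + ?n) j \<cdot> join ?m ?n))
      (lsum ?X ?n (\<lambda>j. \<phi> (?D $$ (i, ?m + j)) \<cdot> proj (?m + ?n) (?m + j) \<cdot> join ?m ?n))"
    by (intro lsum_split chom_action chom_Cmp[OF chom_join chom_proj]) simp_all
  also have "\<dots> = add ?X (lsum ?X ?m (\<lambda>j. \<phi> (?D $$ (i, j)) \<cdot> proj ?m j \<cdot> ?p))
      (lsum ?X ?n (\<lambda>j. \<phi> (?D $$ (i, ?m + j)) \<cdot> proj ?n j \<cdot> ?q))" (is "_ = add _ ?l ?r")
    by (intro arg_cong2[where f = "add ?X"] lsum_cong) (simp_all add: proj_join)
  also have "\<dots> = proj (?m' + ?n') i \<cdot> join ?m' ?n' \<cdot> (mat_map f \<boxtimes> mat_map g)"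
  proof (cases "i < ?m'")
    case True
    have "?r = lsum ?X ?n (\<lambda>j. nil ?X)"
      using True by (intro lsum_cong) (simp add: index_dsum action_zero[OF chom_Cmp[OF q chom_proj]])
    moreover have "?l = row_map f i \<cdot> ?p"
      using True by (subst row_map_Cmp[OF p]) (auto simp: index_dsum intro!: lsum_cong)
    moreover have "row_map f i \<cdot> ?p = proj ?m' i \<cdot> mat_map f \<cdot> ?p"
      using Cmp_reassoc[OF proj_mat_map[OF True], of ?p] True by simp
    ultimately show ?thesis
      using True i chom_Cmp[OF p chom_row_map[of f i]]
      by (simp add: lsum_nil add_nil proj_join_Cmp pr_TenA[OF chom_mat_map chom_mat_map])
  next
    case False
    then have i': "i - ?m' < ?n'" using i by simp
    have "?l = lsum ?X ?m (\<lambda>j. nil ?X)"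
      using False i by (intro lsum_cong) (simp add: index_dsum action_zero[OF chom_Cmp[OF p chom_proj]])
    moreover have "?r = row_map g (i - ?m') \<cdot> ?q"
      using False i by (subst row_map_Cmp[OF q]) (auto simp: index_dsum intro!: lsum_cong)
    moreover have "row_map g (i - ?m') \<cdot> ?q = proj ?n' (i - ?m') \<cdot> mat_map g \<cdot> ?q"
      using Cmp_reassoc[OF proj_mat_map[OF i'], of ?q] i' by simp
    ultimately show ?thesis
      using False i chom_Cmp[OF q chom_row_map[of g "i - ?m'"]]
      by (simp add: lsum_nil add_nil proj_join_Cmp pr_TenA[OF chom_mat_map chom_mat_map])
  qed
  finally show "proj (?m' + ?n') i \<cdot> join ?m' ?n' \<cdot> (mat_map f \<boxtimes> mat_map g) =
      proj (?m' + ?n') i \<cdot> mat_map ?D \<cdot> join ?m ?n" ..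
qed

text \<open>Each coordinate of either side is a coordinate of one of the three factors; the two
  cascades of case distinctions agree.\<close>

lemma join_assoc:
  "join (a + b) c \<cdot> (join a b \<boxtimes> \<iota> (Car (T c))) =
    join a (b + c) \<cdot> (\<iota> (Car (T a)) \<boxtimes> join b c) \<cdot> \<alpha> (Car (T a)) (Car (T b)) (Car (T c))" (is "?L = ?R")
proof (rule T_ext)
  let ?X = "tens (tens (T a) (T b)) (T c)" and ?\<alpha> = "\<alpha> (Car (T a)) (Car (T b)) (Car (T c))"
  note id = chom_Idn[OF cocomm_T]
  note l = chom_TenA[OF chom_join[of a b] id[of c]] and r = chom_TenA[OF id[of a] chom_join[of b c]]
  show "chom ?X (T (a + b + c)) ?L" by (rule chom_Cmp[OF l chom_join])
  show "chom ?X (T (a + b + c)) ?R"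
    using chom_Cmp[OF chom_Cmp[OF chom_assoc r] chom_join] by (simp add: add.assoc)
  note pl = pr_TenA[OF chom_join[of a b] id[of c]] and pr = pr_TenA[OF id[of a] chom_join[of b c]]
  have pr': "pr1 (T a) (T (b + c)) \<cdot> (\<iota> (Car (T a)) \<boxtimes> join b c) \<cdot> ?\<alpha> = pr1 (T a) (T b) \<cdot> pr1 (tens (T a) (T b)) (T c)"
    "pr2 (T a) (T (b + c)) \<cdot> (\<iota> (Car (T a)) \<boxtimes> join b c) \<cdot> ?\<alpha> = join b c \<cdot> pr2 (T a) (tens (T b) (T c)) \<cdot> ?\<alpha>"
    using Cmp_reassoc[OF pr(1), of ?\<alpha>] Cmp_reassoc[OF pr(2), of ?\<alpha>] by (simp_all add: pr_assoc)
  fix i assume i: "i < a + b + c"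
  \<comment> \<open>Rebracketing the dimension lets the coordinate rule for
    \<open>join a (b + c)\<close> match.\<close>
  have "proj (a + b + c) i \<cdot> ?R = proj (a + (b + c)) i \<cdot> ?R" by (simp add: add.assoc)
  also have "\<dots> = (if i < a then proj a i \<cdot> (pr1 (T a) (T b) \<cdot> pr1 (tens (T a) (T b)) (T c))
      else if i - a < b then proj b (i - a) \<cdot> (pr2 (T a) (T b) \<cdot> pr1 (tens (T a) (T b)) (T c))
      else proj c (i - a - b) \<cdot> pr2 (tens (T a) (T b)) (T c))"
    using i by (subst proj_join_Cmp) (auto simp: pr' proj_join_Cmp pr_assoc)
  also have "\<dots> = proj (a + b + c) i \<cdot> ?L"
    using i Cmp_reassoc[OF proj_join, of i a b "pr1 (tens (T a) (T b)) (T c)"]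
    by (subst proj_join_Cmp) (auto simp: pl proj_join_Cmp)
  finally show "proj (a + b + c) i \<cdot> ?L = proj (a + b + c) i \<cdot> ?R" ..
qed

text \<open>Since \<open>T 0\<close> is the unit comonoid itself, the functor can take an identity
  as its unit structure map, and this equation is then its left unit law.\<close>

lemma join_lunit: "join 0 n = lu (Car (T n))"
proof (rule T_ext)
  show "chom (tens triv (T n)) (T n) (join 0 n)" using chom_join[of 0 n] by simp
  show "chom (tens triv (T n)) (T n) (lu (Car (T n)))" using chom_pr2[of triv "T n"] by (simp add: lunit_eq_pr2)
  show "proj n i \<cdot> join 0 n = proj n i \<cdot> lu (Car (T n))" if "i < n" for i
    using proj_join[of i 0 n] that by (simp add: lunit_eq_pr2)
qed

lemma join_runit: "join n 0 = ru (Car (T n))"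
proof (rule T_ext)
  show "chom (tens (T n) triv) (T n) (join n 0)" using chom_join[of n 0] by simp
  show "chom (tens (T n) triv) (T n) (ru (Car (T n)))" using chom_pr1[of "T n" triv] by (simp add: runit_eq_pr1)
  show "proj n i \<cdot> join n 0 = proj n i \<cdot> ru (Car (T n))" if "i < n" for i
    using proj_join[of i n 0] that by (simp add: runit_eq_pr1)
qed

lemma join_symm: "mat_map (swap_mat a b) \<cdot> join a b = join b a \<cdot> \<sigma> (Car (T a)) (Car (T b))"
proof (rule T_ext)
  let ?X = "tens (T a) (T b)"
  show "chom ?X (T (b + a)) (mat_map (swap_mat a b) \<cdot> join a b)"
    using chom_Cmp[OF chom_join[of a b], of "T (b + a)"] chom_mat_map[of "swap_mat a b"] by simp
  show "chom ?X (T (b + a)) (join b a \<cdot> \<sigma> (Car (T a)) (Car (T b)))"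
    by (rule chom_Cmp[OF chom_symm chom_join]) simp_all
  fix i assume i: "i < b + a"
  have "proj (b + a) i \<cdot> mat_map (swap_mat a b) \<cdot> join a b =
      proj (a + b) (if i < b then a + i else i - b) \<cdot> join a b"
    unfolding swap_mat_eq_fun_mat by (rule proj_fun_mat_Cmp[OF chom_join i]) (use i in auto)
  also have "\<dots> = proj (b + a) i \<cdot> join b a \<cdot> \<sigma> (Car (T a)) (Car (T b))"
    using i by (auto simp: proj_join proj_join_Cmp pr_symm)
  finally show "proj (b + a) i \<cdot> mat_map (swap_mat a b) \<cdot> join a b =
      proj (b + a) i \<cdot> join b a \<cdot> \<sigma> (Car (T a)) (Car (T b))" .
qed

definition module_functor :: "(nat, 'r mat, 'o, 'm) monoidal_functor_data" where
  "module_functor = \<lparr>FunO = \<lambda>n. Car (T n), FunA = mat_map, Phi2 = join, Phi0 = \<iota> \<I>\<rparr>"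

lemma module_functor_simps [simp]:
  "FunO module_functor n = Car (T n)" "FunA module_functor = mat_map"
  "Phi2 module_functor = join" "Phi0 module_functor = \<iota> \<I>"
  by (simp_all add: module_functor_def)

lemma symmetric_monoidal_functor_module_functor:
  "symmetric_monoidal_functor (Mat TYPE('r)) C module_functor"
proof -
  interpret M: symmetric_monoidal_category "Mat TYPE('r)"
    by (rule symmetric_monoidal_category_Mat)
  show ?thesis
    by unfold_locales
      (auto simp: in_hom_def mat_map_one mat_map_mult join_iso join_nat join_lunit join_runit
        join_symm join_assoc add.assoc)
qed

end

section \<open>Symmetric monoidal functors preserve bimonoids\<close>

lemma bimonoid_homsD:
  fixes C (structure)
  assumes "f \<in> bimonoid_homs C A B"
  shows "f \<in> Arr C" "Dom C f = Ob A" "Cod C f = Ob B"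
    "Mul B \<cdot> (f \<boxtimes> f) = f \<cdot> Mul A" "f \<cdot> One A = One B"
    "Comul B \<cdot> f = (f \<boxtimes> f) \<cdot> Comul A" "Counit B \<cdot> f = Counit A"
  using assms by (auto simp: bimonoid_homs_def in_hom_def)

lemma monoidal_transformationD:
  fixes T (structure)
  assumes "monoidal_transformation S T F G \<theta>"
  shows "a \<in> Obj S \<Longrightarrow> \<theta> a \<in> Arr T" "a \<in> Obj S \<Longrightarrow> Dom T (\<theta> a) = FunO F a"
    "a \<in> Obj S \<Longrightarrow> Cod T (\<theta> a) = FunO G a"
    "f \<in> Arr S \<Longrightarrow> \<theta> (Cod S f) \<cdot> FunA F f = FunA G f \<cdot> \<theta> (Dom S f)"
    "\<lbrakk>a \<in> Obj S; b \<in> Obj S\<rbrakk> \<Longrightarrow> \<theta> (a \<boxdot>\<^bsub>S\<^esub> b) \<cdot> Phi2 F a b = Phi2 G a b \<cdot> (\<theta> a \<boxtimes> \<theta> b)"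
    "\<theta> \<I>\<^bsub>S\<^esub> \<cdot> Phi0 F = Phi0 G"
  using assms by (auto simp: monoidal_transformation_def natural_transformation_def in_hom_def)

text \<open>Operations into or out of a tensor power are corrected by the structure maps of
  \<open>F\<close>. The comonoid part uses their inverses, so the functor has to be strong.\<close>

definition image_bimonoid ::
  "('o2, 'm2, 'y) smc_data_scheme \<Rightarrow> ('o1, 'm1, 'o2, 'm2) monoidal_functor_data \<Rightarrow>
   ('o1, 'm1) bimonoid_data \<Rightarrow> ('o2, 'm2) bimonoid_data" where
  "image_bimonoid T F A =
     \<lparr>Ob = FunO F (Ob A),
      Mul = FunA F (Mul A) \<cdot>\<^bsub>T\<^esub> Phi2 F (Ob A) (Ob A),
      One = FunA F (One A) \<cdot>\<^bsub>T\<^esub> Phi0 F,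
      Comul = inv_arr T (Phi2 F (Ob A) (Ob A)) \<cdot>\<^bsub>T\<^esub> FunA F (Comul A),
      Counit = inv_arr T (Phi0 F) \<cdot>\<^bsub>T\<^esub> FunA F (Counit A)\<rparr>"

lemma image_bimonoid_simps [simp]:
  "Ob (image_bimonoid T F A) = FunO F (Ob A)"
  "Mul (image_bimonoid T F A) = FunA F (Mul A) \<cdot>\<^bsub>T\<^esub> Phi2 F (Ob A) (Ob A)"
  "One (image_bimonoid T F A) = FunA F (One A) \<cdot>\<^bsub>T\<^esub> Phi0 F"
  "Comul (image_bimonoid T F A) = inv_arr T (Phi2 F (Ob A) (Ob A)) \<cdot>\<^bsub>T\<^esub> FunA F (Comul A)"
  "Counit (image_bimonoid T F A) = inv_arr T (Phi0 F) \<cdot>\<^bsub>T\<^esub> FunA F (Counit A)"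
  by (simp_all add: image_bimonoid_def)

lemma (in bicommutative_bimonoid) bimonoid_simps [simp]:
  "Ob A \<in> Obj C"
  "Mul A \<in> Arr C" "Dom C (Mul A) = Ob A \<boxdot> Ob A" "Cod C (Mul A) = Ob A"
  "One A \<in> Arr C" "Dom C (One A) = \<I>" "Cod C (One A) = Ob A"
  "Comul A \<in> Arr C" "Dom C (Comul A) = Ob A" "Cod C (Comul A) = Ob A \<boxdot> Ob A"
  "Counit A \<in> Arr C" "Dom C (Counit A) = Ob A" "Cod C (Counit A) = \<I>"
  using monoid_Obj mul_hom one_hom comul_hom counit_hom by (auto simp: in_hom_def)

text \<open>Adds no assumption; it only makes the target the implicit structure, so that unindexed
  operations are those of \<open>T\<close>.\<close>

locale strong_functor = symmetric_monoidal_functor S T F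
  for S :: "('o1, 'm1, 'x) smc_data_scheme"
    and T :: "('o2, 'm2, 'y) smc_data_scheme" (structure)
    and F :: "('o1, 'm1, 'o2, 'm2) monoidal_functor_data"
begin

lemma FO_simps [simp]: "a \<in> Obj S \<Longrightarrow> FunO F a \<in> Obj T"
  by (rule FO_Obj)

lemma Phi_simps [simp]:
  "\<lbrakk>a \<in> Obj S; b \<in> Obj S\<rbrakk> \<Longrightarrow> Phi2 F a b \<in> Arr T"
  "\<lbrakk>a \<in> Obj S; b \<in> Obj S\<rbrakk> \<Longrightarrow> Dom T (Phi2 F a b) = FunO F a \<boxdot> FunO F b"
  "\<lbrakk>a \<in> Obj S; b \<in> Obj S\<rbrakk> \<Longrightarrow> Cod T (Phi2 F a b) = FunO F (a \<boxdot>\<^bsub>S\<^esub> b)"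
  "Phi0 F \<in> Arr T" "Dom T (Phi0 F) = \<I>" "Cod T (Phi0 F) = FunO F \<I>\<^bsub>S\<^esub>"
  using Phi2_hom[of a b] Phi0_hom by (auto simp: in_hom_def)

declare Phi2_iso [simp] Phi0_iso [simp] FA_Idn [simp]

lemma Phi2_natural':
  assumes "f \<in> Arr S" "g \<in> Arr S" "Cod S f = a" "Cod S g = b"
  shows "Phi2 F a b \<cdot> (FunA F f \<boxtimes> FunA F g) = FunA F (f \<boxtimes>\<^bsub>S\<^esub> g) \<cdot> Phi2 F (Dom S f) (Dom S g)"
  using Phi2_natural[of f _ a g _ b] assms by (auto simp: in_hom_def)

lemmas Phi2_nat = Phi2_natural' T.Cmp_reassoc[OF Phi2_natural']

lemma Phi2_natural_Idn:
  assumes "f \<in> Arr S" "a \<in> Obj S" "Cod S f = b"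
  shows "Phi2 F b a \<cdot> (FunA F f \<boxtimes> Idn T (FunO F a)) = FunA F (f \<boxtimes>\<^bsub>S\<^esub> Idn S a) \<cdot> Phi2 F (Dom S f) a"
    "Phi2 F a b \<cdot> (Idn T (FunO F a) \<boxtimes> FunA F f) = FunA F (Idn S a \<boxtimes>\<^bsub>S\<^esub> f) \<cdot> Phi2 F a (Dom S f)"
  using Phi2_nat(1)[of f "Idn S a" b a] Phi2_nat(1)[of "Idn S a" f a b] assms by simp_all

lemmas Phi2_nat_Idn = Phi2_natural_Idn(1) T.Cmp_reassoc[OF Phi2_natural_Idn(1)]
  Phi2_natural_Idn(2) T.Cmp_reassoc[OF Phi2_natural_Idn(2)]

text \<open>Collects images into the image of one composite, to which an axiom of the source
  category can be applied.\<close>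

lemmas FA_merge = FA_Cmp'[symmetric] T.Cmp_reassoc[OF FA_Cmp'[symmetric]]

lemma Phi_assoc_tail:
  assumes "a \<in> Obj S" "b \<in> Obj S" "c \<in> Obj S" "k \<in> Arr T"
    "Cod T k = (FunO F a \<boxdot> FunO F b) \<boxdot> FunO F c"
  shows "FunA F (assoc S a b c) \<cdot> Phi2 F (a \<boxdot>\<^bsub>S\<^esub> b) c \<cdot> (Phi2 F a b \<boxtimes> Idn T (FunO F c)) \<cdot> k =
    Phi2 F a (b \<boxdot>\<^bsub>S\<^esub> c) \<cdot> (Idn T (FunO F a) \<boxtimes> Phi2 F b c) \<cdot> assoc T (FunO F a) (FunO F b) (FunO F c) \<cdot> k"
  using arg_cong[OF Phi_assoc[OF assms(1-3)], of "\<lambda>x. x \<cdot> k"] assms by simp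

text \<open>Assembled from the associativity and symmetry coherence of \<open>F\<close>, in the same
  order in which \<open>shift\<close> is assembled.\<close>

lemma Phi_shift:
  assumes [simp]: "b \<in> Obj S" "c \<in> Obj S" "d \<in> Obj S"
  shows "FunA F (S.shift b c d) \<cdot> Phi2 F b (c \<boxdot>\<^bsub>S\<^esub> d) \<cdot> (Idn T (FunO F b) \<boxtimes> Phi2 F c d) =
    Phi2 F c (b \<boxdot>\<^bsub>S\<^esub> d) \<cdot> (Idn T (FunO F c) \<boxtimes> Phi2 F b d) \<cdot>
      T.shift (FunO F b) (FunO F c) (FunO F d)" (is "?L = ?R")
proof (rule T.iso_cancel_right)
  let ?b = "FunO F b" and ?c = "FunO F c" and ?d = "FunO F d"
  let ?\<alpha> = "assoc T ?b ?c ?d"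
  have "?L \<cdot> ?\<alpha> = FunA F (S.shift b c d) \<cdot> FunA F (assoc S b c d) \<cdot>
      Phi2 F (b \<boxdot>\<^bsub>S\<^esub> c) d \<cdot> (Phi2 F b c \<boxtimes> Idn T ?d)"
    by (simp add: Phi_assoc)
  also have "\<dots> = FunA F (assoc S c b d) \<cdot> FunA F (symm S b c \<boxtimes>\<^bsub>S\<^esub> Idn S d) \<cdot>
      Phi2 F (b \<boxdot>\<^bsub>S\<^esub> c) d \<cdot> (Phi2 F b c \<boxtimes> Idn T ?d)"
    by (simp add: FA_merge S.shift_assoc)
  also have "\<dots> = FunA F (assoc S c b d) \<cdot> Phi2 F (c \<boxdot>\<^bsub>S\<^esub> b) d \<cdot>
      ((FunA F (symm S b c) \<cdot> Phi2 F b c) \<boxtimes> Idn T ?d)"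
    using Phi2_nat_Idn(2)[of "symm S b c" d "c \<boxdot>\<^bsub>S\<^esub> b" "Phi2 F b c \<boxtimes> Idn T ?d"]
    by (simp add: T.TenA_merge)
  also have "\<dots> = FunA F (assoc S c b d) \<cdot> Phi2 F (c \<boxdot>\<^bsub>S\<^esub> b) d \<cdot>
      (Phi2 F c b \<boxtimes> Idn T ?d) \<cdot> (symm T ?b ?c \<boxtimes> Idn T ?d)"
    by (simp add: Phi_symm T.TenA_merge)
  also have "\<dots> = ?R \<cdot> ?\<alpha>"
    by (simp add: Phi_assoc_tail T.shift_assoc)
  finally show "?L \<cdot> ?\<alpha> = ?R \<cdot> ?\<alpha>" .
qed simp_all

text \<open>Needed for the one bimonoid axiom that contains an interchange. Composing with the image
  of an associator removes the inverse in \<open>mid\<close> and leaves a whiskered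
  \<open>Phi_shift\<close>.\<close>

lemma Phi_mid:
  assumes [simp]: "a \<in> Obj S" "b \<in> Obj S" "c \<in> Obj S" "d \<in> Obj S"
  shows "FunA F (S.mid a b c d) \<cdot> Phi2 F (a \<boxdot>\<^bsub>S\<^esub> b) (c \<boxdot>\<^bsub>S\<^esub> d) \<cdot> (Phi2 F a b \<boxtimes> Phi2 F c d) =
    Phi2 F (a \<boxdot>\<^bsub>S\<^esub> c) (b \<boxdot>\<^bsub>S\<^esub> d) \<cdot> (Phi2 F a c \<boxtimes> Phi2 F b d) \<cdot>
      T.mid (FunO F a) (FunO F b) (FunO F c) (FunO F d)" (is "?L = ?R")
proof (rule T.iso_cancel_left)
  let ?a = "FunO F a" and ?b = "FunO F b" and ?c = "FunO F c" and ?d = "FunO F d"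
  let ?f = "FunA F (assoc S a c (b \<boxdot>\<^bsub>S\<^esub> d))"
  \<comment> \<open>Associativity coherence moves one structure map at a time, so the pair is split
    into two consecutive steps.\<close>
  have 1: "Phi2 F x y \<boxtimes> Phi2 F z w = (Phi2 F x y \<boxtimes> Idn T (FunO F (z \<boxdot>\<^bsub>S\<^esub> w))) \<cdot>
      (Idn T (FunO F x \<boxdot> FunO F y) \<boxtimes> Phi2 F z w)"
    if "x \<in> Obj S" "y \<in> Obj S" "z \<in> Obj S" "w \<in> Obj S" for x y z w
    using that by (simp add: T.TenA_merge)
  have "?f \<cdot> ?L = FunA F (Idn S a \<boxtimes>\<^bsub>S\<^esub> S.shift b c d) \<cdot> FunA F (assoc S a b (c \<boxdot>\<^bsub>S\<^esub> d)) \<cdot>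
      Phi2 F (a \<boxdot>\<^bsub>S\<^esub> b) (c \<boxdot>\<^bsub>S\<^esub> d) \<cdot> (Phi2 F a b \<boxtimes> Phi2 F c d)"
    by (simp add: FA_merge S.assoc_mid)
  also have "\<dots> = FunA F (Idn S a \<boxtimes>\<^bsub>S\<^esub> S.shift b c d) \<cdot> Phi2 F a (b \<boxdot>\<^bsub>S\<^esub> (c \<boxdot>\<^bsub>S\<^esub> d)) \<cdot>
      (Idn T ?a \<boxtimes> Phi2 F b (c \<boxdot>\<^bsub>S\<^esub> d)) \<cdot>
      (Idn T ?a \<boxtimes> (Idn T ?b \<boxtimes> Phi2 F c d)) \<cdot> assoc T ?a ?b (?c \<boxdot> ?d)"
    by (simp add: 1 Phi_assoc_tail T.assoc_nat_Idn_left del: T.TenA_Idn)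
  also have "\<dots> = Phi2 F a (c \<boxdot>\<^bsub>S\<^esub> (b \<boxdot>\<^bsub>S\<^esub> d)) \<cdot> (Idn T ?a \<boxtimes> FunA F (S.shift b c d)) \<cdot>
      (Idn T ?a \<boxtimes> Phi2 F b (c \<boxdot>\<^bsub>S\<^esub> d)) \<cdot> (Idn T ?a \<boxtimes> (Idn T ?b \<boxtimes> Phi2 F c d)) \<cdot>
      assoc T ?a ?b (?c \<boxdot> ?d)"
    by (simp add: Phi2_nat_Idn)
  also have "\<dots> = Phi2 F a (c \<boxdot>\<^bsub>S\<^esub> (b \<boxdot>\<^bsub>S\<^esub> d)) \<cdot> (Idn T ?a \<boxtimes> (FunA F (S.shift b c d) \<cdot>
      Phi2 F b (c \<boxdot>\<^bsub>S\<^esub> d) \<cdot> (Idn T ?b \<boxtimes> Phi2 F c d))) \<cdot> assoc T ?a ?b (?c \<boxdot> ?d)"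
    by (simp add: T.TenA_merge)
  also have "\<dots> = Phi2 F a (c \<boxdot>\<^bsub>S\<^esub> (b \<boxdot>\<^bsub>S\<^esub> d)) \<cdot> (Idn T ?a \<boxtimes> Phi2 F c (b \<boxdot>\<^bsub>S\<^esub> d)) \<cdot>
      (Idn T ?a \<boxtimes> (Idn T ?c \<boxtimes> Phi2 F b d)) \<cdot>
      (Idn T ?a \<boxtimes> T.shift ?b ?c ?d) \<cdot> assoc T ?a ?b (?c \<boxdot> ?d)"
    by (simp add: Phi_shift T.TenA_merge)
  also have "\<dots> = ?f \<cdot> ?R"
    by (simp add: 1 Phi_assoc_tail T.assoc_nat_Idn_left T.assoc_mid del: T.TenA_Idn)
  finally show "?f \<cdot> ?L = ?f \<cdot> ?R" .
qed (simp_all add: FA_inv_arr)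

lemma Phi0_lunit:
  "FunA F (lunit S \<I>\<^bsub>S\<^esub>) \<cdot> Phi2 F \<I>\<^bsub>S\<^esub> \<I>\<^bsub>S\<^esub> \<cdot> (Phi0 F \<boxtimes> Phi0 F) = Phi0 F \<cdot> lunit T \<I>"
proof -
  have "Phi0 F \<boxtimes> Phi0 F = (Phi0 F \<boxtimes> Idn T (FunO F \<I>\<^bsub>S\<^esub>)) \<cdot> (Idn T \<I> \<boxtimes> Phi0 F)"
    by (simp add: T.TenA_merge)
  then have "FunA F (lunit S \<I>\<^bsub>S\<^esub>) \<cdot> Phi2 F \<I>\<^bsub>S\<^esub> \<I>\<^bsub>S\<^esub> \<cdot> (Phi0 F \<boxtimes> Phi0 F) =
      (FunA F (lunit S \<I>\<^bsub>S\<^esub>) \<cdot> Phi2 F \<I>\<^bsub>S\<^esub> \<I>\<^bsub>S\<^esub> \<cdot> (Phi0 F \<boxtimes> Idn T (FunO F \<I>\<^bsub>S\<^esub>))) \<cdot>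
        (Idn T \<I> \<boxtimes> Phi0 F)"
    by simp
  also have "\<dots> = lunit T (FunO F \<I>\<^bsub>S\<^esub>) \<cdot> (Idn T \<I> \<boxtimes> Phi0 F)"
    by (simp only: Phi_lunit S.unit_Obj)
  also have "\<dots> = Phi0 F \<cdot> lunit T \<I>"
    by (simp add: T.lunit_nat)
  finally show ?thesis .
qed

lemma Phi_lunit_tail:
  assumes "a \<in> Obj S" "k \<in> Arr T" "Cod T k = \<I> \<boxdot> FunO F a"
  shows "FunA F (lunit S a) \<cdot> Phi2 F \<I>\<^bsub>S\<^esub> a \<cdot> (Phi0 F \<boxtimes> Idn T (FunO F a)) \<cdot> k =
    lunit T (FunO F a) \<cdot> k"
  using arg_cong[OF Phi_lunit[OF assms(1)], of "\<lambda>x. x \<cdot> k"] assms by simp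

text \<open>The comonoid laws contain inverse structure maps. Composing with the structure maps
  themselves turns coassociativity and cocommutativity into the images of the corresponding laws of
  \<open>A\<close>; for the counit law, coherence of \<open>F\<close> rewrites the unitor.\<close>

lemma image_cocomm:
  assumes "bicommutative_bimonoid S A"
  shows "cocommutative_comonoid_in T (Ob (image_bimonoid T F A))
    (Comul (image_bimonoid T F A)) (Counit (image_bimonoid T F A))"
proof -
  interpret A: bicommutative_bimonoid S A by fact
  let ?A = "FunO F (Ob A)" and ?P = "Phi2 F (Ob A) (Ob A)"
  let ?D = "FunA F (Comul A)" and ?E = "FunA F (Counit A)"
  let ?d = "inv_arr T ?P \<cdot> ?D" and ?e = "inv_arr T (Phi0 F) \<cdot> ?E"
  have "T.cocomm \<lparr>Car = ?A, Dup = ?d, Del = ?e\<rparr>"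
  proof (rule T.cocommI)
    let ?AA = "Ob A \<boxdot>\<^bsub>S\<^esub> Ob A"
    \<comment> \<open>The prefix is the invertible comparison from the right-nested threefold power;
      it is cancelled once both sides are images under \<open>F\<close>.\<close>
    have "Phi2 F (Ob A) ?AA \<cdot> (Idn T ?A \<boxtimes> ?P) \<cdot>
        assoc T ?A ?A ?A \<cdot> (?d \<boxtimes> Idn T ?A) \<cdot> ?d =
        FunA F (assoc S (Ob A) (Ob A) (Ob A)) \<cdot> Phi2 F ?AA (Ob A) \<cdot>
        (?D \<boxtimes> Idn T ?A) \<cdot> ?d"
      by (simp add: Phi_assoc_tail[symmetric] T.TenA_merge)
    also have "\<dots> = FunA F (assoc S (Ob A) (Ob A) (Ob A) \<cdot>\<^bsub>S\<^esub> (Comul A \<boxtimes>\<^bsub>S\<^esub> Idn S (Ob A)) \<cdot>\<^bsub>S\<^esub> Comul A)"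
      by (simp add: Phi2_nat_Idn FA_merge)
    also have "\<dots> = FunA F ((Idn S (Ob A) \<boxtimes>\<^bsub>S\<^esub> Comul A) \<cdot>\<^bsub>S\<^esub> Comul A)"
      using A.comul_coassoc by simp
    also have "\<dots> = Phi2 F (Ob A) ?AA \<cdot> (Idn T ?A \<boxtimes> ?D) \<cdot> ?d"
      by (simp add: Phi2_nat_Idn FA_merge)
    also have "\<dots> = Phi2 F (Ob A) ?AA \<cdot> (Idn T ?A \<boxtimes> ?P) \<cdot> (Idn T ?A \<boxtimes> ?d) \<cdot> ?d"
      by (simp add: T.TenA_merge)
    finally have "(Phi2 F (Ob A) ?AA \<cdot> (Idn T ?A \<boxtimes> ?P)) \<cdot>
        assoc T ?A ?A ?A \<cdot> (?d \<boxtimes> Idn T ?A) \<cdot> ?d =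
        (Phi2 F (Ob A) ?AA \<cdot> (Idn T ?A \<boxtimes> ?P)) \<cdot> (Idn T ?A \<boxtimes> ?d) \<cdot> ?d"
      by simp
    then show "assoc T ?A ?A ?A \<cdot> (?d \<boxtimes> Idn T ?A) \<cdot> ?d = (Idn T ?A \<boxtimes> ?d) \<cdot> ?d"
      by (rule T.iso_cancel_left) (simp_all add: T.is_iso_Cmp)
    have "lunit T ?A \<cdot> (?e \<boxtimes> Idn T ?A) \<cdot> ?d =
        FunA F (lunit S (Ob A)) \<cdot> Phi2 F \<I>\<^bsub>S\<^esub> (Ob A) \<cdot> (?E \<boxtimes> Idn T ?A) \<cdot> ?d"
      by (simp add: Phi_lunit_tail[symmetric] T.TenA_merge)
    also have "\<dots> = FunA F (lunit S (Ob A) \<cdot>\<^bsub>S\<^esub> (Counit A \<boxtimes>\<^bsub>S\<^esub> Idn S (Ob A)) \<cdot>\<^bsub>S\<^esub> Comul A)"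
      by (simp add: Phi2_nat_Idn FA_merge)
    also have "\<dots> = Idn T ?A" by (simp add: A.comul_lcounit)
    finally show "lunit T ?A \<cdot> (?e \<boxtimes> Idn T ?A) \<cdot> ?d = Idn T ?A" .
    show "symm T ?A ?A \<cdot> ?d = ?d"
    proof (rule T.iso_cancel_left)
      have "?P \<cdot> symm T ?A ?A \<cdot> ?d = (FunA F (symm S (Ob A) (Ob A)) \<cdot> ?P) \<cdot> ?d"
        by (subst Phi_symm) simp_all
      also have "\<dots> = ?P \<cdot> ?d" by (simp add: FA_merge A.comul_cocomm)
      finally show "?P \<cdot> symm T ?A ?A \<cdot> ?d = ?P \<cdot> ?d" .
    qed simp_all
  qed simp_all
  then show ?thesis by (simp add: T.cocomm_def)
qed

lemma image_comm:
  assumes "bicommutative_bimonoid S A"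
  shows "commutative_monoid_in T (Ob (image_bimonoid T F A))
    (Mul (image_bimonoid T F A)) (One (image_bimonoid T F A))"
proof -
  interpret A: bicommutative_bimonoid S A by fact
  let ?a = "Ob A" and ?A = "FunO F (Ob A)" and ?P = "Phi2 F (Ob A) (Ob A)"
  let ?M = "FunA F (Mul A)" and ?N = "FunA F (One A)"
  let ?m = "?M \<cdot> ?P" and ?n = "?N \<cdot> Phi0 F"
  have assoc: "?m \<cdot> (?m \<boxtimes> Idn T ?A) = ?m \<cdot> (Idn T ?A \<boxtimes> ?m) \<cdot> assoc T ?A ?A ?A"
  proof -
    have "?m \<cdot> (?m \<boxtimes> Idn T ?A) =
        ?M \<cdot> ?P \<cdot> (?M \<boxtimes> Idn T ?A) \<cdot> (?P \<boxtimes> Idn T ?A)"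
      by (simp add: T.TenA_merge)
    also have "\<dots> = FunA F (Mul A \<cdot>\<^bsub>S\<^esub> (Mul A \<boxtimes>\<^bsub>S\<^esub> Idn S ?a)) \<cdot>
        Phi2 F (?a \<boxdot>\<^bsub>S\<^esub> ?a) ?a \<cdot> (?P \<boxtimes> Idn T ?A)"
      by (simp add: Phi2_nat_Idn FA_merge)
    also have "\<dots> = ?M \<cdot> FunA F (Idn S ?a \<boxtimes>\<^bsub>S\<^esub> Mul A) \<cdot> FunA F (assoc S ?a ?a ?a) \<cdot>
        Phi2 F (?a \<boxdot>\<^bsub>S\<^esub> ?a) ?a \<cdot> (?P \<boxtimes> Idn T ?A)"
      by (simp add: FA_merge A.mul_assoc)
    also have "\<dots> = ?M \<cdot> ?P \<cdot> (Idn T ?A \<boxtimes> ?M) \<cdot>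
        (Idn T ?A \<boxtimes> ?P) \<cdot> assoc T ?A ?A ?A"
      by (simp add: Phi_assoc Phi2_nat_Idn)
    also have "\<dots> = ?m \<cdot> (Idn T ?A \<boxtimes> ?m) \<cdot> assoc T ?A ?A ?A"
      by (simp add: T.TenA_merge)
    finally show ?thesis .
  qed
  have lunit: "?m \<cdot> (?n \<boxtimes> Idn T ?A) = lunit T ?A"
  proof -
    have "?m \<cdot> (?n \<boxtimes> Idn T ?A) =
        ?M \<cdot> ?P \<cdot> (?N \<boxtimes> Idn T ?A) \<cdot> (Phi0 F \<boxtimes> Idn T ?A)"
      by (simp add: T.TenA_merge)
    also have "\<dots> = lunit T ?A"
      by (simp add: Phi2_nat_Idn FA_merge A.mul_lunit Phi_lunit)
    finally show ?thesis .
  qed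
  have runit: "?m \<cdot> (Idn T ?A \<boxtimes> ?n) = runit T ?A"
  proof -
    have "?m \<cdot> (Idn T ?A \<boxtimes> ?n) =
        ?M \<cdot> ?P \<cdot> (Idn T ?A \<boxtimes> ?N) \<cdot> (Idn T ?A \<boxtimes> Phi0 F)"
      by (simp add: T.TenA_merge)
    also have "\<dots> = runit T ?A"
      by (simp add: Phi2_nat_Idn FA_merge A.mul_runit Phi_runit)
    finally show ?thesis .
  qed
  have comm: "?m \<cdot> symm T ?A ?A = ?m"
    by (simp add: Phi_symm[symmetric] FA_merge A.mul_comm)
  show ?thesis
    using assoc lunit runit comm by unfold_locales (simp_all add: in_hom_def)
qed

text \<open>After cancelling an isomorphism, the multiplication-comultiplication law reduces to
  \<open>Phi_mid\<close>, and the two laws with a unitor reduce to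
  \<open>Phi0_lunit\<close>.\<close>

lemma image_bicommutative_bimonoid:
  assumes "bicommutative_bimonoid S A"
  shows "bicommutative_bimonoid T (image_bimonoid T F A)"
proof -
  interpret A: bicommutative_bimonoid S A by fact
  interpret M: commutative_monoid_in T "Ob (image_bimonoid T F A)" "Mul (image_bimonoid T F A)"
    "One (image_bimonoid T F A)" by (rule image_comm[OF assms])
  interpret N: cocommutative_comonoid_in T "Ob (image_bimonoid T F A)" "Comul (image_bimonoid T F A)"
    "Counit (image_bimonoid T F A)" by (rule image_cocomm[OF assms])
  let ?a = "Ob A" and ?A = "FunO F (Ob A)" and ?P = "Phi2 F (Ob A) (Ob A)"
  let ?aa = "?a \<boxdot>\<^bsub>S\<^esub> ?a"
  let ?M = "FunA F (Mul A)" and ?N = "FunA F (One A)" and ?D = "FunA F (Comul A)" and ?E = "FunA F (Counit A)"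
  let ?m = "?M \<cdot> ?P" and ?n = "?N \<cdot> Phi0 F"
  let ?d = "inv_arr T ?P \<cdot> ?D" and ?e = "inv_arr T (Phi0 F) \<cdot> ?E"
  have 1: "?d \<cdot> ?m = (?m \<boxtimes> ?m) \<cdot> T.mid ?A ?A ?A ?A \<cdot> (?d \<boxtimes> ?d)"
  proof (rule T.iso_cancel_left)
    have "?P \<cdot> ?d \<cdot> ?m = FunA F (Comul A \<cdot>\<^bsub>S\<^esub> Mul A) \<cdot> ?P"
      by (simp add: FA_merge)
    also have "Comul A \<cdot>\<^bsub>S\<^esub> Mul A = (Mul A \<boxtimes>\<^bsub>S\<^esub> Mul A) \<cdot>\<^bsub>S\<^esub> S.mid ?a ?a ?a ?a \<cdot>\<^bsub>S\<^esub> (Comul A \<boxtimes>\<^bsub>S\<^esub> Comul A)"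
      by (simp add: A.Comul_Mul S.middle_swap_eq_mid)
    also have "FunA F \<dots> \<cdot> ?P = FunA F (Mul A \<boxtimes>\<^bsub>S\<^esub> Mul A) \<cdot> FunA F (S.mid ?a ?a ?a ?a) \<cdot>
        Phi2 F ?aa ?aa \<cdot> (?D \<boxtimes> ?D)"
      by (simp add: Phi2_nat FA_merge)
    also have "\<dots> = FunA F (Mul A \<boxtimes>\<^bsub>S\<^esub> Mul A) \<cdot> (FunA F (S.mid ?a ?a ?a ?a) \<cdot>
        Phi2 F ?aa ?aa \<cdot> (?P \<boxtimes> ?P)) \<cdot> (?d \<boxtimes> ?d)"
      by (simp add: T.TenA_merge)
    also have "\<dots> = FunA F (Mul A \<boxtimes>\<^bsub>S\<^esub> Mul A) \<cdot> Phi2 F ?aa ?aa \<cdot> (?P \<boxtimes> ?P) \<cdot>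
        T.mid ?A ?A ?A ?A \<cdot> (?d \<boxtimes> ?d)"
      by (subst Phi_mid) simp_all
    also have "\<dots> = ?P \<cdot> (?M \<boxtimes> ?M) \<cdot> (?P \<boxtimes> ?P) \<cdot>
        T.mid ?A ?A ?A ?A \<cdot> (?d \<boxtimes> ?d)"
      by (simp add: Phi2_nat)
    also have "\<dots> = ?P \<cdot> (?m \<boxtimes> ?m) \<cdot> T.mid ?A ?A ?A ?A \<cdot> (?d \<boxtimes> ?d)"
      by (simp add: T.TenA_merge(2))
    finally show "?P \<cdot> ?d \<cdot> ?m = ?P \<cdot> (?m \<boxtimes> ?m) \<cdot> T.mid ?A ?A ?A ?A \<cdot> (?d \<boxtimes> ?d)" .
  qed simp_all
  let ?II = "Phi2 F \<I>\<^bsub>S\<^esub> \<I>\<^bsub>S\<^esub>" and ?l = "lunit S \<I>\<^bsub>S\<^esub>" and ?l' = "lunit T \<I>"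
  have 2: "?d \<cdot> ?n = (?n \<boxtimes> ?n) \<cdot> inv_arr T ?l'"
  proof (rule T.iso_cancel_right)
    have "(?d \<cdot> ?n) \<cdot> ?l' = inv_arr T ?P \<cdot> FunA F (Comul A \<cdot>\<^bsub>S\<^esub> One A) \<cdot> Phi0 F \<cdot> ?l'"
      by (simp add: FA_merge)
    also have "\<dots> = inv_arr T ?P \<cdot> FunA F (One A \<boxtimes>\<^bsub>S\<^esub> One A) \<cdot> ?II \<cdot> (Phi0 F \<boxtimes> Phi0 F)"
      by (simp add: Phi0_lunit[symmetric] A.Comul_One FA_merge)
    also have "\<dots> = (?N \<boxtimes> ?N) \<cdot> (Phi0 F \<boxtimes> Phi0 F)"
      using T.Cmp_reassoc[OF Phi2_natural'[of "One A" "One A" ?a ?a], of "Phi0 F \<boxtimes> Phi0 F", symmetric] by simp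
    also have "\<dots> = ((?n \<boxtimes> ?n) \<cdot> inv_arr T ?l') \<cdot> ?l'"
      by (simp add: T.TenA_merge)
    finally show "(?d \<cdot> ?n) \<cdot> ?l' = ((?n \<boxtimes> ?n) \<cdot> inv_arr T ?l') \<cdot> ?l'" .
  qed simp_all
  have 3: "?e \<cdot> ?m = ?l' \<cdot> (?e \<boxtimes> ?e)"
  proof (rule T.iso_cancel_left)
    have "Phi0 F \<cdot> ?l' \<cdot> (?e \<boxtimes> ?e) =
        (FunA F ?l \<cdot> ?II \<cdot> (Phi0 F \<boxtimes> Phi0 F)) \<cdot> (?e \<boxtimes> ?e)"
      by (subst Phi0_lunit) simp
    also have "\<dots> = FunA F ?l \<cdot> ?II \<cdot> (?E \<boxtimes> ?E)"
      by (simp add: T.TenA_merge)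
    also have "\<dots> = FunA F (Counit A \<cdot>\<^bsub>S\<^esub> Mul A) \<cdot> ?P"
      by (simp add: Phi2_nat FA_merge A.Counit_Mul)
    also have "\<dots> = Phi0 F \<cdot> ?e \<cdot> ?m"
      by (simp add: FA_merge)
    finally show "Phi0 F \<cdot> ?e \<cdot> ?m = Phi0 F \<cdot> ?l' \<cdot> (?e \<boxtimes> ?e)" ..
  qed simp_all
  have 4: "?e \<cdot> ?n = Idn T \<I>"
    by (simp add: FA_merge A.Counit_One)
  show ?thesis
    using 1 2 3 4 by unfold_locales (simp_all add: T.middle_swap_eq_mid)
qed

lemma image_bimonoid_homs:
  assumes "bicommutative_bimonoid S A" "bicommutative_bimonoid S B" and f: "f \<in> bimonoid_homs S A B"
  shows "FunA F f \<in> bimonoid_homs T (image_bimonoid T F A) (image_bimonoid T F B)"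
proof -
  interpret A: bicommutative_bimonoid S A by fact
  interpret B: bicommutative_bimonoid S B by fact
  note [simp] = bimonoid_homsD(1-3)[OF f] and laws = bimonoid_homsD(4-7)[OF f]
  have "(inv_arr T (Phi2 F (Ob B) (Ob B)) \<cdot> FunA F (Comul B)) \<cdot> FunA F f =
      (FunA F f \<boxtimes> FunA F f) \<cdot> inv_arr T (Phi2 F (Ob A) (Ob A)) \<cdot> FunA F (Comul A)"
    by (rule T.iso_cancel_left[where f = "Phi2 F (Ob B) (Ob B)"]) (simp_all add: FA_merge Phi2_nat laws)
  then show ?thesis
    by (simp add: bimonoid_homs_def in_hom_def FA_merge Phi2_nat laws)
qed

lemma image_rig_hom:
  assumes A: "bicommutative_bimonoid S A" and \<phi>: "\<phi> \<in> rig_hom (End S A)"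
  shows "(\<lambda>r. FunA F (\<phi> r)) \<in> rig_hom (End T (image_bimonoid T F A))"
proof -
  interpret A: bicommutative_bimonoid S A by fact
  have \<phi>_hom: "\<phi> r \<in> bimonoid_homs S A A" for r
    using \<phi> by (simp add: rig_hom_def End_def)
  then have [simp]: "\<phi> r \<in> Arr S" "Dom S (\<phi> r) = Ob A" "Cod S (\<phi> r) = Ob A" for r
    by (auto simp: bimonoid_homs_def in_hom_def)
  have laws: "\<phi> 0 = One A \<cdot>\<^bsub>S\<^esub> Counit A" "\<phi> 1 = Idn S (Ob A)"
    "\<And>r s. \<phi> (r + s) = Mul A \<cdot>\<^bsub>S\<^esub> (\<phi> r \<boxtimes>\<^bsub>S\<^esub> \<phi> s) \<cdot>\<^bsub>S\<^esub> Comul A" "\<And>r s. \<phi> (r * s) = \<phi> r \<cdot>\<^bsub>S\<^esub> \<phi> s"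
    using \<phi> by (auto simp: rig_hom_def End_def)
  show ?thesis
    using image_bimonoid_homs[OF A A \<phi>_hom]
    by (auto simp: rig_hom_def End_def laws FA_merge[symmetric] Phi2_nat)
qed

end

text \<open>Naturality at each operation of \<open>A\<close> combined with compatibility with the
  structure maps. For the comonoid half these maps occur inverted, so they are cancelled on the left
  first.\<close>

lemma monoidal_transformation_bimonoid_homs:
  fixes T (structure)
  assumes F: "symmetric_monoidal_functor S T F" and G: "symmetric_monoidal_functor S T G"
    and \<theta>: "monoidal_transformation S T F G \<theta>" and A: "bicommutative_bimonoid S A"
  shows "\<theta> (Ob A) \<in> bimonoid_homs T (image_bimonoid T F A) (image_bimonoid T G A)"
proof -
  interpret F: strong_functor S T F by (rule strong_functor.intro) fact
  interpret G: strong_functor S T G by (rule strong_functor.intro) fact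
  interpret A: bicommutative_bimonoid S A by fact
  note [simp] = monoidal_transformationD(1-3)[OF \<theta>]
  note nat = monoidal_transformationD(4)[OF \<theta>] and mon = monoidal_transformationD(5)[OF \<theta>]
    and unit = monoidal_transformationD(6)[OF \<theta>]
  let ?a = "Ob A" and ?PF = "Phi2 F (Ob A) (Ob A)" and ?PG = "Phi2 G (Ob A) (Ob A)"
  have mul: "(FunA G (Mul A) \<cdot> ?PG) \<cdot> (\<theta> ?a \<boxtimes> \<theta> ?a) = \<theta> ?a \<cdot> FunA F (Mul A) \<cdot> ?PF"
    using mon[of ?a ?a] F.T.Cmp_reassoc[OF nat, of "Mul A" ?PF] by simp
  have one: "\<theta> ?a \<cdot> FunA F (One A) \<cdot> Phi0 F = FunA G (One A) \<cdot> Phi0 G"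
    using unit F.T.Cmp_reassoc[OF nat, of "One A" "Phi0 F"] by simp
  have comul: "(inv_arr T ?PG \<cdot> FunA G (Comul A)) \<cdot> \<theta> ?a =
      (\<theta> ?a \<boxtimes> \<theta> ?a) \<cdot> inv_arr T ?PF \<cdot> FunA F (Comul A)"
  proof (rule F.T.iso_cancel_left[where f = ?PG])
    have "?PG \<cdot> (\<theta> ?a \<boxtimes> \<theta> ?a) \<cdot> inv_arr T ?PF \<cdot> FunA F (Comul A) =
        \<theta> (?a \<boxdot>\<^bsub>S\<^esub> ?a) \<cdot> FunA F (Comul A)"
      using F.T.Cmp_reassoc[OF mon[of ?a ?a, symmetric], of "inv_arr T ?PF \<cdot> FunA F (Comul A)"] by simp
    then show "?PG \<cdot> (inv_arr T ?PG \<cdot> FunA G (Comul A)) \<cdot> \<theta> ?a =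
        ?PG \<cdot> (\<theta> ?a \<boxtimes> \<theta> ?a) \<cdot> inv_arr T ?PF \<cdot> FunA F (Comul A)"
      using nat[of "Comul A"] by simp
  qed simp_all
  have counit: "(inv_arr T (Phi0 G) \<cdot> FunA G (Counit A)) \<cdot> \<theta> ?a = inv_arr T (Phi0 F) \<cdot> FunA F (Counit A)"
  proof (rule F.T.iso_cancel_left[where f = "Phi0 G"])
    have "Phi0 G \<cdot> inv_arr T (Phi0 F) \<cdot> FunA F (Counit A) = \<theta> \<I>\<^bsub>S\<^esub> \<cdot> FunA F (Counit A)"
      unfolding unit[symmetric] by simp
    then show "Phi0 G \<cdot> (inv_arr T (Phi0 G) \<cdot> FunA G (Counit A)) \<cdot> \<theta> ?a =
        Phi0 G \<cdot> inv_arr T (Phi0 F) \<cdot> FunA F (Counit A)"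
      using nat[of "Counit A"] by simp
  qed simp_all
  show ?thesis
    using mul one comul counit by (simp add: bimonoid_homs_def in_hom_def)
qed

section \<open>The generic bimonoid\<close>

definition generic_bimonoid :: "(nat, 'r::comm_rig mat) bimonoid_data" where
  "generic_bimonoid = \<lparr>Ob = 1, Mul = mul_mat, One = unit_mat, Comul = comul_mat, Counit = counit_mat\<rparr>"

lemma generic_bimonoid_simps [simp]:
  "Ob generic_bimonoid = 1" "Mul generic_bimonoid = mul_mat" "One generic_bimonoid = unit_mat"
  "Comul generic_bimonoid = comul_mat" "Counit generic_bimonoid = counit_mat"
  by (simp_all add: generic_bimonoid_def)

lemmas generator_defs = mul_mat_def unit_mat_def comul_mat_def counit_mat_def scalar_mat_def

lemma comul_mat_eq_fun_mat: "comul_mat = fun_mat 2 1 (\<lambda>_. 0)"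
  by (rule eq_matI) (auto simp: comul_mat_def index_fun_mat)

text \<open>Products with fixed small matrices in entrywise form. The dimension guards leave sums of
  at most two terms, so the bimonoid axioms become finite comparisons of entries.\<close>

lemma generator_mult:
  fixes Q :: "'r::comm_rig mat"
  shows "dim_row Q = 2 \<Longrightarrow> mul_mat * Q = mat 1 (dim_col Q) (\<lambda>(i, j). Q $$ (0, j) + Q $$ (1, j))"
    "dim_row Q = 1 \<Longrightarrow> comul_mat * Q = mat 2 (dim_col Q) (\<lambda>(i, j). Q $$ (0, j))"
    "dim_row Q = 1 \<Longrightarrow> scalar_mat r * Q = mat 1 (dim_col Q) (\<lambda>(i, j). r * Q $$ (0, j))"
    "dim_row Q = 2 \<Longrightarrow> dsum (scalar_mat r) (scalar_mat s) * Q =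
      mat 2 (dim_col Q) (\<lambda>(i, j). if i = 0 then r * Q $$ (0, j) else s * Q $$ (1, j))"
    "dim_row Q = 4 \<Longrightarrow> dsum mul_mat mul_mat * Q =
      mat 2 (dim_col Q) (\<lambda>(i, j). if i = 0 then Q $$ (0, j) + Q $$ (1, j) else Q $$ (2, j) + Q $$ (3, j))"
proof -
  show "dim_row Q = 1 \<Longrightarrow> comul_mat * Q = mat 2 (dim_col Q) (\<lambda>(i, j). Q $$ (0, j))"
    unfolding comul_mat_eq_fun_mat by (subst fun_mat_mult) auto
qed (rule eq_matI; auto simp: mul_mat_def scalar_mat_def scalar_prod_def index_dsum eval_nat_numeral)+

text \<open>Both sides are the 2 by 2 matrix with all entries 1: on the right, the selection after
  duplicating has rows 0, 1, 0, 1, and each pair is added.\<close>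

lemma comul_mat_mul_mat:
  "comul_mat * mul_mat = (dsum mul_mat mul_mat *
    (dsum (1\<^sub>m 1) (dsum (swap_mat 1 1) (1\<^sub>m 1)) * dsum comul_mat comul_mat) :: 'r::comm_rig mat)"
proof -
  \<comment> \<open>The interchange on four wires is the transposition of the indices 1 and
    2.\<close>
  have 1: "dsum (1\<^sub>m 1) (dsum (swap_mat 1 1) (1\<^sub>m 1)) =
      (fun_mat 4 4 (\<lambda>i. if i = 1 then 2 else if i = 2 then 1 else i) :: 'r mat)"
    by (rule eq_matI)
      (auto simp: index_dsum swap_mat_eq_fun_mat index_fun_mat one_eq_fun_mat eval_nat_numeral less_Suc_eq)
  have 2: "dsum comul_mat comul_mat = (fun_mat 4 2 (\<lambda>i. if i < 2 then 0 else 1) :: 'r mat)"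
    by (rule eq_matI) (auto simp: index_dsum comul_mat_def index_fun_mat)
  have 3: "dsum (1\<^sub>m 1) (dsum (swap_mat 1 1) (1\<^sub>m 1)) * dsum comul_mat comul_mat =
      (fun_mat 4 2 (\<lambda>i. if i = 0 \<or> i = 2 then 0 else 1) :: 'r mat)"
    unfolding 1 2 by (subst fun_mat_comp) (auto intro!: fun_mat_cong)
  show ?thesis
    unfolding 3 by (rule eq_matI, simp_all add: generator_mult, auto simp: index_fun_mat mul_mat_def less_Suc_eq numeral_2_eq_2)
qed

lemma bicommutative_bimonoid_generic_bimonoid:
  "bicommutative_bimonoid (Mat (R :: 'r::comm_rig itself)) generic_bimonoid"
proof -
  interpret M: symmetric_monoidal_category "Mat R" by (rule symmetric_monoidal_category_Mat)
  have inv: "inv_arr (Mat R) (1\<^sub>m n) = 1\<^sub>m n" for n using M.inv_arr_Idn(2)[of n] by simp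
  \<comment> \<open>The associators are identities here, so only the whiskered symmetry
    survives.\<close>
  have middle: "middle_swap (Mat R) 1 = dsum (1\<^sub>m 1) (dsum (swap_mat 1 1) (1\<^sub>m 1))"
    by (simp add: middle_swap_def inv del: One_nat_def)
  have m1: "mul_mat * dsum mul_mat (1\<^sub>m 1) = (mul_mat * dsum (1\<^sub>m 1) mul_mat :: 'r mat)"
    by (rule eq_matI, simp_all add: generator_mult, auto simp: index_dsum mul_mat_def less_Suc_eq)
  have m2: "mul_mat * dsum unit_mat (1\<^sub>m 1) = (1\<^sub>m 1 :: 'r mat)" "mul_mat * dsum (1\<^sub>m 1) unit_mat = (1\<^sub>m 1 :: 'r mat)"
    "mul_mat * swap_mat 1 1 = (mul_mat :: 'r mat)"
    by (rule eq_matI; simp add: generator_mult;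
        auto simp: index_dsum generator_defs swap_mat_def less_Suc_eq numeral_2_eq_2)+
  have c1: "dsum comul_mat (1\<^sub>m 1) * comul_mat = (dsum (1\<^sub>m 1) comul_mat * comul_mat :: 'r mat)"
    unfolding comul_mat_eq_fun_mat one_eq_fun_mat
    by (simp add: dsum_fun_mat del: One_nat_def) (simp add: fun_mat_comp eval_nat_numeral)
  have c2: "dsum counit_mat (1\<^sub>m 1) * comul_mat = (1\<^sub>m 1 :: 'r mat)" "dsum (1\<^sub>m 1) counit_mat * comul_mat = (1\<^sub>m 1 :: 'r mat)"
    by (rule eq_matI; simp add: scalar_prod_def numeral_2_eq_2 index_dsum generator_defs)+
  have c3: "swap_mat 1 1 * comul_mat = (comul_mat :: 'r mat)"
    unfolding swap_mat_eq_fun_mat comul_mat_eq_fun_mat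
    by (simp add: fun_mat_comp flip: numeral_2_eq_2)
  have b: "comul_mat * unit_mat = (dsum unit_mat unit_mat * 1\<^sub>m 0 :: 'r mat)"
    "counit_mat * mul_mat = (1\<^sub>m 0 * dsum counit_mat counit_mat :: 'r mat)"
    "counit_mat * unit_mat = (1\<^sub>m 0 :: 'r mat)"
    by (rule eq_matI; simp)+
  \<comment> \<open>The simplifier writes the object 1 as \<open>Suc 0\<close>, so the laws have to
    be restated in that form to match.\<close>
  note laws = inv middle[unfolded One_nat_def] m1[unfolded One_nat_def] m2[unfolded One_nat_def]
    c1[unfolded One_nat_def] c2[unfolded One_nat_def] c3[unfolded One_nat_def] b
    comul_mat_mul_mat[unfolded One_nat_def]
  show ?thesis
    by unfold_locales (simp_all add: laws)
qed

lemma rig_hom_scalar_mat: "scalar_mat \<in> rig_hom (End (Mat (R :: 'r::comm_rig itself)) generic_bimonoid)"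
proof -
  have hom: "mul_mat * dsum (scalar_mat r) (scalar_mat r) = scalar_mat r * (mul_mat :: 'r mat)"
    "scalar_mat r * unit_mat = (unit_mat :: 'r mat)"
    "comul_mat * scalar_mat r = dsum (scalar_mat r) (scalar_mat r) * (comul_mat :: 'r mat)"
    "counit_mat * scalar_mat r = (counit_mat :: 'r mat)" for r
    by (rule eq_matI; simp add: generator_mult; auto simp: index_dsum generator_defs less_Suc_eq numeral_2_eq_2)+
  have zero: "scalar_mat 0 = (unit_mat * counit_mat :: 'r mat)"
    by (rule eq_matI) (simp_all add: generator_defs scalar_prod_def)
  have plus: "scalar_mat (r + s) = (mul_mat * (dsum (scalar_mat r) (scalar_mat s) * comul_mat) :: 'r mat)" for r s
    by (rule eq_matI) (simp_all add: generator_mult, simp_all add: generator_defs)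
  have one: "scalar_mat 1 = (1\<^sub>m 1 :: 'r mat)"
    by (rule eq_matI) (simp_all add: scalar_mat_def)
  have times: "scalar_mat (r * s) = scalar_mat r * (scalar_mat s :: 'r mat)" for r s
    by (rule eq_matI) (simp_all add: generator_mult, simp_all add: scalar_mat_def)
  show ?thesis
    by (simp add: rig_hom_def End_def bimonoid_homs_def hom zero plus one[unfolded One_nat_def] times)
qed

section \<open>Matrices are generated by the operations of the generic bimonoid\<close>

text \<open>A matrix is its rows applied to copies of the input. Copies come from
  \<open>comul_mat\<close> and symmetries, a row adds up scalars by \<open>mul_mat\<close>, and the
  empty cases come from \<open>unit_mat\<close> and \<open>counit_mat\<close>.\<close>

lemma matrix_induct [case_names mult dsum one swap mul unit comul counit scalar]:
  fixes P :: "'r::comm_rig mat \<Rightarrow> bool"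
  assumes mult: "\<And>M N. \<lbrakk>P M; P N; dim_col N = dim_row M\<rbrakk> \<Longrightarrow> P (N * M)"
    and dsum: "\<And>M N. \<lbrakk>P M; P N\<rbrakk> \<Longrightarrow> P (dsum M N)"
    and one: "\<And>n. P (1\<^sub>m n)" and swap: "\<And>m n. P (swap_mat m n)"
    and mul: "P mul_mat" and unit: "P unit_mat" and comul: "P comul_mat" and counit: "P counit_mat"
    and scalar: "\<And>r. P (scalar_mat r)"
  shows "P M"
proof -
  \<comment> \<open>The diagonal of the object \<open>n\<close>: two identity matrices
    stacked.\<close>
  define dup :: "nat \<Rightarrow> 'r mat" where "dup n = fun_mat (n + n) n (\<lambda>i. if i < n then i else i - n)" for n
  have dim_dup [simp]: "dim_row (dup n) = n + n" "dim_col (dup n) = n" for n by (simp_all add: dup_def)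
  have dup: "P (dup n)" for n
  proof (induction n)
    case 0
    have "dup 0 = 1\<^sub>m 0" by (rule eq_matI) simp_all
    then show ?case using one by simp
  next
    case (Suc n)
    \<comment> \<open>The nested conditionals are those produced by applying
      \<open>dsum_fun_mat\<close> twice to the reordering below.\<close>
    let ?p = "\<lambda>i. if i < n then i else n + (if i - n < 1 + n then if i - n < 1 then n + (i - n) else i - n - 1 else n + 1 + (i - n - (1 + n)))"
    have 1: "dsum (1\<^sub>m n) (dsum (swap_mat n 1) (1\<^sub>m 1)) = (fun_mat (Suc n + Suc n) (n + n + 2) ?p :: 'r mat)"
    proof -
      have "dsum (swap_mat n 1) (1\<^sub>m 1) = (fun_mat (1 + n + 1) (n + 1 + 1)
          (\<lambda>i. if i < 1 + n then if i < 1 then n + i else i - 1 else n + 1 + (i - (1 + n))) :: 'r mat)"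
        unfolding swap_mat_eq_fun_mat one_eq_fun_mat by (subst dsum_fun_mat) auto
      then show ?thesis
        unfolding one_eq_fun_mat[of n] by (auto simp: dsum_fun_mat intro!: fun_mat_cong)
    qed
    have 2: "dsum (dup n) comul_mat = (fun_mat (n + n + 2) (n + 1)
        (\<lambda>i. if i < n + n then if i < n then i else i - n else n) :: 'r mat)"
      unfolding dup_def comul_mat_eq_fun_mat by (subst dsum_fun_mat) (auto intro!: fun_mat_cong)
    \<comment> \<open>Duplicating the first \<open>n\<close> entries and the last one separately
      yields x, x, y, y; exchanging the second x with the first y gives x, y, x, y.\<close>
    have "dup (Suc n) = dsum (1\<^sub>m n) (dsum (swap_mat n 1) (1\<^sub>m 1)) * dsum (dup n) comul_mat"
      unfolding 1 2 unfolding dup_def by (subst fun_mat_comp) (auto intro!: fun_mat_cong)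
    then show ?case
      using Suc by (simp only:) (intro mult dsum one swap comul; simp)
  qed
  have row: "P M" if "dim_row M = 1" for M
    using that
  proof (induction "dim_col M" arbitrary: M)
    case 0
    then have "M = unit_mat" by (intro eq_matI) (simp_all add: unit_mat_def)
    then show ?case using unit by simp
  next
    case (Suc n)
    let ?M = "mat 1 n (\<lambda>(i, j). M $$ (0, j))" and ?r = "M $$ (0, n)"
    \<comment> \<open>The last entry is split off as a scalar and added to the shorter row.\<close>
    have "M = mul_mat * dsum ?M (scalar_mat ?r)"
    proof (rule eq_matI)
      fix i j assume "i < dim_row (mul_mat * dsum ?M (scalar_mat ?r))" "j < dim_col (mul_mat * dsum ?M (scalar_mat ?r))"
      then have "i = 0" "j < Suc n" by simp_all
      moreover from this have "j = n \<or> j < n" by auto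
      ultimately show "M $$ (i, j) = (mul_mat * dsum ?M (scalar_mat ?r)) $$ (i, j)"
        by (auto simp add: generator_mult index_dsum scalar_mat_def)
    qed (use Suc in simp_all)
    moreover have "P ?M" using Suc by simp
    ultimately show ?case
      using mult[OF dsum[OF _ scalar] mul] by (metis dim_dsum(1) dim_generators(2,9) dim_row_mat(1) one_add_one)
  qed
  \<comment> \<open>With no rows there is nothing to stack; such a matrix is a direct sum of
    counits.\<close>
  have zero: "P (0\<^sub>m 0 n)" for n
  proof (induction n)
    case 0
    have "0\<^sub>m 0 0 = (1\<^sub>m 0 :: 'r mat)" by (rule eq_matI) simp_all
    then show ?case using one[of 0] by simp
  next
    case (Suc n)
    have "0\<^sub>m 0 (Suc n) = (dsum (0\<^sub>m 0 n) counit_mat :: 'r mat)" by (rule eq_matI) simp_all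
    then show ?case using dsum[OF Suc counit] by simp
  qed
  show ?thesis
  proof (induction "dim_row M" arbitrary: M)
    case 0
    then have "M = 0\<^sub>m 0 (dim_col M)" by (intro eq_matI) simp_all
    then show ?case using zero by metis
  next
    case (Suc n)
    let ?m = "dim_col M"
    let ?M = "mat n ?m (\<lambda>(i, j). M $$ (i, j))" and ?R = "mat 1 ?m (\<lambda>(i, j). M $$ (n, j))"
    \<comment> \<open>The two right-hand blocks have no columns. They only serve to make stacking a
      four-block product.\<close>
    have d: "dup ?m = four_block_mat (1\<^sub>m ?m) (0\<^sub>m ?m 0) (1\<^sub>m ?m) (0\<^sub>m ?m 0)"
      by (rule eq_matI) (auto simp: dup_def index_fun_mat)
    have "dsum ?M ?R * dup ?m = four_block_mat ?M (0\<^sub>m n 0) ?R (0\<^sub>m 1 0)"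
      unfolding d dsum_def
      by (subst mult_four_block_mat[where ?nr1.0 = n and ?nr2.0 = 1 and
          ?n1.0 = ?m and ?n2.0 = ?m and ?nc1.0 = ?m and ?nc2.0 = 0])
        (auto intro!: cong_four_block_mat carrier_matI)
    also have "\<dots> = M"
    proof (rule eq_matI)
      fix i j assume "i < dim_row M" "j < dim_col M"
      moreover from this have "i = n \<or> i < n" using Suc by auto
      ultimately show "four_block_mat ?M (0\<^sub>m n 0) ?R (0\<^sub>m 1 0) $$ (i, j) = M $$ (i, j)"
        using Suc by auto
    qed (use Suc in simp_all)
    finally have "M = dsum ?M ?R * dup ?m" ..
    moreover have "P (dsum ?M ?R * dup ?m)"
      by (rule mult[OF dup dsum]) (use Suc row in simp_all)
    ultimately show ?case by simp
  qed
qed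

section \<open>Monoidal transformations between algebras\<close>

locale algebra_pair = F: strong_functor "Mat R" C F + G: strong_functor "Mat R" C G
  for R :: "'r::comm_rig itself" and C :: "('o, 'm, 'x) smc_data_scheme" (structure) and F G

context algebra_pair
begin

text \<open>Every object is an iterated sum of 1, and the invertible structure maps of
  \<open>F\<close> determine the component at 0 and the one at \<open>n + 1\<close> from those at
  \<open>n\<close> and 1.\<close>

lemma transformation_unique:
  assumes \<theta>: "monoidal_transformation (Mat R) C F G \<theta>" and \<theta>': "monoidal_transformation (Mat R) C F G \<theta>'"
    and eq: "\<theta> 1 = \<theta>' 1"
  shows "\<theta> n = \<theta>' n"
proof -
  note [simp] = monoidal_transformationD(1-3)[OF \<theta>] monoidal_transformationD(1-3)[OF \<theta>']
  show ?thesis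
  proof (induction n)
    case 0
    have "\<theta> 0 \<cdot> Phi0 F = \<theta>' 0 \<cdot> Phi0 F"
      using monoidal_transformationD(6)[OF \<theta>] monoidal_transformationD(6)[OF \<theta>'] by simp
    then show ?case by (rule F.T.iso_cancel_right) simp_all
  next
    case (Suc n)
    have "\<theta> (n + 1) \<cdot> Phi2 F n 1 = \<theta>' (n + 1) \<cdot> Phi2 F n 1"
      using monoidal_transformationD(5)[OF \<theta>, of n 1] monoidal_transformationD(5)[OF \<theta>', of n 1] Suc eq
      by (simp del: One_nat_def add_Suc_right)
    then have "\<theta> (n + 1) = \<theta>' (n + 1)" by (rule F.T.iso_cancel_right) simp_all
    then show ?case by simp
  qed
qed

text \<open>Compatibility with \<open>Phi0\<close> and with \<open>Phi2\<close> at \<open>n\<close>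
  and 1 forces this recursion, so it is the only possible monoidal family with \<open>f\<close> at
  1.\<close>

primrec extend :: "'m \<Rightarrow> nat \<Rightarrow> 'm" where
  "extend f 0 = Phi0 G \<cdot> inv_arr C (Phi0 F)"
| "extend f (Suc n) = Phi2 G n 1 \<cdot> (extend f n \<boxtimes> f) \<cdot> inv_arr C (Phi2 F n 1)"

context
  fixes f :: 'm
  assumes f: "f \<in> bimonoid_homs C (image_bimonoid C F generic_bimonoid) (image_bimonoid C G generic_bimonoid)"
    and f_scalar: "\<And>r. f \<cdot> FunA F (scalar_mat r) = FunA G (scalar_mat r) \<cdot> f"
begin

lemmas f_simps [simp] = bimonoid_homsD(1-3)[OF f, simplified image_bimonoid_simps generic_bimonoid_simps]
lemmas f_laws = bimonoid_homsD(4-7)[OF f, simplified image_bimonoid_simps generic_bimonoid_simps]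

declare One_nat_def [simp del]

lemma extend_simps [simp]:
  "extend f n \<in> Arr C" "Dom C (extend f n) = FunO F n" "Cod C (extend f n) = FunO G n"
  by (induction n) (simp_all flip: Suc_eq_plus1)

lemma extend_Suc: "extend f (n + 1) \<cdot> Phi2 F n 1 = Phi2 G n 1 \<cdot> (extend f n \<boxtimes> f)"
  by (simp flip: Suc_eq_plus1)

text \<open>The recursion reaches 1 through an extra unit factor, which the unit coherence of
  \<open>F\<close> and \<open>G\<close> removes.\<close>

lemma extend_one: "extend f 1 = f"
proof (rule F.T.iso_cancel_right)
  have F: "Phi2 F 0 1 \<cdot> (Phi0 F \<boxtimes> Idn C (FunO F 1)) = lunit C (FunO F 1)"
    using F.Phi_lunit[of 1] F.FA_Idn[of 1] by simp
  have G: "Phi2 G 0 1 \<cdot> (Phi0 G \<boxtimes> Idn C (FunO G 1)) = lunit C (FunO G 1)"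
    using G.Phi_lunit[of 1] G.FA_Idn[of 1] by simp
  have "extend f 1 \<cdot> Phi2 F 0 1 \<cdot> (Phi0 F \<boxtimes> Idn C (FunO F 1)) =
      Phi2 G 0 1 \<cdot> (Phi0 G \<boxtimes> f)"
    using F.T.Cmp_reassoc[OF extend_Suc[of 0], of "Phi0 F \<boxtimes> Idn C (FunO F 1)"]
    by (simp add: F.T.TenA_merge)
  also have "\<dots> = (Phi2 G 0 1 \<cdot> (Phi0 G \<boxtimes> Idn C (FunO G 1))) \<cdot> (Idn C \<I> \<boxtimes> f)"
    by (simp add: F.T.TenA_merge)
  also have "\<dots> = f \<cdot> lunit C (FunO F 1)"
    unfolding G by (simp add: F.T.lunit_nat)
  finally show "extend f 1 \<cdot> lunit C (FunO F 1) = f \<cdot> lunit C (FunO F 1)"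
    unfolding F .
qed simp_all

text \<open>The recursion gives this only for \<open>b = 1\<close>. Induction on \<open>b\<close>
  moves one summand across, using associativity coherence of both functors; the base case is their
  right unit law.\<close>

lemma extend_monoidal: "extend f (a + b) \<cdot> Phi2 F a b = Phi2 G a b \<cdot> (extend f a \<boxtimes> extend f b)"
proof (induction b)
  case 0
  have F: "Phi2 F a 0 \<cdot> (Idn C (FunO F a) \<boxtimes> Phi0 F) = runit C (FunO F a)"
    using F.Phi_runit[of a] F.FA_Idn[of a] by simp
  have G: "Phi2 G a 0 \<cdot> (Idn C (FunO G a) \<boxtimes> Phi0 G) = runit C (FunO G a)"
    using G.Phi_runit[of a] G.FA_Idn[of a] by simp
  let ?i = "Idn C (FunO F a) \<boxtimes> Phi0 F"
  have "(Phi2 G a 0 \<cdot> (extend f a \<boxtimes> extend f 0)) \<cdot> ?i =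
      (Phi2 G a 0 \<cdot> (Idn C (FunO G a) \<boxtimes> Phi0 G)) \<cdot> (extend f a \<boxtimes> Idn C \<I>)"
    by (simp add: F.T.TenA_merge)
  also have "\<dots> = extend f a \<cdot> Phi2 F a 0 \<cdot> ?i"
    unfolding F G by (simp add: F.T.runit_nat)
  finally have "(extend f (a + 0) \<cdot> Phi2 F a 0) \<cdot> ?i = (Phi2 G a 0 \<cdot> (extend f a \<boxtimes> extend f 0)) \<cdot> ?i"
    by simp
  then show ?case by (rule F.T.iso_cancel_right) simp_all
next
  case (Suc b)
  have F: "Phi2 F (a + b) 1 \<cdot> (Phi2 F a b \<boxtimes> Idn C (FunO F 1)) =
      Phi2 F a (b + 1) \<cdot> (Idn C (FunO F a) \<boxtimes> Phi2 F b 1) \<cdot> assoc C (FunO F a) (FunO F b) (FunO F 1)"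
    using F.Phi_assoc[of a b 1] F.FA_Idn[of "a + b + 1"] by (simp add: add.assoc)
  have G: "Phi2 G (a + b) 1 \<cdot> (Phi2 G a b \<boxtimes> Idn C (FunO G 1)) =
      Phi2 G a (b + 1) \<cdot> (Idn C (FunO G a) \<boxtimes> Phi2 G b 1) \<cdot> assoc C (FunO G a) (FunO G b) (FunO G 1)"
    using G.Phi_assoc[of a b 1] G.FA_Idn[of "a + b + 1"] by (simp add: add.assoc)
  \<comment> \<open>An isomorphism that exposes the source as a threefold tensor product, so that
    the associativity coherence \<open>F\<close> applies; it is cancelled at the end.\<close>
  let ?i = "(Idn C (FunO F a) \<boxtimes> Phi2 F b 1) \<cdot> assoc C (FunO F a) (FunO F b) (FunO F 1)"
  have "extend f (a + b + 1) \<cdot> Phi2 F a (b + 1) \<cdot> ?i =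
      (extend f (a + b + 1) \<cdot> Phi2 F (a + b) 1) \<cdot> (Phi2 F a b \<boxtimes> Idn C (FunO F 1))"
    unfolding F[symmetric] by (simp add: add.assoc del: extend.simps)
  also have "\<dots> = Phi2 G (a + b) 1 \<cdot> ((extend f (a + b) \<cdot> Phi2 F a b) \<boxtimes> f)"
    unfolding extend_Suc by (simp add: F.T.TenA_merge)
  also have "\<dots> = (Phi2 G (a + b) 1 \<cdot> (Phi2 G a b \<boxtimes> Idn C (FunO G 1))) \<cdot> ((extend f a \<boxtimes> extend f b) \<boxtimes> f)"
    unfolding Suc by (simp add: F.T.TenA_merge)
  also have "\<dots> = Phi2 G a (b + 1) \<cdot> (extend f a \<boxtimes> (Phi2 G b 1 \<cdot> (extend f b \<boxtimes> f))) \<cdot>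
      assoc C (FunO F a) (FunO F b) (FunO F 1)"
    unfolding G by (simp add: F.T.assoc_nat F.T.TenA_merge)
  also have "\<dots> = (Phi2 G a (b + 1) \<cdot> (extend f a \<boxtimes> extend f (b + 1))) \<cdot> ?i"
    unfolding extend_Suc[symmetric] by (simp add: F.T.TenA_merge del: extend.simps)
  finally have "(extend f (a + (b + 1)) \<cdot> Phi2 F a (b + 1)) \<cdot> ?i =
      (Phi2 G a (b + 1) \<cdot> (extend f a \<boxtimes> extend f (b + 1))) \<cdot> ?i"
    by (simp add: add.assoc del: extend.simps)
  then have "extend f (a + (b + 1)) \<cdot> Phi2 F a (b + 1) = Phi2 G a (b + 1) \<cdot> (extend f a \<boxtimes> extend f (b + 1))"
    by (rule F.T.iso_cancel_right) (simp_all add: F.T.is_iso_Cmp add.assoc del: extend.simps)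
  then show ?case by (simp only: Suc_eq_plus1)
qed

lemma extend_monoidal_tail:
  assumes "k \<in> Arr C" "Cod C k = FunO F a \<boxdot> FunO F b"
  shows "extend f (a + b) \<cdot> Phi2 F a b \<cdot> k = Phi2 G a b \<cdot> (extend f a \<boxtimes> extend f b) \<cdot> k"
  using F.T.Cmp_reassoc[OF extend_monoidal[of a b], of k] assms by simp

text \<open>Sums and symmetries need only that the family is monoidal. Each operation of the generic
  bimonoid uses the matching homomorphism law of \<open>f\<close>, and scalars use that
  \<open>f\<close> commutes with the actions.\<close>

lemma extend_natural: "extend f (dim_row M) \<cdot> FunA F M = FunA G M \<cdot> extend f (dim_col M)"
proof (induction M rule: matrix_induct)
  case (mult M N)
  have "extend f (dim_row N) \<cdot> FunA F (N * M) = (extend f (dim_row N) \<cdot> FunA F N) \<cdot> FunA F M"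
    using mult(3) F.FA_Cmp'[of M N] by simp
  also have "\<dots> = FunA G N \<cdot> extend f (dim_row M) \<cdot> FunA F M"
    unfolding mult(2) using mult(3) by simp
  also have "\<dots> = FunA G (N * M) \<cdot> extend f (dim_col M)"
    unfolding mult(1) using mult(3) G.FA_Cmp'[of M N] by simp
  finally show ?case by simp
next
  case (dsum M N)
  have "(extend f (dim_row M + dim_row N) \<cdot> FunA F (dsum M N)) \<cdot> Phi2 F (dim_col M) (dim_col N) =
      extend f (dim_row M + dim_row N) \<cdot> Phi2 F (dim_row M) (dim_row N) \<cdot> (FunA F M \<boxtimes> FunA F N)"
    using F.Phi2_nat(1)[of M N] by simp
  also have "\<dots> = Phi2 G (dim_row M) (dim_row N) \<cdot> (FunA G M \<boxtimes> FunA G N) \<cdot> (extend f (dim_col M) \<boxtimes> extend f (dim_col N))"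
    by (simp add: extend_monoidal_tail F.T.TenA_merge dsum)
  also have "\<dots> = (FunA G (dsum M N) \<cdot> extend f (dim_col M + dim_col N)) \<cdot> Phi2 F (dim_col M) (dim_col N)"
    using F.T.Cmp_reassoc[OF G.Phi2_natural'[of M N], of _ _ "extend f (dim_col M) \<boxtimes> extend f (dim_col N)"]
    by (simp add: extend_monoidal)
  finally have "extend f (dim_row M + dim_row N) \<cdot> FunA F (dsum M N) =
      FunA G (dsum M N) \<cdot> extend f (dim_col M + dim_col N)"
    by (rule F.T.iso_cancel_right) simp_all
  then show ?case by simp
next
  case (one n)
  show ?case using F.FA_Idn[of n] G.FA_Idn[of n] by simp
next
  case (swap m n)
  let ?s = "symm C (FunO F m) (FunO F n)"
  have "(extend f (n + m) \<cdot> FunA F (swap_mat m n)) \<cdot> Phi2 F m n = extend f (n + m) \<cdot> Phi2 F n m \<cdot> ?s"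
    using F.Phi_symm[of m n] by simp
  also have "\<dots> = Phi2 G n m \<cdot> symm C (FunO G m) (FunO G n) \<cdot> (extend f m \<boxtimes> extend f n)"
    by (simp add: extend_monoidal_tail F.T.symm_nat)
  also have "\<dots> = (FunA G (swap_mat m n) \<cdot> Phi2 G m n) \<cdot> (extend f m \<boxtimes> extend f n)"
    using G.Phi_symm[of m n] by simp
  also have "\<dots> = (FunA G (swap_mat m n) \<cdot> extend f (m + n)) \<cdot> Phi2 F m n"
    by (simp add: extend_monoidal)
  finally have "extend f (n + m) \<cdot> FunA F (swap_mat m n) = FunA G (swap_mat m n) \<cdot> extend f (m + n)"
    by (rule F.T.iso_cancel_right) simp_all
  then show ?case by simp
next
  case mul
  \<comment> \<open>The homomorphism law of \<open>f\<close> is naturality precomposed with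
    \<open>Phi2 F 1 1\<close>, because the image multiplication contains that map.\<close>
  have "(extend f 1 \<cdot> FunA F mul_mat) \<cdot> Phi2 F 1 1 = (FunA G mul_mat \<cdot> extend f (1 + 1)) \<cdot> Phi2 F 1 1"
    using f_laws(1) extend_monoidal[of 1 1] by (simp add: extend_one del: extend.simps)
  then show ?case
    using F.T.iso_cancel_right[of "extend f 1 \<cdot> FunA F mul_mat" "Phi2 F 1 1" "FunA G mul_mat \<cdot> extend f 2"]
    by (simp del: extend.simps)
next
  case unit
  have "(extend f 1 \<cdot> FunA F unit_mat) \<cdot> Phi0 F = (FunA G unit_mat \<cdot> extend f 0) \<cdot> Phi0 F"
    using f_laws(2) by (simp add: extend_one)
  then show ?case
    using F.T.iso_cancel_right[of "extend f 1 \<cdot> FunA F unit_mat" "Phi0 F" "FunA G unit_mat \<cdot> extend f 0"]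
    by (simp del: extend.simps)
next
  case comul
  \<comment> \<open>Inserting the structure map and its inverse exposes the comultiplication of the
    image bimonoid.\<close>
  have "extend f (1 + 1) \<cdot> FunA F comul_mat =
      extend f (1 + 1) \<cdot> Phi2 F 1 1 \<cdot> inv_arr C (Phi2 F 1 1) \<cdot> FunA F comul_mat"
    by (simp del: extend.simps)
  also have "\<dots> = Phi2 G 1 1 \<cdot> (f \<boxtimes> f) \<cdot> inv_arr C (Phi2 F 1 1) \<cdot> FunA F comul_mat"
    by (subst extend_monoidal_tail) (simp_all add: extend_one)
  also have "\<dots> = FunA G comul_mat \<cdot> f"
    unfolding f_laws(3)[symmetric] by simp
  finally show ?case by (simp add: extend_one del: extend.simps)
next
  case counit
  have "extend f 0 \<cdot> FunA F counit_mat = Phi0 G \<cdot> inv_arr C (Phi0 F) \<cdot> FunA F counit_mat"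
    by simp
  also have "\<dots> = FunA G counit_mat \<cdot> f"
    unfolding f_laws(4)[symmetric] by simp
  finally show ?case by (simp add: extend_one del: extend.simps)
next
  case (scalar r)
  show ?case using f_scalar by (simp add: extend_one del: extend.simps)
qed

lemma monoidal_transformation_extend: "monoidal_transformation (Mat R) C F G (extend f)"
  unfolding monoidal_transformation_def natural_transformation_def
  using extend_monoidal extend_natural by (auto simp: in_hom_def[of C])

end

end

section \<open>The equivalence\<close>

lemma hom_category_simps [simp]:
  "Obj (hom_category X H i c) = X"
  "(a, b, f) \<in> Arr (hom_category X H i c) \<longleftrightarrow> a \<in> X \<and> b \<in> X \<and> f \<in> H a b"
  "Dom (hom_category X H i c) (a, b, f) = a" "Cod (hom_category X H i c) (a, b, f) = b"
  "Idn (hom_category X H i c) a = (a, a, i a)"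
  "Cmp (hom_category X H i c) (b', d, g) (a, b, f) = (a, d, c g f)"
  by (simp_all add: hom_category_def)

lemma in_hom_hom_category:
  "in_hom (hom_category X H i c) x a b \<longleftrightarrow> (\<exists>f. x = (a, b, f) \<and> a \<in> X \<and> b \<in> X \<and> f \<in> H a b)"
  by (cases x) (auto simp: in_hom_def)

lemma category_hom_category:
  assumes "\<And>a. a \<in> X \<Longrightarrow> i a \<in> H a a"
    and "\<And>a b d f g. \<lbrakk>a \<in> X; b \<in> X; d \<in> X; f \<in> H a b; g \<in> H b d\<rbrakk> \<Longrightarrow> c g f \<in> H a d"
    and "\<And>a b f. \<lbrakk>a \<in> X; b \<in> X; f \<in> H a b\<rbrakk> \<Longrightarrow> c f (i a) = f"
    and "\<And>a b f. \<lbrakk>a \<in> X; b \<in> X; f \<in> H a b\<rbrakk> \<Longrightarrow> c (i b) f = f"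
    and "\<And>a b d e f g h. \<lbrakk>a \<in> X; b \<in> X; d \<in> X; e \<in> X; f \<in> H a b; g \<in> H b d; h \<in> H d e\<rbrakk> \<Longrightarrow>
      c (c h g) f = c h (c g f)"
  shows "category (hom_category X H i c)"
proof
  fix f assume "f \<in> Arr (hom_category X H i c)"
  then show "Dom (hom_category X H i c) f \<in> Obj (hom_category X H i c)"
    "Cod (hom_category X H i c) f \<in> Obj (hom_category X H i c)"
    by (cases f; simp)+
qed (use assms in \<open>auto simp: in_hom_hom_category\<close>)

lemma is_iso_hom_category:
  assumes "a \<in> X" "b \<in> X" "f \<in> H a b" "g \<in> H b a" "c g f = i a" "c f g = i b"
  shows "is_iso (hom_category X H i c) (a, b, f)"
  unfolding is_iso_def inverse_arrows_def
  by (rule exI[of _ "(b, a, g)"]) (use assms in \<open>simp add: in_hom_hom_category\<close>)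

text \<open>Each law for the inverse is the law for \<open>f\<close> with \<open>f\<close>
  cancelled. It is needed because an isomorphism of modules requires an inverse that is again a
  homomorphism.\<close>

lemma (in symmetric_monoidal_category) bimonoid_homs_inv_arr:
  assumes "bicommutative_bimonoid C A" "bicommutative_bimonoid C B"
    and f: "f \<in> bimonoid_homs C A B" and iso [simp]: "is_iso C f"
  shows "inv_arr C f \<in> bimonoid_homs C B A"
proof -
  interpret A: bicommutative_bimonoid C A by fact
  interpret B: bicommutative_bimonoid C B by fact
  note [simp] = bimonoid_homsD(1-3)[OF f] and laws = bimonoid_homsD(4-7)[OF f]
  let ?g = "inv_arr C f"
  have "Mul A \<cdot> (?g \<boxtimes> ?g) = ?g \<cdot> Mul B"
    using inv_arr_move_right[of "?g \<cdot> Mul B" "f \<boxtimes> f" "Mul A"] laws(1) by simp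
  moreover have "?g \<cdot> One B = One A"
    using laws(2) by (simp flip: laws(2))
  moreover have "Comul A \<cdot> ?g = (?g \<boxtimes> ?g) \<cdot> Comul B"
    using inv_arr_move_left[of "f \<boxtimes> f" "Comul A \<cdot> ?g" "Comul B"] Cmp_reassoc[OF laws(3), of ?g, symmetric]
    by simp
  moreover have "Counit A \<cdot> ?g = Counit B"
    by (simp flip: laws(4))
  ultimately show ?thesis
    by (simp add: bimonoid_homs_def in_hom_def)
qed

section \<open>Recovering a module from its functor, up to isomorphism\<close>

context rig_module
begin

text \<open>The comparison from the constructed algebra at 1, whose carrier is
  \<open>\<I> \<boxdot> A\<close>, to \<open>A\<close>: the counit of the equivalence, not the
  counit of the bimonoid.\<close>

definition counit_map :: 'm where
  "counit_map = lu (Car K)"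

lemma counit_map_eq_proj: "counit_map = proj 1 0"
  by (simp add: counit_map_def lunit_eq_pr2)

lemma chom_counit_map: "chom (T 1) K counit_map"
  unfolding counit_map_eq_proj by (rule chom_proj) simp

lemma counit_map_simps [simp]:
  "counit_map \<in> Arr C" "Dom C counit_map = Car (T 1)" "Cod C counit_map = Car K" "is_iso C counit_map"
  using chomD(3-5)[OF chom_counit_map] by (simp_all add: counit_map_def)

text \<open>As the comparison is the sole coordinate of \<open>T 1\<close>, all four laws are
  statements about coordinates: the row of two ones gives convolution of the two projections, and
  the column of two ones gives the diagonal.\<close>

lemma counit_map_bimonoid_homs: "counit_map \<in> bimonoid_homs C (image_bimonoid C module_functor generic_bimonoid) A"
proof -
  let ?e = counit_map
  note e = chom_counit_map
  have mul: "Mul A \<cdot> (?e \<boxtimes> ?e) = ?e \<cdot> mat_map mul_mat \<cdot> join 1 1"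
  proof -
    let ?X = "tens (T 1) (T 1)"
    have j: "chom ?X (T 2) (join 1 1)" using chom_join[of 1 1] by (simp del: T.simps add: numeral_2_eq_2)
    have p: "proj 2 0 \<cdot> join 1 1 = ?e \<cdot> pr1 (T 1) (T 1)" "proj 2 1 \<cdot> join 1 1 = ?e \<cdot> pr2 (T 1) (T 1)"
      using proj_join[of 0 1 1] proj_join[of 1 1 1] unfolding counit_map_eq_proj one_add_one by simp_all
    have h: "chom ?X K (?e \<cdot> pr1 (T 1) (T 1))" "chom ?X K (?e \<cdot> pr2 (T 1) (T 1))"
      by (rule chom_Cmp[OF chom_pr1 e] chom_Cmp[OF chom_pr2 e]; simp)+
    have "?e \<cdot> mat_map mul_mat \<cdot> join 1 1 = lsum ?X 2 (\<lambda>j. \<phi> (mul_mat $$ (0, j)) \<cdot> proj 2 j \<cdot> join 1 1)"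
      using proj_mat_map_Cmp[of ?X mul_mat "join 1 1" 0] j by (simp add: counit_map_eq_proj)
    also have "\<dots> = add ?X (?e \<cdot> pr1 (T 1) (T 1)) (?e \<cdot> pr2 (T 1) (T 1))"
      using p h by (simp add: numeral_2_eq_2 mul_mat_def action_one add_nil del: T.simps)
    also have "\<dots> = Mul A \<cdot> (?e \<boxtimes> ?e)"
      using chom_eq_pair[OF chom_TenA[OF e e]] by (simp add: add_def pr_TenA[OF e e])
    finally show ?thesis ..
  qed
  have one: "?e \<cdot> mat_map unit_mat \<cdot> \<iota> \<I> = One A"
  proof -
    have "mat_map unit_mat \<cdot> \<iota> \<I> = mat_map unit_mat"
      using mat_map_simps[of unit_mat] by simp
    moreover have "proj 1 0 \<cdot> mat_map unit_mat = row_map unit_mat 0"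
      using proj_mat_map[of 0 unit_mat] by simp
    ultimately show ?thesis
      by (simp add: counit_map_eq_proj row_map_def nil_def)
  qed
  have comul: "Dup K \<cdot> ?e = (?e \<boxtimes> ?e) \<cdot> inv_arr C (join 1 1) \<cdot> mat_map comul_mat"
  proof (rule chom_tens_ext)
    have m: "chom (T 1) (T (1 + 1)) (mat_map comul_mat)"
      using chom_mat_map[of comul_mat] by (simp del: T.simps add: numeral_2_eq_2)
    note [simp] = chomD(3-5)[OF m]
    have s: "chom (T 1) (tens (T 1) (T 1)) (split 1 1 \<cdot> mat_map comul_mat)"
      by (rule chom_Cmp[OF m chom_split])
    show "chom (T 1) (tens K K) (Dup K \<cdot> ?e)" by (rule chom_Cmp[OF e chom_Dup]) simp
    show "chom (T 1) (tens K K) ((?e \<boxtimes> ?e) \<cdot> inv_arr C (join 1 1) \<cdot> mat_map comul_mat)"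
      unfolding join_iso(2) by (rule chom_Cmp[OF s chom_TenA[OF e e]])
    have row: "proj (1 + 1) j \<cdot> mat_map comul_mat = ?e" if "j < 2" for j
      unfolding comul_mat_eq_fun_mat counit_map_eq_proj one_add_one using that by (intro proj_fun_mat) simp_all
    have "pr1 K K \<cdot> (?e \<boxtimes> ?e) \<cdot> split 1 1 \<cdot> mat_map comul_mat = ?e"
      using Cmp_reassoc[OF pr_TenA(1)[OF e e], of "split 1 1 \<cdot> mat_map comul_mat"]
        Cmp_reassoc[OF proj_split(1)[of 0 1 1], of "mat_map comul_mat"] row[of 0]
      by (simp add: counit_map_eq_proj del: T.simps proj.simps One_nat_def)
    then show "pr1 K K \<cdot> Dup K \<cdot> ?e = pr1 K K \<cdot> (?e \<boxtimes> ?e) \<cdot> inv_arr C (join 1 1) \<cdot> mat_map comul_mat"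
      unfolding join_iso(2) using Cmp_reassoc[OF pr_Dup(1)[OF cocomm_K], of ?e] by (simp del: T.simps)
    have "pr2 K K \<cdot> (?e \<boxtimes> ?e) \<cdot> split 1 1 \<cdot> mat_map comul_mat = ?e"
      using Cmp_reassoc[OF pr_TenA(2)[OF e e], of "split 1 1 \<cdot> mat_map comul_mat"]
        Cmp_reassoc[OF proj_split(2)[of 0 1 1], of "mat_map comul_mat"] row[of 1]
      by (simp add: counit_map_eq_proj del: T.simps proj.simps One_nat_def)
    then show "pr2 K K \<cdot> Dup K \<cdot> ?e = pr2 K K \<cdot> (?e \<boxtimes> ?e) \<cdot> inv_arr C (join 1 1) \<cdot> mat_map comul_mat"
      unfolding join_iso(2) using Cmp_reassoc[OF pr_Dup(2)[OF cocomm_K], of ?e] by (simp del: T.simps)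
  qed simp_all
  \<comment> \<open>The matrix has no rows, so its image is the empty tuple, which is the counit of
    \<open>T 1\<close>.\<close>
  have counit: "Del K \<cdot> ?e = inv_arr C (\<iota> \<I>) \<cdot> mat_map counit_mat"
    using chomD(7)[OF e] by (simp add: mat_map_def)
  show ?thesis
    using mul one comul counit by (simp add: bimonoid_homs_def in_hom_def K_simps[symmetric])
qed

lemma counit_map_scalar: "counit_map \<cdot> mat_map (scalar_mat r) = \<phi> r \<cdot> counit_map"
proof -
  have "counit_map \<cdot> mat_map (scalar_mat r) = row_map (scalar_mat r) 0"
    using proj_mat_map[of 0 "scalar_mat r"] by (simp add: counit_map_eq_proj)
  also have "\<dots> = \<phi> r \<cdot> counit_map"
    using add_nil(1)[OF chom_action[OF chom_counit_map, of r]]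
    by (simp add: row_map_def scalar_mat_def counit_map_eq_proj)
  finally show ?thesis .
qed

end

section \<open>Both sides are categories, and they are equivalent\<close>

lemma (in symmetric_monoidal_category) category_BimonR: "category (BimonR TYPE('r::comm_rig) C)"
  unfolding BimonR_def
\<comment> \<open>Goals 1 and 2 say that identities and composites are equivariant homomorphisms;
  the category laws are inherited from \<open>C\<close>.\<close>
proof (rule category_hom_category, goal_cases)
  case (1 a)
  then obtain A \<phi> where a: "a = (A, \<phi>)" "bicommutative_bimonoid C A" "\<phi> \<in> rig_hom (End C A)" by auto
  interpret A: rig_module C A \<phi> using a by (simp add: rig_module_def rig_module_axioms_def)
  show ?case using A.action_simps by (simp add: a bimonoid_homs_def in_hom_def A.K_simps)
next
  case (2 a b d f g)
  obtain A \<phi> B \<psi> D \<chi> where abd: "a = (A, \<phi>)" "b = (B, \<psi>)" "d = (D, \<chi>)" by (metis surj_pair)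
  interpret A: rig_module C A \<phi> using 2 abd by (simp add: rig_module_def rig_module_axioms_def)
  interpret B: rig_module C B \<psi> using 2 abd by (simp add: rig_module_def rig_module_axioms_def)
  interpret D: rig_module C D \<chi> using 2 abd by (simp add: rig_module_def rig_module_axioms_def)
  have f: "f \<in> bimonoid_homs C A B" "f \<cdot> \<phi> r = \<psi> r \<cdot> f"
    and g: "g \<in> bimonoid_homs C B D" "g \<cdot> \<psi> r = \<chi> r \<cdot> g" for r
    using 2 by (auto simp: abd)
  note f = bimonoid_homsD[OF f(1)] f(2) and g = bimonoid_homsD[OF g(1)] g(2)
  note [simp] = f(1-3) g(1-3) A.K_simps(1) B.K_simps(1) D.K_simps(1)
  have "Mul D \<cdot> ((g \<cdot> f) \<boxtimes> (g \<cdot> f)) = Mul D \<cdot> (g \<boxtimes> g) \<cdot> (f \<boxtimes> f)"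
    by (simp add: TenA_merge)
  also have "\<dots> = (g \<cdot> f) \<cdot> Mul A"
    using Cmp_reassoc[OF g(4), of "f \<boxtimes> f"] by (simp add: f(4))
  finally have 1: "Mul D \<cdot> ((g \<cdot> f) \<boxtimes> (g \<cdot> f)) = (g \<cdot> f) \<cdot> Mul A" .
  have 2: "(g \<cdot> f) \<cdot> One A = One D" by (simp add: f(5) g(5))
  have 3: "Comul D \<cdot> g \<cdot> f = ((g \<cdot> f) \<boxtimes> (g \<cdot> f)) \<cdot> Comul A"
    using Cmp_reassoc[OF g(6), of f] by (simp add: f(6) TenA_merge)
  have 4: "Counit D \<cdot> g \<cdot> f = Counit A"
    using Cmp_reassoc[OF g(7), of f] by (simp add: f(7))
  have 5: "(g \<cdot> f) \<cdot> \<phi> r = \<chi> r \<cdot> g \<cdot> f" for r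
    using Cmp_reassoc[OF g(8)[of r], of f] by (simp add: f(8))
  show ?case using 1 2 3 4 5 by (simp add: abd bimonoid_homs_def in_hom_def)
qed (auto simp: bimonoid_homs_def in_hom_def)

lemma (in symmetric_monoidal_category) category_Alg:
  assumes T: "is_PROP T"
  shows "category (Alg T C)"
  unfolding Alg_def
proof -
  have T': "symmetric_monoidal_category T" "Obj T = UNIV" using T by (auto simp: is_PROP_def)
  interpret T: symmetric_monoidal_category T by (rule T')
  show "category (hom_category {F. symmetric_monoidal_functor T C F \<and> FunA F \<in> extensional (Arr T)}
     (\<lambda>F G. {\<theta>. monoidal_transformation T C F G \<theta>}) (\<lambda>F n. Idn C (FunO F n)) (\<lambda>\<psi> \<theta> n. \<psi> n \<cdot> \<theta> n))"
  proof (rule category_hom_category, goal_cases)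
    case (1 F)
    then interpret F: strong_functor T C F by (simp add: strong_functor_def)
    show ?case
      using T'(2) by (auto simp: monoidal_transformation_def natural_transformation_def in_hom_def)
  next
    case (2 F G H \<theta> \<psi>)
    interpret F: strong_functor T C F using 2 by (simp add: strong_functor_def)
    interpret G: strong_functor T C G using 2 by (simp add: strong_functor_def)
    interpret H: strong_functor T C H using 2 by (simp add: strong_functor_def)
    have m: "monoidal_transformation T C F G \<theta>" "monoidal_transformation T C G H \<psi>" using 2 by simp_all
    note m1 = monoidal_transformationD[OF m(1)] and m2 = monoidal_transformationD[OF m(2)]
    note [simp] = m1(1-3) m2(1-3) T'(2)
    have "(\<psi> (Cod T f) \<cdot> \<theta> (Cod T f)) \<cdot> FunA F f = FunA H f \<cdot> \<psi> (Dom T f) \<cdot> \<theta> (Dom T f)"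
      if "f \<in> Arr T" for f
      using that Cmp_reassoc[OF m2(4)[OF that], of "\<theta> (Dom T f)"] by (simp add: m1(4))
    moreover have "(\<psi> (TenO T a b) \<cdot> \<theta> (TenO T a b)) \<cdot> Phi2 F a b = Phi2 H a b \<cdot> ((\<psi> a \<cdot> \<theta> a) \<boxtimes> (\<psi> b \<cdot> \<theta> b))"
      for a b
      using Cmp_reassoc[OF m2(5)[of a b], of "\<theta> a \<boxtimes> \<theta> b"] by (simp add: m1(5) TenA_merge)
    moreover have "(\<psi> (unit T) \<cdot> \<theta> (unit T)) \<cdot> Phi0 F = Phi0 H"
      by (simp add: m1(6) m2(6))
    ultimately show ?case
      by (auto simp: monoidal_transformation_def natural_transformation_def in_hom_def)
  next
    \<comment> \<open>Associativity is an equality of functions on all naturals. It can be checked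
      at every argument because every natural number is an object of the PROP.\<close>
    case (5 F G H K \<theta> \<psi> \<chi>)
    then have m: "monoidal_transformation T C F G \<theta>" "monoidal_transformation T C G H \<psi>"
      "monoidal_transformation T C H K \<chi>" by simp_all
    show ?case using m[THEN monoidal_transformationD(1)] m[THEN monoidal_transformationD(2)]
        m[THEN monoidal_transformationD(3)] T'(2) by (simp add: fun_eq_iff)
  qed (use T'(2) monoidal_transformationD(1-3) in \<open>fastforce simp: fun_eq_iff\<close>)+
qed

theorem theorem5:
  fixes C :: "('o, 'm) smc_data"
  assumes "symmetric_monoidal_category C"
  shows "is_PROP (Mat TYPE('r::comm_rig)) \<and>
         equivalent_categories (Alg (Mat TYPE('r)) C) (BimonR TYPE('r) C)"
proof
  interpret C: symmetric_monoidal_category C by fact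
  let ?M = "Mat TYPE('r)" and ?g = "generic_bimonoid :: (nat, 'r mat) bimonoid_data"
  show PROP: "is_PROP ?M" by (rule is_PROP_Mat)
  note g = bicommutative_bimonoid_generic_bimonoid[of "TYPE('r)"]
  \<comment> \<open>Evaluation at the generic bimonoid and its scalars; on transformations it takes
    the component at 1.\<close>
  define FO :: "(nat, 'r mat, 'o, 'm) monoidal_functor_data \<Rightarrow> ('o, 'm) bimonoid_data \<times> ('r \<Rightarrow> 'm)"
    where "FO F = (image_bimonoid C F ?g, \<lambda>r. FunA F (scalar_mat r))" for F
  define FA where "FA = (\<lambda>(F, G, \<theta>). (FO F, FO G, \<theta> (1::nat) :: 'm))"
  \<comment> \<open>Every matrix is an arrow, so being extensional outside the arrows is
    automatic.\<close>
  have Alg_Obj: "F \<in> Obj (Alg ?M C) \<longleftrightarrow> symmetric_monoidal_functor ?M C F" for F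
    by (simp add: Alg_def extensional_def)
  have in_Alg: "in_hom (Alg ?M C) x F G \<longleftrightarrow> (\<exists>\<theta>. x = (F, G, \<theta>) \<and> symmetric_monoidal_functor ?M C F \<and>
      symmetric_monoidal_functor ?M C G \<and> monoidal_transformation ?M C F G \<theta>)" for x F G
    unfolding Alg_def in_hom_hom_category by (simp add: extensional_def)
  have FO: "FO F \<in> Obj (BimonR TYPE('r) C)" if "symmetric_monoidal_functor ?M C F" for F
  proof -
    interpret F: strong_functor ?M C F by (rule strong_functor.intro) fact
    show ?thesis
      using F.image_bicommutative_bimonoid[OF g] F.image_rig_hom[OF g rig_hom_scalar_mat]
      by (simp add: BimonR_def FO_def)
  qed
  have FA: "in_hom (BimonR TYPE('r) C) (FA (F, G, \<theta>)) (FO F) (FO G)"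
    if F: "symmetric_monoidal_functor ?M C F" and G: "symmetric_monoidal_functor ?M C G"
      and \<theta>: "monoidal_transformation ?M C F G \<theta>" for F G \<theta>
  proof -
    have "\<theta> 1 \<cdot>\<^bsub>C\<^esub> FunA F (scalar_mat r) = FunA G (scalar_mat r) \<cdot>\<^bsub>C\<^esub> \<theta> 1" for r
      using monoidal_transformationD(4)[OF \<theta>, of "scalar_mat r"] by simp
    then show ?thesis
      using FO[OF F] FO[OF G] monoidal_transformation_bimonoid_homs[OF F G \<theta> g]
      by (simp add: BimonR_def in_hom_hom_category FO_def FA_def)
  qed
  have "category_functor (Alg ?M C) (BimonR TYPE('r) C) FO FA"
  proof (intro category_functor.intro category_functor_axioms.intro)
    show "category (Alg ?M C)" by (rule C.category_Alg[OF PROP])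
    show "category (BimonR TYPE('r) C)" by (rule C.category_BimonR)
    show "FO F \<in> Obj (BimonR TYPE('r) C)" if "F \<in> Obj (Alg ?M C)" for F
      using that FO by (simp add: Alg_Obj)
    show "in_hom (BimonR TYPE('r) C) (FA x) (FO F) (FO G)" if "in_hom (Alg ?M C) x F G" for x F G
      using that FA by (auto simp: in_Alg)
    show "FA (Idn (Alg ?M C) F) = Idn (BimonR TYPE('r) C) (FO F)" if "F \<in> Obj (Alg ?M C)" for F
      by (simp add: Alg_def BimonR_def FA_def FO_def)
    show "FA (y \<cdot>\<^bsub>Alg ?M C\<^esub> x) = FA y \<cdot>\<^bsub>BimonR TYPE('r) C\<^esub> FA x"
      if "in_hom (Alg ?M C) x F G" "in_hom (Alg ?M C) y G H" for x y F G H
      using that unfolding in_Alg by (auto simp: Alg_def BimonR_def FA_def)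
  qed
  then interpret \<Phi>: category_functor "Alg ?M C" "BimonR TYPE('r) C" FO FA .
  show "equivalent_categories (Alg ?M C) (BimonR TYPE('r) C)"
  \<comment> \<open>Fullness comes from \<open>extend\<close>, faithfulness from determination at 1,
    and essential surjectivity from \<open>module_functor\<close> with \<open>counit_map\<close> as
    the isomorphism.\<close>
  proof (rule \<Phi>.fully_faithful_ess_surj_equivalence)
    fix F G h
    assume "F \<in> Obj (Alg ?M C)" "G \<in> Obj (Alg ?M C)" and h: "in_hom (BimonR TYPE('r) C) h (FO F) (FO G)"
    then have FG: "symmetric_monoidal_functor ?M C F" "symmetric_monoidal_functor ?M C G"
      by (simp_all add: Alg_Obj)
    then interpret algebra_pair "TYPE('r)" C F G by (simp add: algebra_pair_def strong_functor_def)
    obtain f where f: "h = (FO F, FO G, f)" "f \<in> bimonoid_homs C (image_bimonoid C F ?g) (image_bimonoid C G ?g)"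
      "\<And>r. f \<cdot>\<^bsub>C\<^esub> FunA F (scalar_mat r) = FunA G (scalar_mat r) \<cdot>\<^bsub>C\<^esub> f"
      using h by (auto simp: BimonR_def in_hom_hom_category FO_def)
    have "in_hom (Alg ?M C) (F, G, extend f) F G"
      using FG monoidal_transformation_extend[OF f(2,3)] by (simp add: in_Alg)
    moreover have "FA (F, G, extend f) = h"
      using extend_one[OF f(2,3)] by (simp add: FA_def f(1))
    ultimately show "\<exists>x. in_hom (Alg ?M C) x F G \<and> FA x = h" by blast
  next
    fix F G x y
    assume "in_hom (Alg ?M C) x F G" "in_hom (Alg ?M C) y F G" and eq: "FA x = FA y"
    then obtain \<theta> \<psi> where FG: "symmetric_monoidal_functor ?M C F" "symmetric_monoidal_functor ?M C G"
      and \<theta>: "x = (F, G, \<theta>)" "monoidal_transformation ?M C F G \<theta>"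
      and \<psi>: "y = (F, G, \<psi>)" "monoidal_transformation ?M C F G \<psi>"
      by (auto simp: in_Alg)
    interpret algebra_pair "TYPE('r)" C F G using FG by (simp add: algebra_pair_def strong_functor_def)
    have "\<theta> = \<psi>"
      using transformation_unique[OF \<theta>(2) \<psi>(2)] eq by (auto simp: FA_def \<theta>(1) \<psi>(1))
    then show "x = y" by (simp add: \<theta> \<psi>)
  next
    fix b assume b: "b \<in> Obj (BimonR TYPE('r) C)"
    then obtain A \<phi> where A: "b = (A, \<phi>)" "bicommutative_bimonoid C A" "\<phi> \<in> rig_hom (End C A)"
      by (auto simp: BimonR_def)
    interpret rig_module C A \<phi> using A by (simp add: rig_module_def rig_module_axioms_def)
    let ?F = module_functor and ?e = counit_map
    have F: "symmetric_monoidal_functor ?M C ?F" by (rule symmetric_monoidal_functor_module_functor)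
    then interpret F: strong_functor ?M C ?F by (rule strong_functor.intro)
    note FA' = F.image_bicommutative_bimonoid[OF g] F.image_rig_hom[OF g rig_hom_scalar_mat]
    have "?e \<in> bimonoid_homs C (image_bimonoid C ?F ?g) A" by (rule counit_map_bimonoid_homs)
    moreover have "inv_arr C ?e \<in> bimonoid_homs C A (image_bimonoid C ?F ?g)"
      using C.bimonoid_homs_inv_arr[OF FA'(1) A(2) counit_map_bimonoid_homs] by simp
    \<comment> \<open>Equivariance of the inverse, checked after composing with \<open>?e\<close>;
      it belongs to the inverse morphism that \<open>is_iso_hom_category\<close> demands.\<close>
    moreover have "inv_arr C ?e \<cdot>\<^bsub>C\<^esub> \<phi> r = mat_map (scalar_mat r) \<cdot>\<^bsub>C\<^esub> inv_arr C ?e" for r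
    proof (rule C.iso_cancel_left[where f = ?e])
      have "?e \<cdot>\<^bsub>C\<^esub> mat_map (scalar_mat r) \<cdot>\<^bsub>C\<^esub> inv_arr C ?e = \<phi> r \<cdot>\<^bsub>C\<^esub> ?e \<cdot>\<^bsub>C\<^esub> inv_arr C ?e"
        using C.Cmp_reassoc[OF counit_map_scalar[of r], of "inv_arr C ?e"] mat_map_simps[of "scalar_mat r"] by simp
      then show "?e \<cdot>\<^bsub>C\<^esub> inv_arr C ?e \<cdot>\<^bsub>C\<^esub> \<phi> r = ?e \<cdot>\<^bsub>C\<^esub> mat_map (scalar_mat r) \<cdot>\<^bsub>C\<^esub> inv_arr C ?e"
        by simp
    qed (use mat_map_simps[of "scalar_mat r"] in simp_all)
    ultimately have "in_hom (BimonR TYPE('r) C) (FO ?F, b, ?e) (FO ?F) b" "is_iso (BimonR TYPE('r) C) (FO ?F, b, ?e)"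
      using FA' A counit_map_scalar unfolding BimonR_def
      by (auto simp: in_hom_hom_category FO_def K_simps[symmetric] intro!: is_iso_hom_category[where g = "inv_arr C ?e"])
    then show "\<exists>F\<in>Obj (Alg ?M C). \<exists>e. in_hom (BimonR TYPE('r) C) e (FO F) b \<and> is_iso (BimonR TYPE('r) C) e"
      using Alg_Obj F by blast
  qed
qed

end
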